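(* There exists a measurable function $p:\mathbb{T}\to[1,\infty)$ with $1<p(x)<\infty$ for a.e. $x$ such that the space $C(\mathbb{T})$ of continuous functions is a closed subspace of $L^{p(\cdot)}(\mathbb{T})$ and, with $q$ the conjugate exponent of $p$ (that is, $1/p(x)+1/q(x)=1$), both the Kolmogorov example $K$ and the Marcinkiewicz example $M$ belong to $L^{q(\cdot)}(\mathbb{T})$. Here this means: there are a choice of the functions $\phi_n$ (as constructed in the context) and strictly increasing sequences of integers such that the corresponding functions $K$ and $M$ of the form given in the context belong to $L^{q(\cdot)}(\mathbb{T})$ and satisfy $$\limsup_{n\to\infty}|S_n(x,K)|=\infty\ \text{ for a.e. } x,$$ $$\limsup_{n\to\infty}|S_n(x,M)|<\infty\ \text{ for a.e. } x,\quad\text{and } (S_n(x,M))_n \text{ diverges for a.e. } x .$$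
   Context: $\mathbb{T}=\mathbb{R}/(2\pi\mathbb{Z})$. For measurable $p:\mathbb{T}\to[1,\infty)$ (values mattering only up to null sets), $L^{p(\cdot)}(\mathbb{T})$ is the space of measurable $f$ on $\mathbb{T}$ with $\int_{\mathbb{T}}(|f(x)|/\lambda)^{p(x)}dx<\infty$ for some $\lambda>0$, normed by $\|f\|_{p(\cdot)}=\inf\{\lambda>0:\int_{\mathbb{T}}(|f(x)|/\lambda)^{p(x)}dx\le1\}$. For $f\in L^1(\mathbb{T})$, $S_n(x,f)=\sum_{k=-n}^n\widehat f(k)e^{ikx}$ with $\widehat f(k)=\frac1{2\pi}\int_{\mathbb{T}}f(x)e^{-ikx}dx$. Construction of $\phi_n$ ($n\ge2$). Let $A_k=\frac{4\pi k}{2n+1}$ $(k=1,\dots,n)$. Let $1=\lambda_1<\lambda_2<\dots<\lambda_n$ be odd integers and define $m_1=n$ and $2m_k+1=\lambda_k(2n+1)$ for $k=2,\dots,n$. Let $\Delta_k=(A_k,A_k+\frac{2}{m_k^2})$ $(k=1,\dots,n)$; these are non-overlapping. Let $\phi_n$ be the $2\pi$-periodic function with $\phi_n(x)=m_k^2/n$ for $x\in\Delta_k$ $(k=1,\dots,n)$ and $\phi_n(x)=0$ for $x\in[0,2\pi]\setminus\bigcup_{k=1}^n\Delta_k$. Put $D_k=[A_k+\frac1{n\log n},A_{k+1}-\frac1{n\log n}]$ $(k=1,\dots,n-1)$ and $L_r(t)=\frac{\sin((r+\frac12)t)}{2\sin(t/2)}$. The numbers $m_k$ (equivalently $\lambda_k$),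 $k\ge2$, are chosen inductively so large that $$\left|\frac1\pi\int_{\bigcup_{j=1}^{k-1}\Delta_j}\phi_n(t)L_{m_k}(t-x)\,dt\right|<1\quad\text{for all }x\in D_{k-1}.$$ The Kolmogorov and Marcinkiewicz examples are functions of the form $$K(x)=\sum_{k=1}^\infty\frac{\phi_{n_k}(x)}{\sqrt{\log n_k}},\qquad M(x)=\sum_{k=1}^\infty\frac{\phi_{n_k}(x)}{\log n_k},$$ respectively, where in each case $(n_k)$ is a suitably chosen strictly increasing sequence of integers $\ge2$ (possibly different for $K$ and $M$). *)

theory Defs
  imports "HOL-Analysis.Analysis" "HOL-Library.Periodic_Fun"
begin

text \<open>
  Functions on the circle \<open>\<real> / 2\<pi>\<int>\<close> are represented by \<open>2\<pi>\<close>-periodic functions on the real line;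
  integrals and null sets refer to Lebesgue measure on the fundamental domain \<open>[0, 2\<pi>)\<close>.
\<close>

abbreviation circle_periodic :: "(real \<Rightarrow> 'a) \<Rightarrow> bool" where
  "circle_periodic f \<equiv> periodic_fun_simple f (2 * pi)"

definition circle :: "real measure" where
  "circle = lebesgue_on {0..<2 * pi}"

definition circle_continuous :: "(real \<Rightarrow> complex) set" where
  "circle_continuous = {f. circle_periodic f \<and> continuous_on UNIV f}"


definition variable_exponent :: "(real \<Rightarrow> real) \<Rightarrow> bool" where
  "variable_exponent p \<longleftrightarrow>
     circle_periodic p \<and> p \<in> borel_measurable circle \<and> (\<forall>x. 1 \<le> p x)"

definition modular :: "(real \<Rightarrow> real) \<Rightarrow> real \<Rightarrow> (real \<Rightarrow> complex) \<Rightarrow> ennreal" where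
  "modular p c f = (\<integral>\<^sup>+ x. ennreal ((cmod (f x) / c) powr p x) \<partial>circle)"

definition variable_Lp :: "(real \<Rightarrow> real) \<Rightarrow> (real \<Rightarrow> complex) set" where
  "variable_Lp p =
     {f. circle_periodic f \<and> f \<in> borel_measurable circle \<and> (\<exists>c>0. modular p c f < \<infinity>)}"

definition variable_norm :: "(real \<Rightarrow> real) \<Rightarrow> (real \<Rightarrow> complex) \<Rightarrow> real" where
  "variable_norm p f = Inf {c. 0 < c \<and> modular p c f \<le> 1}"

text \<open>
  \<open>variable_Lp p\<close> consists of functions rather than of classes modulo null sets, so the limit in the
  closedness condition (the last conjunct) is only required to agree almost everywhere with an
  element of \<open>V\<close>.
\<close>

definition closed_subspace_Lp :: "(real \<Rightarrow> real) \<Rightarrow> (real \<Rightarrow> complex) set \<Rightarrow> bool" where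
  "closed_subspace_Lp p V \<longleftrightarrow>
     V \<subseteq> variable_Lp p \<and>
     (\<lambda>x. 0) \<in> V \<and>
     (\<forall>f\<in>V. \<forall>g\<in>V. (\<lambda>x. f x + g x) \<in> V) \<and>
     (\<forall>a. \<forall>f\<in>V. (\<lambda>x. a * f x) \<in> V) \<and>
     (\<forall>f\<in>variable_Lp p.
        (\<forall>e>0. \<exists>g\<in>V. variable_norm p (\<lambda>x. f x - g x) < e) \<longrightarrow>
        (\<exists>g\<in>V. AE x in circle. f x = g x))"


definition fourier_coeff :: "(real \<Rightarrow> complex) \<Rightarrow> int \<Rightarrow> complex" where
  "fourier_coeff f k =
     1 / (2 * complex_of_real pi) *
     (\<integral>x. f x * exp (- (\<i> * of_int k * complex_of_real x)) \<partial>circle)"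

definition fourier_sum :: "nat \<Rightarrow> real \<Rightarrow> (real \<Rightarrow> complex) \<Rightarrow> complex" where
  "fourier_sum n x f =
     (\<Sum>k = - int n..int n. fourier_coeff f k * exp (\<i> * of_int k * complex_of_real x))"


definition node :: "nat \<Rightarrow> nat \<Rightarrow> real" where
  "node n k = 4 * pi * real k / (2 * real n + 1)"

definition spike :: "nat \<Rightarrow> (nat \<Rightarrow> nat) \<Rightarrow> nat \<Rightarrow> real set" where
  "spike n m k = {node n k <..< node n k + 2 / (real (m k))\<^sup>2}"

definition gap :: "nat \<Rightarrow> nat \<Rightarrow> real set" where
  "gap n k = {node n k + 1 / (real n * ln (real n)) .. node n (k + 1) - 1 / (real n * ln (real n))}"

definition dirichlet_kernel :: "nat \<Rightarrow> real \<Rightarrow> real" where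
  "dirichlet_kernel r t = sin ((real r + 1 / 2) * t) / (2 * sin (t / 2))"

text \<open>
  \<open>f\<close> is one of the possible functions \<open>\<phi>\<^sub>n\<close>; \<open>l\<close> and \<open>m\<close> are the sequences \<open>\<lambda>\<^sub>k\<close> and \<open>m\<^sub>k\<close>, whose values
  matter only for \<open>1 \<le> k \<le> n\<close>.
\<close>

definition admissible_phi :: "nat \<Rightarrow> (real \<Rightarrow> real) \<Rightarrow> bool" where
  "admissible_phi n f \<longleftrightarrow>
     (\<exists>l m :: nat \<Rightarrow> nat.
        l 1 = 1 \<and> strict_mono_on {1..n} l \<and> (\<forall>k\<in>{1..n}. odd (l k)) \<and>
        m 1 = n \<and> (\<forall>k\<in>{2..n}. 2 * m k + 1 = l k * (2 * n + 1)) \<and>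
        circle_periodic f \<and>
        (\<forall>k\<in>{1..n}. \<forall>x\<in>spike n m k. f x = (real (m k))\<^sup>2 / real n) \<and>
        (\<forall>x\<in>{0..2 * pi} - (\<Union>k\<in>{1..n}. spike n m k). f x = 0) \<and>
        (\<forall>k\<in>{2..n}. \<forall>x\<in>gap n (k - 1).
           \<bar>1 / pi * (LINT t:(\<Union>j\<in>{1..k - 1}. spike n m j)|lebesgue.
              f t * dirichlet_kernel (m k) (t - x))\<bar> < 1))"

text \<open>
  Sequences \<open>n\<^sub>1 < n\<^sub>2 < \<dots>\<close> are indexed from \<open>0\<close>. As \<^term>\<open>suminf\<close> is unspecified on divergent series,
  convergence almost everywhere has to be required separately.
\<close>

definition kolmogorov_term :: "(nat \<Rightarrow> real \<Rightarrow> real) \<Rightarrow> (nat \<Rightarrow> nat) \<Rightarrow> real \<Rightarrow> nat \<Rightarrow> real" where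
  "kolmogorov_term \<phi> \<nu> x k = \<phi> (\<nu> k) x / sqrt (ln (real (\<nu> k)))"

definition marcinkiewicz_term :: "(nat \<Rightarrow> real \<Rightarrow> real) \<Rightarrow> (nat \<Rightarrow> nat) \<Rightarrow> real \<Rightarrow> nat \<Rightarrow> real" where
  "marcinkiewicz_term \<phi> \<nu> x k = \<phi> (\<nu> k) x / ln (real (\<nu> k))"

definition kolmogorov_fun :: "(nat \<Rightarrow> real \<Rightarrow> real) \<Rightarrow> (nat \<Rightarrow> nat) \<Rightarrow> real \<Rightarrow> complex" where
  "kolmogorov_fun \<phi> \<nu> x = complex_of_real (\<Sum>k. kolmogorov_term \<phi> \<nu> x k)"

definition marcinkiewicz_fun :: "(nat \<Rightarrow> real \<Rightarrow> real) \<Rightarrow> (nat \<Rightarrow> nat) \<Rightarrow> real \<Rightarrow> complex" where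
  "marcinkiewicz_fun \<phi> \<nu> x = complex_of_real (\<Sum>k. marcinkiewicz_term \<phi> \<nu> x k)"

end

theory Submission
  imports Defs "HOL-Real_Asymp.Real_Asymp"
begin

text \<open>
  The exponent may be taken close to \<open>1\<close> exactly where the two examples are large. Both examples are
  non-negative sums over the spikes of the functions \<open>\<phi>\<^sub>\<nu>\<close>, and the spikes of all levels together form
  a very sparse, but dense, set. The conjugate pair used here is
  \<open>p = 2 + \<Sum>\<^sub>k \<nu>\<^sub>k \<phi>\<^bsub>\<nu>\<^sub>k\<^esub>\<close> and \<open>q = p / (p - 1)\<close>. On the one hand \<open>p - 1\<close> dominates both
  examples almost everywhere, so that \<open>y\<^sup>q = y \<cdot> y\<^bsup>1/(p-1)\<^esup> \<le> e y\<close> for their values \<open>y\<close>, and integrability is enough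
  for membership in \<open>L\<^sup>q\<close> (\<open>powr_conjugate_le\<close>, \<open>series_in_variable_Lp\<close>). On the other hand a spike of
  width \<open>2/m\<^sup>2\<close> has \<open>p \<ge> 2 + m\<^sup>2\<close> at almost all of its points, hence \<open>\<integral> 2\<^sup>p > 2\<close> over every interval,
  and a continuous function whose modular at scale \<open>c\<close> is at most \<open>2\<close> is bounded by \<open>2c\<close>
  (\<open>sup_le_of_modular\<close>). So convergence in \<open>L\<^sup>p\<close> of continuous functions is uniform convergence, and \<open>C\<close> is closed.

  The behaviour of the Fourier sums rests on three facts about a single function \<open>\<phi>\<^sub>n\<close>.

  \<^item> Its Fourier sums are \<open>O(log n)\<close>, uniformly in the order, away from a set of measure
    \<open>O(1/log n)\<close>: the spikes have mass \<open>2/n\<close> each and are spaced like \<open>1/n\<close>, and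
    \<open>|L\<^sub>r(u)|\<close> is at most a constant times \<open>1/|u|\<close> for \<open>|u| \<le> \<pi>\<close>, so a harmonic sum appears (\<open>fourier_sum_f_le\<close>).
  \<^item> Between the nodes \<open>k - 1\<close> and \<open>k\<close> the sum of order \<open>m\<^sub>k\<close> has modulus at least a constant times
    \<open>|sin ((m\<^sub>k + 1/2) x)| log (n - k + 1) - 1\<close>. As \<open>(m\<^sub>k + 1/2) A\<^sub>j\<close> is a multiple of \<open>2\<pi>\<close>, all
    the later spikes contribute with the same sign, and the earlier ones contribute less than \<open>1\<close> by
    the choice of \<open>m\<^sub>k\<close> (\<open>fourier_sum_f_ge\<close>). The points where the sine is below \<open>\<delta>\<close> have measure
    \<open>O(\<delta>)\<close> (\<open>measure_bad_points\<close>).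
  \<^item> They converge to \<open>\<phi>\<^sub>n\<close> almost everywhere, since \<open>\<phi>\<^sub>n\<close> is a step function
    (\<open>AE_fourier_sum_f_tendsto\<close>).

  Such functions exist because the earlier spikes stay away from the relevant points, where the
  Dirichlet integrals decay like the inverse of the order (\<open>exists_admissible_phi\<close>).

  If the levels \<open>\<nu>\<^sub>k\<close> grow fast enough, the orders split into consecutive blocks in which only one
  level is active: the lower ones have already converged, and the higher ones have too small an
  \<open>L\<^sup>1\<close> norm to be noticed. The Fourier sum is then, up to a vanishing error, a fixed number plus the
  weight times the Fourier sum of the active level (\<open>block_estimate\<close>). At the beginning of a block
  the active level is also negligible, so that the sums tend to that number there. Inside the
  blocks the active level reaches the size \<open>weight \<cdot> log \<nu>\<^sub>k\<close> infinitely often and never exceeds a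
  multiple of it. For the weight \<open>1/\<surd>log \<nu>\<^sub>k\<close> this product is unbounded; for \<open>1/log \<nu>\<^sub>k\<close> it is \<open>1\<close>,
  which gives boundedness and divergence at the same time. One sequence \<open>\<nu>\<close> serves both examples.
\<close>

section \<open>The Dirichlet kernel and Fourier sums on the circle\<close>

text \<open>
  Integration by parts: the antiderivative of the sine supplies the factor \<open>1/M\<close>, and the remaining
  factor and its derivative are controlled by the lower bound \<open>s\<close>. The bound depends on the position
  of the interval only through \<open>s\<close>, which makes it uniform in \<open>x\<close>.
\<close>

lemma oscillatory_integral_bound:
  fixes a b M s x :: real
  assumes ab: "a \<le> b" "b - a \<le> 2 * pi" and M: "0 < M" and s: "0 < s"
    and sin: "\<And>u. u \<in> {a..b} \<Longrightarrow> s \<le> \<bar>sin ((u - x) / 2)\<bar>"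
  shows "\<bar>integral {a..b} (\<lambda>u. sin (M * (u - x)) / (2 * sin ((u - x) / 2)))\<bar> \<le> 3 / (M * s\<^sup>2)"
proof -
  define F where "F = (\<lambda>u. - cos (M * (u - x)) / (M * (2 * sin ((u - x) / 2))))"
  define h where "h = (\<lambda>u. cos (M * (u - x)) * cos ((u - x) / 2) / (4 * (sin ((u - x) / 2))\<^sup>2))"
  define g where "g = (\<lambda>u. sin (M * (u - x)) / (2 * sin ((u - x) / 2)))"
  have nz: "sin ((u - x) / 2) \<noteq> 0" if "u \<in> {a..b}" for u
    using sin[OF that] s by auto
  have s1: "s \<le> 1"
    using order_trans[OF sin abs_sin_le_one, of a] ab by simp
  have d: "(F has_real_derivative (g u + h u / M)) (at u within {a..b})" if "u \<in> {a..b}" for u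
  proof -
    have n: "M * (2 * sin ((u - x) / 2)) \<noteq> 0" using nz[OF that] M by simp
    have "(F has_real_derivative
        ((sin (M * (u - x)) * M) * (M * (2 * sin ((u - x) / 2))) - (- cos (M * (u - x))) * (M * cos ((u - x) / 2))) /
        ((M * (2 * sin ((u - x) / 2))) * (M * (2 * sin ((u - x) / 2))))) (at u within {a..b})"
      unfolding F_def
      by (rule DERIV_divide) (use n in \<open>auto intro!: derivative_eq_intros\<close>)
    moreover have "((sin (M * (u - x)) * M) * (M * (2 * sin ((u - x) / 2))) - (- cos (M * (u - x))) * (M * cos ((u - x) / 2))) /
        ((M * (2 * sin ((u - x) / 2))) * (M * (2 * sin ((u - x) / 2)))) = g u + h u / M"
      unfolding g_def h_def using nz[OF that] M
      by (simp add: divide_simps power2_eq_square) (simp add: algebra_simps)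
    ultimately show ?thesis by simp
  qed
  have "((\<lambda>u. g u + h u / M) has_integral (F b - F a)) {a..b}"
    using ab d by (intro fundamental_theorem_of_calculus)
      (auto simp: has_real_derivative_iff_has_vector_derivative[symmetric])
  moreover have hi: "h integrable_on {a..b}"
    unfolding h_def using nz by (intro integrable_continuous_real continuous_intros) auto
  moreover have gi: "g integrable_on {a..b}"
    unfolding g_def using nz by (intro integrable_continuous_real continuous_intros) auto
  ultimately have eq: "integral {a..b} g = F b - F a - integral {a..b} h / M"
  proof -
    assume *: "((\<lambda>u. g u + h u / M) has_integral (F b - F a)) {a..b}"
    have "((\<lambda>u. g u + h u / M) has_integral (integral {a..b} g + integral {a..b} h / M)) {a..b}"
      using hi gi by (intro has_integral_add has_integral_divide integrable_integral)
    from has_integral_unique[OF * this] show ?thesis by linarith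
  qed
  have Fb: "\<bar>F u\<bar> \<le> 1 / (2 * M * s\<^sup>2)" if "u \<in> {a..b}" for u
  proof -
    have "\<bar>F u\<bar> = \<bar>cos (M * (u - x))\<bar> / (M * (2 * \<bar>sin ((u - x) / 2)\<bar>))"
      using M by (simp add: F_def abs_mult)
    also have "\<dots> \<le> 1 / (M * (2 * s))"
      using M s sin[OF that] by (intro frac_le mult_left_mono) auto
    also have "\<dots> \<le> 1 / (2 * M * s\<^sup>2)"
      using M s s1 by (intro frac_le) (auto simp: power2_eq_square)
    finally show ?thesis .
  qed
  have hb: "\<bar>h u\<bar> \<le> 1 / (4 * s\<^sup>2)" if "u \<in> {a..b}" for u
  proof -
    have "\<bar>h u\<bar> = \<bar>cos (M * (u - x))\<bar> * \<bar>cos ((u - x) / 2)\<bar> / (4 * \<bar>sin ((u - x) / 2)\<bar>\<^sup>2)"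
      by (simp add: h_def abs_mult)
    also have "\<dots> \<le> 1 * 1 / (4 * s\<^sup>2)"
      using s sin[OF that] by (intro frac_le mult_mono mult_left_mono power_mono) auto
    finally show ?thesis by simp
  qed
  have "\<bar>integral {a..b} h\<bar> \<le> 1 / (4 * s\<^sup>2) * (b - a)"
    using has_integral_bound_real[of "1 / (4 * s\<^sup>2)" "{}" h "integral {a..b} h" a b] hb ab hi
    by (simp add: integrable_integral)
  also have "\<dots> \<le> 1 / (4 * s\<^sup>2) * 8"
    using ab pi_less_4 by (intro mult_left_mono) auto
  finally have hI: "\<bar>integral {a..b} h / M\<bar> \<le> 2 / (M * s\<^sup>2)"
    using M s by (simp add: field_simps)
  have "\<bar>integral {a..b} g\<bar> \<le> \<bar>F b\<bar> + \<bar>F a\<bar> + \<bar>integral {a..b} h / M\<bar>"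
    unfolding eq by linarith
  also have "\<dots> \<le> 1 / (2 * M * s\<^sup>2) + 1 / (2 * M * s\<^sup>2) + 2 / (M * s\<^sup>2)"
    using Fb[of a] Fb[of b] hI ab by (intro add_mono) auto
  also have "\<dots> = 3 / (M * s\<^sup>2)" using M s by (simp add: field_simps)
  finally show ?thesis unfolding g_def .
qed

lemma sum_exp_eq_dirichlet_kernel:
  assumes "sin (u / 2) \<noteq> 0"
  shows "(\<Sum>k = - int m..int m. exp (\<i> * of_int k * complex_of_real u)) =
    complex_of_real (2 * dirichlet_kernel m u)"
proof (induction m)
  case 0
  then show ?case using assms by (simp add: dirichlet_kernel_def)
next
  case (Suc m)
  have set: "{- int (Suc m)..int (Suc m)} = insert (int (Suc m)) (insert (- int (Suc m)) {- int m..int m})"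
    by auto
  have ex: "exp (\<i> * of_int (int (Suc m)) * complex_of_real u) + exp (\<i> * of_int (- int (Suc m)) * complex_of_real u)
    = complex_of_real (2 * cos (real (Suc m) * u))"
    using exp_Euler[of "of_real (real (Suc m) * u)"] exp_Euler[of "of_real (- (real (Suc m) * u))"]
    by (simp add: mult.assoc cos_of_real[symmetric] del: of_nat_Suc cos_of_real)
  have k: "dirichlet_kernel (Suc m) u - dirichlet_kernel m u = cos (real (Suc m) * u)"
  proof -
    have "sin (real (Suc m) * u + u / 2) - sin (real (Suc m) * u - u / 2) = 2 * cos (real (Suc m) * u) * sin (u / 2)"
      by (simp add: sin_add sin_diff)
    moreover have "real (Suc m) * u + u / 2 = (real (Suc m) + 1 / 2) * u"
      and "real (Suc m) * u - u / 2 = (real m + 1 / 2) * u"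
      by (simp_all add: algebra_simps)
    ultimately have "sin ((real (Suc m) + 1 / 2) * u) - sin ((real m + 1 / 2) * u) = 2 * cos (real (Suc m) * u) * sin (u / 2)"
      by metis
    then show ?thesis
      using assms by (simp add: dirichlet_kernel_def diff_divide_distrib[symmetric] del: of_nat_Suc)
  qed
  have "(\<Sum>k = - int (Suc m)..int (Suc m). exp (\<i> * of_int k * complex_of_real u)) =
     complex_of_real (2 * cos (real (Suc m) * u)) + complex_of_real (2 * dirichlet_kernel m u)"
    unfolding set using Suc ex by (simp del: of_nat_Suc of_int_of_nat_eq)
  also have "\<dots> = complex_of_real (2 * dirichlet_kernel (Suc m) u)"
    using k by (metis add.commute diff_add_cancel distrib_left of_real_add)
  finally show ?case .
qed

lemma abs_dirichlet_kernel_le: "\<bar>dirichlet_kernel m u\<bar> \<le> 1 / (2 * \<bar>sin (u / 2)\<bar>)"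
  unfolding dirichlet_kernel_def by (simp add: abs_mult divide_right_mono)

lemma set_integrable_circle_iff:
  fixes f :: "real \<Rightarrow> 'a :: {banach, second_countable_topology}"
  shows "integrable circle f \<longleftrightarrow> set_integrable lebesgue {0..<2 * pi} f"
  unfolding circle_def set_integrable_def by (simp add: integrable_restrict_space)

lemma space_circle [simp]: "space circle = {0..<2 * pi}"
  by (simp add: circle_def)

lemma emeasure_circle:
  assumes "A \<in> sets lebesgue" "A \<subseteq> {0..<2 * pi}"
  shows "emeasure circle A = emeasure lebesgue A"
  unfolding circle_def using assms by (intro emeasure_restrict_space) auto

lemma finite_measure_circle: "finite_measure circle"
  unfolding circle_def by (intro finite_measure_lebesgue_on bounded_set_imp_lmeasurable) auto

interpretation circle: finite_measure circle by (rule finite_measure_circle)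

lemma measure_circle_space: "measure circle {0..<2 * pi} = 2 * pi"
  by (simp add: measure_def emeasure_circle)

lemma borel_measurable_circle: "f \<in> borel_measurable borel \<Longrightarrow> f \<in> borel_measurable circle"
  unfolding circle_def by (intro measurable_restrict_space1 measurable_completion) simp

lemma ident_borel_measurable_circle [measurable]: "(\<lambda>x::real. x) \<in> borel_measurable circle"
  by (rule borel_measurable_circle) simp

lemma AE_circle_countable:
  assumes "countable A" shows "AE x in circle. x \<notin> A"
proof -
  have "AE x in lebesgue. x \<notin> A"
    using countable_imp_null_set_lborel[OF assms] by (intro AE_not_in) (simp add: null_sets_completionI)
  then show ?thesis unfolding circle_def
    by (subst AE_restrict_space_iff) auto
qed

lemma integral_circle_eq:
  fixes f :: "real \<Rightarrow> 'a :: {banach, second_countable_topology}"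
  shows "(\<integral>x. f x \<partial>circle) = (LINT x:{0..<2 * pi}|lebesgue. f x)"
  unfolding circle_def set_lebesgue_integral_def by (simp add: integral_restrict_space)

text \<open>
  At the zeros of \<open>sin (u/2)\<close> division by zero gives the kernel the value \<open>0\<close> instead of \<open>r + 1/2\<close>.
  These points form a null set, so integrals do not see the difference.
\<close>

lemma AE_circle_sin_half_nonzero: "AE t in circle. sin ((t - x) / 2) \<noteq> 0"
proof -
  have "AE t in circle. t \<notin> range (\<lambda>k::int. x + 2 * of_int k * pi)"
    by (rule AE_circle_countable) auto
  then show ?thesis
  proof (rule AE_mp, intro AE_I2 impI notI)
    fix t assume *: "t \<notin> range (\<lambda>k::int. x + 2 * of_int k * pi)" "sin ((t - x) / 2) = 0"
    then obtain k :: int where "(t - x) / 2 = of_int k * pi" by (auto simp: sin_zero_iff_int2)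
    then have "t = x + 2 * of_int k * pi" by (simp add: field_simps)
    with * show False by blast
  qed
qed

lemma integrable_circle_mult_exp:
  assumes "integrable circle f"
  shows "integrable circle (\<lambda>x. f x * exp (- (\<i> * of_int k * complex_of_real x)))"
proof (rule Bochner_Integration.integrable_bound[OF assms])
  show "(\<lambda>x. f x * exp (- (\<i> * of_int k * complex_of_real x))) \<in> borel_measurable circle"
    using borel_measurable_integrable[OF assms] by measurable
qed (auto simp: norm_mult)

lemma norm_fourier_coeff_le:
  assumes "integrable circle f"
  shows "cmod (fourier_coeff f k) \<le> (\<integral>x. cmod (f x) \<partial>circle) / (2 * pi)"
proof -
  have "cmod (\<integral>x. f x * exp (- (\<i> * of_int k * complex_of_real x)) \<partial>circle) \<le>
     (\<integral>x. cmod (f x * exp (- (\<i> * of_int k * complex_of_real x))) \<partial>circle)"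
    by (rule integral_norm_bound)
  also have "\<dots> = (\<integral>x. cmod (f x) \<partial>circle)" by (simp add: norm_mult)
  finally show ?thesis by (simp add: fourier_coeff_def norm_mult norm_divide divide_right_mono)
qed

lemma norm_fourier_sum_le:
  assumes "integrable circle f"
  shows "cmod (fourier_sum m x f) \<le> (2 * real m + 1) * ((\<integral>x. cmod (f x) \<partial>circle) / (2 * pi))"
proof -
  have "cmod (fourier_sum m x f) \<le> (\<Sum>k = - int m..int m. (\<integral>x. cmod (f x) \<partial>circle) / (2 * pi))"
    unfolding fourier_sum_def
    by (rule sum_norm_le) (simp add: norm_mult norm_fourier_coeff_le[OF assms])
  also have "\<dots> = (2 * real m + 1) * ((\<integral>x. cmod (f x) \<partial>circle) / (2 * pi))"
    by simp
  finally show ?thesis .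
qed

abbreviation partial_sum :: "(real \<Rightarrow> real) \<Rightarrow> nat \<Rightarrow> real \<Rightarrow> complex" where
  "partial_sum f r x \<equiv> fourier_sum r x (\<lambda>t. complex_of_real (f t))"

lemma fourier_sum_eq_dirichlet:
  assumes f: "integrable circle f"
  shows "integrable circle (\<lambda>t. f t * dirichlet_kernel m (t - x))"
    and "partial_sum f m x =
      complex_of_real (1 / pi * (\<integral>t. f t * dirichlet_kernel m (t - x) \<partial>circle))"
proof -
  have cf: "integrable circle (\<lambda>t. complex_of_real (f t))" using f by simp
  define E where "E = (\<lambda>t. \<Sum>k = - int m..int m.
      (complex_of_real (f t) * exp (- (\<i> * of_int k * complex_of_real t))) * exp (\<i> * of_int k * complex_of_real x))"
  have iE: "integrable circle E"
    unfolding E_def by (intro Bochner_Integration.integrable_sum integrable_mult_left integrable_circle_mult_exp cf)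
  have m1: "(\<lambda>t. f t * dirichlet_kernel m (t - x)) \<in> borel_measurable circle"
    using borel_measurable_integrable[OF f] unfolding dirichlet_kernel_def by measurable
  then have m2: "(\<lambda>t. complex_of_real (2 * (f t * dirichlet_kernel m (t - x)))) \<in> borel_measurable circle"
    by measurable
  have ae: "AE t in circle. E t = complex_of_real (2 * (f t * dirichlet_kernel m (t - x)))"
    using AE_circle_sin_half_nonzero[of x]
  proof (rule AE_mp, intro AE_I2 impI)
    fix t assume "sin ((t - x) / 2) \<noteq> 0"
    then have nz: "sin ((x - t) / 2) \<noteq> 0"
      using sin_minus[of "(t - x) / 2"] by (metis minus_diff_eq minus_divide_left neg_equal_0_iff_equal)
    have "dirichlet_kernel m (x - t) = dirichlet_kernel m (t - x)"
    proof -
      have "(x - t) / 2 = - ((t - x) / 2)" "(real m + 1 / 2) * (x - t) = - ((real m + 1 / 2) * (t - x))"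
        by (simp_all add: field_simps)
      then show ?thesis unfolding dirichlet_kernel_def by (simp only: sin_minus mult_minus_right minus_divide_divide)
    qed
    moreover have "exp (- (\<i> * of_int k * complex_of_real t)) * exp (\<i> * of_int k * complex_of_real x) =
        exp (\<i> * of_int k * complex_of_real (x - t))" for k
      unfolding exp_add[symmetric] by (simp add: algebra_simps)
    then have "E t = complex_of_real (f t) * (\<Sum>k = - int m..int m. exp (\<i> * of_int k * complex_of_real (x - t)))"
      unfolding E_def sum_distrib_left by (intro sum.cong refl) (simp only: mult.assoc)
    ultimately show "E t = complex_of_real (2 * (f t * dirichlet_kernel m (t - x)))"
      using sum_exp_eq_dirichlet_kernel[OF nz, of m] by simp
  qed
  have i2: "integrable circle (\<lambda>t. complex_of_real (2 * (f t * dirichlet_kernel m (t - x))))"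
    using integrable_cong_AE[OF borel_measurable_integrable[OF iE] m2 ae] iE by blast
  from integrable_mult_right[OF this, of "1 / 2"]
  have "integrable circle (\<lambda>t. complex_of_real (f t * dirichlet_kernel m (t - x)))"
    by simp
  then show i1: "integrable circle (\<lambda>t. f t * dirichlet_kernel m (t - x))"
    by (simp only: complex_of_real_integrable_eq)
  have "partial_sum f m x = 1 / (2 * complex_of_real pi) * (\<integral>t. E t \<partial>circle)"
  proof -
    have "(\<integral>t. E t \<partial>circle) = (\<Sum>k = - int m..int m.
        (\<integral>t. complex_of_real (f t) * exp (- (\<i> * of_int k * complex_of_real t)) \<partial>circle)
          * exp (\<i> * of_int k * complex_of_real x))"
      unfolding E_def
      by (subst Bochner_Integration.integral_sum)
        (auto intro!: integrable_mult_left integrable_circle_mult_exp cf simp only: integral_mult_left_zero)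
    then show ?thesis
      unfolding fourier_sum_def fourier_coeff_def by (simp only: sum_distrib_left mult.assoc)
  qed
  also have "(\<integral>t. E t \<partial>circle) = (\<integral>t. complex_of_real (2 * (f t * dirichlet_kernel m (t - x))) \<partial>circle)"
    by (rule integral_cong_AE[OF borel_measurable_integrable[OF iE] m2 ae])
  also have "\<dots> = complex_of_real (2 * (\<integral>t. f t * dirichlet_kernel m (t - x) \<partial>circle))"
    by (subst integral_complex_of_real) simp
  finally show "partial_sum f m x =
      complex_of_real (1 / pi * (\<integral>t. f t * dirichlet_kernel m (t - x) \<partial>circle))"
    by simp
qed

text \<open>
  A Fourier sum is a finite combination of \<open>L\<^sup>1\<close>-continuous functionals, so it commutes with series
  that converge absolutely in \<open>L\<^sup>1\<close>.
\<close>

lemma fourier_sum_suminf: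
  fixes f :: "nat \<Rightarrow> real \<Rightarrow> real"
  assumes int: "\<And>k. integrable circle (f k)"
    and sm: "AE x in circle. summable (\<lambda>k. \<bar>f k x\<bar>)"
    and sm2: "summable (\<lambda>k. \<integral>x. \<bar>f k x\<bar> \<partial>circle)"
  shows "(\<lambda>k. fourier_sum m x (\<lambda>t. complex_of_real (f k t))) sums
     fourier_sum m x (\<lambda>t. complex_of_real (\<Sum>k. f k t))"
proof -
  have "(\<lambda>k. fourier_coeff (\<lambda>t. complex_of_real (f k t)) j) sums
     fourier_coeff (\<lambda>t. complex_of_real (\<Sum>k. f k t)) j" for j
  proof -
    let ?e = "\<lambda>t. exp (- (\<i> * of_int j * complex_of_real t))"
    have i: "integrable circle (\<lambda>t. complex_of_real (f k t) * ?e t)" for k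
      using int by (intro integrable_circle_mult_exp) simp
    have n: "norm (complex_of_real (f k t) * ?e t) = \<bar>f k t\<bar>" for k t
      by (simp add: norm_mult)
    have "(\<lambda>k. \<integral>t. complex_of_real (f k t) * ?e t \<partial>circle) sums
       (\<integral>t. (\<Sum>k. complex_of_real (f k t) * ?e t) \<partial>circle)"
      using sums_integral[OF i] sm sm2 unfolding n by auto
    also have "(\<integral>t. (\<Sum>k. complex_of_real (f k t) * ?e t) \<partial>circle) =
        (\<integral>t. complex_of_real (\<Sum>k. f k t) * ?e t \<partial>circle)"
    proof (rule integral_cong_AE)
      show "(\<lambda>t. \<Sum>k. complex_of_real (f k t) * ?e t) \<in> borel_measurable circle"
        by (intro borel_measurable_suminf borel_measurable_integrable i)
      have "(\<lambda>t. (\<Sum>k. f k t)) \<in> borel_measurable circle"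
        by (intro borel_measurable_suminf borel_measurable_integrable int)
      then show "(\<lambda>t. complex_of_real (\<Sum>k. f k t) * ?e t) \<in> borel_measurable circle"
        by measurable
      show "AE t in circle. (\<Sum>k. complex_of_real (f k t) * ?e t) = complex_of_real (\<Sum>k. f k t) * ?e t"
        using sm
      proof (rule AE_mp, intro AE_I2 impI)
        fix t assume "summable (\<lambda>k. \<bar>f k t\<bar>)"
        then have "(\<lambda>k. f k t) sums (\<Sum>k. f k t)" by (rule summable_sums[OF summable_rabs_cancel])
        then have "(\<lambda>k. complex_of_real (f k t) * ?e t) sums (complex_of_real (\<Sum>k. f k t) * ?e t)"
          by (intro sums_mult2 sums_of_real)
        then show "(\<Sum>k. complex_of_real (f k t) * ?e t) = complex_of_real (\<Sum>k. f k t) * ?e t"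
          by (rule sums_unique[symmetric])
      qed
    qed
    finally show ?thesis unfolding fourier_coeff_def by (rule sums_mult)
  qed
  then show ?thesis unfolding fourier_sum_def
    by (intro sums_sum sums_mult2)
qed

lemma borel_measurable_fourier_sum [measurable]: "(\<lambda>x. fourier_sum m x f) \<in> borel_measurable circle"
  unfolding fourier_sum_def by measurable

section \<open>Dirichlet integrals over intervals\<close>

text \<open>
  The sine is concave on \<open>[0, \<pi>/2]\<close> and so lies above its chord.
\<close>

lemma jordan_sin_inequality:
  fixes v :: real
  assumes "0 \<le> v" "v \<le> pi / 2"
  shows "2 * v / pi \<le> sin v"
proof -
  have cv: "convex_on {0..pi / 2} (\<lambda>x. - sin x)"
  proof (rule convex_on_realI[where f' = "\<lambda>x. - cos x"])
    fix x y :: real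
    assume "x \<in> {0..pi / 2}" "y \<in> {0..pi / 2}" "x \<le> y"
    then show "- cos x \<le> - cos y" using cos_monotone_0_pi_le[of x y] by simp
  qed (auto intro!: derivative_eq_intros)
  have "- sin ((1 - 2 * v / pi) *\<^sub>R 0 + (2 * v / pi) *\<^sub>R (pi / 2)) \<le>
      (1 - 2 * v / pi) * - sin 0 + (2 * v / pi) * - sin (pi / 2)"
    using assms by (intro convex_onD[OF cv]) (auto simp: field_simps)
  then show ?thesis by simp
qed

text \<open>
  On \<open>(-2\<pi>, 2\<pi>)\<close> the Dirichlet kernel is singular at \<open>0\<close> and, by periodicity, at both ends; the two
  summands account for these singularities.
\<close>

lemma inverse_sin_half_le:
  fixes u :: real
  assumes "u \<noteq> 0" "\<bar>u\<bar> < 2 * pi"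
  shows "1 / (2 * \<bar>sin (u / 2)\<bar>) \<le> pi / 2 * (1 / \<bar>u\<bar> + 1 / (2 * pi - \<bar>u\<bar>))"
proof (cases "\<bar>u\<bar> \<le> pi")
  case True
  have "\<bar>u\<bar> / pi \<le> sin (\<bar>u\<bar> / 2)"
    using jordan_sin_inequality[of "\<bar>u\<bar> / 2"] True by simp
  also have "\<dots> \<le> \<bar>sin (u / 2)\<bar>"
    by (cases "u \<ge> 0") (auto simp: abs_if)
  finally have "1 / (2 * \<bar>sin (u / 2)\<bar>) \<le> 1 / (2 * (\<bar>u\<bar> / pi))"
    using assms by (intro frac_le) auto
  also have "\<dots> = pi / 2 * (1 / \<bar>u\<bar>)" using assms by simp
  also have "\<dots> \<le> pi / 2 * (1 / \<bar>u\<bar> + 1 / (2 * pi - \<bar>u\<bar>))"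
    using assms by (intro mult_left_mono) auto
  finally show ?thesis .
next
  case False
  have "(2 * pi - \<bar>u\<bar>) / pi \<le> sin (pi - \<bar>u\<bar> / 2)"
    using jordan_sin_inequality[of "pi - \<bar>u\<bar> / 2"] False assms by (simp add: field_simps)
  also have "\<dots> \<le> \<bar>sin (u / 2)\<bar>"
    by (cases "u \<ge> 0") (auto simp: abs_if sin_diff)
  finally have "1 / (2 * \<bar>sin (u / 2)\<bar>) \<le> 1 / (2 * ((2 * pi - \<bar>u\<bar>) / pi))"
    using assms by (intro frac_le mult_left_mono) auto
  also have "\<dots> = pi / 2 * (1 / (2 * pi - \<bar>u\<bar>))" by simp
  also have "\<dots> \<le> pi / 2 * (1 / \<bar>u\<bar> + 1 / (2 * pi - \<bar>u\<bar>))"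
    using assms by (intro mult_left_mono) auto
  finally show ?thesis .
qed

lemma dirichlet_kernel_set_integrable:
  assumes "\<And>t. t \<in> {a..b} \<Longrightarrow> sin ((t - x) / 2) \<noteq> 0"
  shows "set_integrable lebesgue {a<..<b} (\<lambda>t. dirichlet_kernel m (t - x))"
proof -
  have "set_integrable lebesgue {a..b} (\<lambda>t. dirichlet_kernel m (t - x))"
    unfolding dirichlet_kernel_def using assms
    by (intro absolutely_integrable_continuous_real continuous_intros) auto
  then show ?thesis
    by (simp add: absolutely_integrable_on_Icc_iff_Ioo)
qed

lemma dirichlet_kernel_integral_le:
  assumes "a \<le> b" "b - a \<le> 2 * pi" and s: "0 < s"
    and sin: "\<And>t. t \<in> {a..b} \<Longrightarrow> s \<le> \<bar>sin ((t - x) / 2)\<bar>"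
  shows "\<bar>LINT t:{a<..<b}|lebesgue. dirichlet_kernel m (t - x)\<bar> \<le> 3 / ((real m + 1 / 2) * s\<^sup>2)"
proof -
  have nz: "sin ((t - x) / 2) \<noteq> 0" if "t \<in> {a..b}" for t using sin[OF that] s by auto
  have "(LINT t:{a<..<b}|lebesgue. dirichlet_kernel m (t - x)) = integral {a<..<b} (\<lambda>t. dirichlet_kernel m (t - x))"
    by (rule set_lebesgue_integral_eq_integral(2)[OF dirichlet_kernel_set_integrable[OF nz]])
  also have "\<dots> = integral {a..b} (\<lambda>t. dirichlet_kernel m (t - x))"
    using integral_open_interval[of a b "\<lambda>t. dirichlet_kernel m (t - x)"]
    by (simp only: box_real cbox_interval)
  finally show ?thesis
    using oscillatory_integral_bound[OF assms(1,2) _ s sin, of "real m + 1 / 2"]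
    by (simp add: dirichlet_kernel_def)
qed

lemma circle_integral_indicator:
  fixes g :: "real \<Rightarrow> real"
  assumes "A \<subseteq> {0..<2 * pi}"
  shows "(\<integral>t. indicator A t * g t \<partial>circle) = (LINT t:A|lebesgue. g t)"
  unfolding integral_circle_eq set_lebesgue_integral_def
  by (rule Bochner_Integration.integral_cong) (use assms in \<open>auto simp: indicator_def\<close>)

lemma fourier_sum_const_one: "fourier_sum m x (\<lambda>t. 1) = 1"
proof -
  have c: "fourier_coeff (\<lambda>t. 1) k = (if k = 0 then 1 else 0)" for k
  proof (cases "k = 0")
    case True
    then show ?thesis by (simp add: fourier_coeff_def measure_circle_space scaleR_conv_of_real)
  next
    case False
    define F where "F = (\<lambda>x. exp (- (\<i> * of_int k * complex_of_real x)) / (- (\<i> * of_int k)))"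
    have d: "(F has_vector_derivative exp (- (\<i> * of_int k * complex_of_real x))) (at x within {0..2 * pi})" for x
      unfolding F_def using False
      by (auto intro!: derivative_eq_intros has_vector_derivative_real_field)
    have "((\<lambda>x. exp (- (\<i> * of_int k * complex_of_real x))) has_integral (F (2 * pi) - F 0)) {0..2 * pi}"
      by (rule fundamental_theorem_of_calculus) (use d in auto)
    moreover have "exp (- (\<i> * of_int k * complex_of_real (2 * pi))) = 1"
      using exp_integer_2pi[of "- of_int k"] by (simp add: mult_ac)
    then have "F (2 * pi) - F 0 = 0" by (simp add: F_def)
    ultimately have z: "integral {0..2 * pi} (\<lambda>x. exp (- (\<i> * of_int k * complex_of_real x))) = 0"
      by (simp add: integral_unique)
    have "set_integrable lebesgue {0..<2 * pi} (\<lambda>x. exp (- (\<i> * of_int k * complex_of_real x)))"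
      using integrable_circle_mult_exp[of "\<lambda>x. 1" k] circle.integrable_const
      by (simp add: set_integrable_circle_iff[symmetric])
    then have "(\<integral>x. exp (- (\<i> * of_int k * complex_of_real x)) \<partial>circle) =
        integral {0..<2 * pi} (\<lambda>x. exp (- (\<i> * of_int k * complex_of_real x)))"
      unfolding integral_circle_eq by (rule set_lebesgue_integral_eq_integral(2))
    also have "\<dots> = integral {0..2 * pi} (\<lambda>x. exp (- (\<i> * of_int k * complex_of_real x)))"
      by (rule integral_subset_negligible[symmetric, THEN sym])
        (auto intro: negligible_subset[of "{2 * pi}"])
    finally show ?thesis using z False by (simp add: fourier_coeff_def)
  qed
  have "fourier_sum m x (\<lambda>t. 1) = (\<Sum>k = - int m..int m. if k = 0 then 1 else 0)"
    unfolding fourier_sum_def c by (intro sum.cong) auto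
  also have "\<dots> = 1" by (subst sum.delta) auto
  finally show ?thesis .
qed

lemma dirichlet_kernel_integral_circle:
  shows "integrable circle (\<lambda>t. dirichlet_kernel m (t - x))"
    and "(\<integral>t. dirichlet_kernel m (t - x) \<partial>circle) = pi"
proof -
  have i: "integrable circle (\<lambda>t. 1 :: real)" by simp
  show "integrable circle (\<lambda>t. dirichlet_kernel m (t - x))"
    using fourier_sum_eq_dirichlet(1)[OF i, of m x] by simp
  have "complex_of_real (1 / pi * (\<integral>t. dirichlet_kernel m (t - x) \<partial>circle)) = complex_of_real 1"
    using fourier_sum_eq_dirichlet(2)[OF i, of m x] fourier_sum_const_one[of m x] by simp
  then have "1 / pi * (\<integral>t. dirichlet_kernel m (t - x) \<partial>circle) = 1"
    by (simp only: of_real_eq_iff)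
  then show "(\<integral>t. dirichlet_kernel m (t - x) \<partial>circle) = pi" by (simp add: field_simps)
qed

lemma dirichlet_integral_tendsto_zero:
  assumes ab: "0 \<le> a" "a \<le> b" "b \<le> 2 * pi"
    and nz: "\<And>t. t \<in> {a..b} \<Longrightarrow> sin ((t - x) / 2) \<noteq> 0"
  shows "(\<lambda>m. LINT t:{a<..<b}|lebesgue. dirichlet_kernel m (t - x)) \<longlonglongrightarrow> 0"
proof -
  have "continuous_on {a..b} (\<lambda>t. \<bar>sin ((t - x) / 2)\<bar>)" by (intro continuous_intros) auto
  moreover have "compact {a..b}" "{a..b} \<noteq> {}" using ab by auto
  ultimately have "\<exists>t0\<in>{a..b}. \<forall>t\<in>{a..b}. \<bar>sin ((t0 - x) / 2)\<bar> \<le> \<bar>sin ((t - x) / 2)\<bar>"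
    by (intro continuous_attains_inf)
  then obtain t0 where t0: "t0 \<in> {a..b}" "\<And>t. t \<in> {a..b} \<Longrightarrow> \<bar>sin ((t0 - x) / 2)\<bar> \<le> \<bar>sin ((t - x) / 2)\<bar>"
    by blast
  define s where "s = \<bar>sin ((t0 - x) / 2)\<bar>"
  have s: "0 < s" using nz[OF t0(1)] by (simp add: s_def)
  have "\<bar>LINT t:{a<..<b}|lebesgue. dirichlet_kernel m (t - x)\<bar> \<le> 3 / ((real m + 1 / 2) * s\<^sup>2)" for m
    using ab s t0(2) by (intro dirichlet_kernel_integral_le) (auto simp: s_def)
  then have ev: "\<forall>\<^sub>F m in sequentially.
      norm (LINT t:{a<..<b}|lebesgue. dirichlet_kernel m (t - x)) \<le> 3 / ((real m + 1 / 2) * s\<^sup>2)"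
    by (simp add: eventuallyI)
  have "(\<lambda>m. 3 / ((real m + 1 / 2) * s\<^sup>2)) \<longlonglongrightarrow> 0"
    using s by real_asymp
  then show ?thesis by (rule Lim_null_comparison[OF ev])
qed

lemma sin_half_nonzero: "u \<noteq> 0 \<Longrightarrow> \<bar>u\<bar> < 2 * pi \<Longrightarrow> sin (u / 2) \<noteq> 0" for u :: real
  using sin_gt_zero[of "u / 2"] sin_gt_zero[of "- u / 2"] by (cases "u > 0") auto

text \<open>
  Localisation for a single step. If \<open>x\<close> is outside the interval, the kernel is regular on it and the
  Riemann-Lebesgue bound applies. If \<open>x\<close> is inside, the same holds for the two complementary
  intervals, while the integral over the whole period is \<open>\<pi>\<close>.
\<close>

lemma dirichlet_integral_tendsto_indicator:
  assumes ab: "0 \<le> a" "a < b" "b \<le> 2 * pi" and x: "0 < x" "x < 2 * pi" "x \<noteq> a" "x \<noteq> b"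
  shows "(\<lambda>m. LINT t:{a<..<b}|lebesgue. dirichlet_kernel m (t - x)) \<longlonglongrightarrow> pi * indicator {a<..<b} x"
proof (cases "x \<in> {a<..<b}")
  case False
  then show ?thesis using ab x
    by (simp, intro dirichlet_integral_tendsto_zero sin_half_nonzero) auto
next
  case True
  have i: "integrable circle (\<lambda>t. indicator A t * dirichlet_kernel m (t - x))"
    if "A \<in> sets lebesgue" for m A
  proof (rule Bochner_Integration.integrable_bound[OF dirichlet_kernel_integral_circle(1)[of m x]])
    have [measurable]: "A \<inter> {0..<2 * pi} \<in> sets circle"
      unfolding circle_def using that by (subst sets_restrict_space_iff) auto
    have "(\<lambda>t. indicator (A \<inter> {0..<2 * pi}) t * dirichlet_kernel m (t - x)) \<in> borel_measurable circle"
      unfolding dirichlet_kernel_def by measurable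
    then show "(\<lambda>t. indicator A t * dirichlet_kernel m (t - x)) \<in> borel_measurable circle"
      by (rule measurable_cong[THEN iffD1, rotated]) (auto simp: indicator_def)
  qed (auto simp: indicator_def)
  have split: "(LINT t:{a<..<b}|lebesgue. dirichlet_kernel m (t - x)) = pi -
      ((LINT t:{0<..<a}|lebesgue. dirichlet_kernel m (t - x)) +
       (LINT t:{b<..<2 * pi}|lebesgue. dirichlet_kernel m (t - x)))" for m
  proof -
    have "AE t in circle. t \<notin> {0, a, b}" by (rule AE_circle_countable) auto
    then have ae: "AE t in circle. dirichlet_kernel m (t - x) = indicator {a<..<b} t * dirichlet_kernel m (t - x)
       + (indicator {0<..<a} t * dirichlet_kernel m (t - x) + indicator {b<..<2 * pi} t * dirichlet_kernel m (t - x))"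
      by (rule AE_mp, intro AE_I2) (use ab in \<open>auto simp: indicator_def\<close>)
    have "(\<integral>t. dirichlet_kernel m (t - x) \<partial>circle) = (\<integral>t. indicator {a<..<b} t * dirichlet_kernel m (t - x)
       + (indicator {0<..<a} t * dirichlet_kernel m (t - x) + indicator {b<..<2 * pi} t * dirichlet_kernel m (t - x)) \<partial>circle)"
      by (rule integral_cong_AE[OF _ _ ae])
        (intro borel_measurable_integrable dirichlet_kernel_integral_circle Bochner_Integration.integrable_add i; simp)+
    also have "\<dots> = (\<integral>t. indicator {a<..<b} t * dirichlet_kernel m (t - x) \<partial>circle)
      + (\<integral>t. indicator {0<..<a} t * dirichlet_kernel m (t - x) + indicator {b<..<2 * pi} t * dirichlet_kernel m (t - x) \<partial>circle)"
      by (rule Bochner_Integration.integral_add) (intro i Bochner_Integration.integrable_add; simp)+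
    also have "(\<integral>t. indicator {0<..<a} t * dirichlet_kernel m (t - x) + indicator {b<..<2 * pi} t * dirichlet_kernel m (t - x) \<partial>circle) =
      (\<integral>t. indicator {0<..<a} t * dirichlet_kernel m (t - x) \<partial>circle)
      + (\<integral>t. indicator {b<..<2 * pi} t * dirichlet_kernel m (t - x) \<partial>circle)"
      by (rule Bochner_Integration.integral_add) (intro i; simp)+
    moreover have "(\<integral>t. indicator {c<..<c'} t * dirichlet_kernel m (t - x) \<partial>circle) =
        (LINT t:{c<..<c'}|lebesgue. dirichlet_kernel m (t - x))" if "0 \<le> c" "c' \<le> 2 * pi" for c c'
      using that by (intro circle_integral_indicator) auto
    ultimately show ?thesis using ab dirichlet_kernel_integral_circle(2)[of m x] by simp
  qed
  have "(\<lambda>m. pi - ((LINT t:{0<..<a}|lebesgue. dirichlet_kernel m (t - x)) +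
       (LINT t:{b<..<2 * pi}|lebesgue. dirichlet_kernel m (t - x)))) \<longlonglongrightarrow> pi - (0 + 0)"
    using ab x True
    by (intro tendsto_intros dirichlet_integral_tendsto_zero sin_half_nonzero) auto
  then show ?thesis unfolding split using True by simp
qed

section \<open>The spikes and their geometry\<close>

text \<open>
  Used with \<open>h k\<close> the number of cells between a point and the node \<open>k\<close>: reciprocal distances to
  equally spaced nodes sum to at most a harmonic number.
\<close>

lemma sum_inverse_le_harm:
  fixes J :: "nat set" and h :: "nat \<Rightarrow> nat"
  assumes "inj_on h J" "h ` J \<subseteq> {1..n}"
  shows "(\<Sum>k\<in>J. 1 / real (h k)) \<le> harm n"
proof -
  have "(\<Sum>k\<in>J. 1 / real (h k)) = (\<Sum>i\<in>h ` J. 1 / real i)"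
    using assms(1) by (simp add: sum.reindex)
  also have "\<dots> \<le> (\<Sum>i\<in>{1..n}. 1 / real i)"
    using assms(2) by (intro sum_mono2) auto
  finally show ?thesis by (simp add: harm_def inverse_eq_divide)
qed

lemma harm_le_ln: "1 \<le> n \<Longrightarrow> harm n \<le> 1 + ln (real n)"
proof -
  assume "1 \<le> n"
  then obtain k where k: "n = Suc k" by (cases n) auto
  have "harm (Suc k) - ln (real (Suc k)) \<le> harm (Suc 0) - ln (real (Suc 0))"
    using decseqD[OF decseq_harm_diff_ln, of 0 k] by simp
  then show ?thesis by (simp add: k harm_expand)
qed

lemma ln_2_ge_half: "1 / 2 \<le> ln (2::real)"
proof -
  have "ln (1 / 2 :: real) \<le> 1 / 2 - 1" by (rule ln_le_minus_one) simp
  then show ?thesis by (simp add: ln_div)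
qed

text \<open>
  The combinatorial data \<open>\<lambda>\<^sub>k\<close>, \<open>m\<^sub>k\<close> of one level, separated from the function itself because the
  geometry is needed for the construction of that function.
\<close>

locale spike_geometry =
  fixes n :: nat and l m :: "nat \<Rightarrow> nat"
  assumes n2: "2 \<le> n" and l1: "l 1 = 1" and l_mono: "strict_mono_on {1..n} l"
    and l_odd: "\<And>k. k \<in> {1..n} \<Longrightarrow> odd (l k)"
    and m1: "m 1 = n" and m_eq: "\<And>k. k \<in> {2..n} \<Longrightarrow> 2 * m k + 1 = l k * (2 * n + 1)"
begin

text \<open>
  The distance of neighbouring nodes. Since \<open>(n + 1/2) d = 2\<pi>\<close>, the last node lies half a step before
  the end of the period.
\<close>

definition d :: real where "d = 4 * pi / (2 * real n + 1)"

lemma node_eq: "node n k = d * real k"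
  by (simp add: node_def d_def)

lemma d_pos: "0 < d" by (simp add: d_def)

lemma d_ge: "4 / real n \<le> d"
proof -
  have "2 * real n + 1 \<le> 3 * real n" using n2 by simp
  also have "\<dots> \<le> pi * real n" using pi_gt3 by (intro mult_right_mono) auto
  finally show ?thesis using n2 by (simp add: d_def field_simps)
qed

lemma d_mult: "d * real n = 2 * pi - d / 2" "d * (real n + 1 / 2) = 2 * pi"
  by (simp_all add: d_def field_simps)

lemma l_ge: assumes "k \<in> {2..n}" shows "3 \<le> l k"
proof -
  have "l 1 < l k" using assms n2 by (intro strict_mono_onD[OF l_mono]) auto
  moreover have "odd (l k)" using assms by (intro l_odd) auto
  ultimately show ?thesis using l1 by (cases "l k = 2") auto
qed

lemma two_m: "k \<in> {1..n} \<Longrightarrow> 2 * m k + 1 = l k * (2 * n + 1)"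
  using m_eq[of k] m1 l1 by (cases "k = 1") auto

lemma m_mono: assumes "j \<in> {1..n}" "k \<in> {1..n}" "j \<le> k" shows "m j \<le> m k"
proof -
  have "l j \<le> l k" using strict_mono_onD[OF l_mono, of j k] assms by (cases "j = k") auto
  then have "l j * (2 * n + 1) \<le> l k * (2 * n + 1)" by (rule mult_le_mono1)
  then show ?thesis using two_m[OF assms(1)] two_m[OF assms(2)] by linarith
qed

lemma m_ge: "k \<in> {1..n} \<Longrightarrow> n \<le> m k"
  using m_mono[of 1 k] m1 by auto

lemma width_le: assumes "k \<in> {1..n}" shows "2 / (real (m k))\<^sup>2 \<le> 2 / (real n)\<^sup>2"
  using m_ge[OF assms] n2 by (intro divide_left_mono power_mono) auto

text \<open>
  Every spike stays in the first quarter of the cell between its node and the next one.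
\<close>

lemma width_le_d: "2 / (real n)\<^sup>2 \<le> d / 4"
proof -
  have "2 / (real n)\<^sup>2 \<le> 1 / real n" using n2 by (simp add: field_simps power2_eq_square)
  then show ?thesis using d_ge by simp
qed

lemma spike_subset: "k \<in> {1..n} \<Longrightarrow> spike n m k \<subseteq> {d * real k <..< d * real k + d / 4}"
  using width_le[of k] width_le_d by (auto simp: spike_def node_eq)

lemma spike_in_period: assumes "k \<in> {1..n}" shows "spike n m k \<subseteq> {0<..<2 * pi}"
proof -
  have "d * real k \<le> d * real n" "0 \<le> d * real k" using assms d_pos by auto
  then have "d * real k + d / 4 < 2 * pi" using d_mult(1) d_pos by linarith
  show ?thesis
  proof
    fix x assume "x \<in> spike n m k"
    then have "d * real k < x" "x < d * real k + d / 4" using spike_subset[OF assms] by auto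
    then have "0 < x" "x < 2 * pi"
      using \<open>d * real k + d / 4 < 2 * pi\<close> \<open>0 \<le> d * real k\<close> by linarith+
    then show "x \<in> {0<..<2 * pi}" by simp
  qed
qed

lemma spike_disjoint: assumes "j \<in> {1..n}" "k \<in> {1..n}" "j \<noteq> k" shows "spike n m j \<inter> spike n m k = {}"
proof -
  have *: "spike n m j \<inter> spike n m k = {}" if jk: "j \<in> {1..n}" "k \<in> {1..n}" "j < k" for j k
  proof -
    have "real j + 1 \<le> real k" using jk by simp
    then have "d * (real j + 1) \<le> d * real k" using d_pos by simp
    then have "d * real j + d / 4 \<le> d * real k" using d_pos by (simp add: distrib_left)
    then show ?thesis using spike_subset[OF jk(1)] spike_subset[OF jk(2)] by fastforce
  qed
  show ?thesis using *[of j k] *[of k j] assms by (cases "j < k") auto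
qed

lemma m_pos: "k \<in> {1..n} \<Longrightarrow> 0 < m k"
  using m_ge[of k] n2 by simp

lemma spike_lebesgue [simp]: "spike n m k \<in> sets lebesgue"
  by (simp add: spike_def)

lemma spike_circle [simp]: "k \<in> {1..n} \<Longrightarrow> spike n m k \<in> sets circle"
  using spike_in_period[of k] unfolding circle_def by (subst sets_restrict_space_iff) auto

lemma measure_spike: assumes "k \<in> {1..n}" shows "measure circle (spike n m k) = 2 / (real (m k))\<^sup>2"
proof -
  have "emeasure circle (spike n m k) = emeasure lebesgue (spike n m k)"
    using spike_in_period[OF assms] by (intro emeasure_circle) auto
  then show ?thesis by (simp add: measure_def spike_def)
qed

end

section \<open>Fourier sums of a spike function\<close>

locale spike_function = spike_geometry +
  fixes f :: "real \<Rightarrow> real"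
  assumes periodic: "circle_periodic f"
    and f_spike: "\<And>k x. k \<in> {1..n} \<Longrightarrow> x \<in> spike n m k \<Longrightarrow> f x = (real (m k))\<^sup>2 / real n"
    and f_zero: "\<And>x. x \<in> {0..2 * pi} - (\<Union>k\<in>{1..n}. spike n m k) \<Longrightarrow> f x = 0"
begin

lemma f_eq_sum:
  assumes "x \<in> {0..<2 * pi}"
  shows "f x = (\<Sum>k\<in>{1..n}. (real (m k))\<^sup>2 / real n * indicator (spike n m k) x)"
proof (cases "\<exists>k\<in>{1..n}. x \<in> spike n m k")
  case True
  then obtain k where k: "k \<in> {1..n}" "x \<in> spike n m k" by blast
  have "(\<Sum>j\<in>{1..n}. (real (m j))\<^sup>2 / real n * indicator (spike n m j) x) =
      (\<Sum>j\<in>{1..n}. if j = k then (real (m k))\<^sup>2 / real n else 0)"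
    using k spike_disjoint[OF _ k(1)] by (intro sum.cong) (auto simp: indicator_def)
  then show ?thesis using f_spike[OF k] k by simp
next
  case False
  then have "f x = 0" using assms by (intro f_zero) auto
  moreover have "(\<Sum>k\<in>{1..n}. (real (m k))\<^sup>2 / real n * indicator (spike n m k) x) = 0"
    using False by (intro sum.neutral) auto
  ultimately show ?thesis by simp
qed

lemma f_nonneg: "x \<in> {0..<2 * pi} \<Longrightarrow> 0 \<le> f x"
  by (subst f_eq_sum) (auto intro!: sum_nonneg)

lemma integrable_circle_sum:
  "integrable circle (\<lambda>x. \<Sum>k\<in>{1..n}. (real (m k))\<^sup>2 / real n * indicator (spike n m k) x)"
proof (intro Bochner_Integration.integrable_sum integrable_mult_right)
  fix k assume "k \<in> {1..n}"
  then show "integrable circle (indicator (spike n m k) :: real \<Rightarrow> real)"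
    by (intro integrable_real_indicator) (auto simp: less_top[symmetric] circle.emeasure_finite)
qed

lemma integrable_f: "integrable circle f"
  by (rule Bochner_Integration.integrable_cong[THEN iffD2, OF refl _ integrable_circle_sum]) (simp add: f_eq_sum)

lemma integral_f: "(\<integral>x. f x \<partial>circle) = 2"
proof -
  have "(\<integral>x. f x \<partial>circle) = (\<integral>x. (\<Sum>k\<in>{1..n}. (real (m k))\<^sup>2 / real n * indicator (spike n m k) x) \<partial>circle)"
    by (rule Bochner_Integration.integral_cong) (simp_all add: f_eq_sum)
  also have "\<dots> = (\<Sum>k\<in>{1..n}. (real (m k))\<^sup>2 / real n * measure circle (spike n m k))"
  proof (subst Bochner_Integration.integral_sum)
    fix k assume "k \<in> {1..n}"
    then show "integrable circle (\<lambda>x. (real (m k))\<^sup>2 / real n * indicator (spike n m k) x)"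
      by (intro integrable_mult_right integrable_real_indicator) (auto simp: less_top[symmetric] circle.emeasure_finite)
  next
    show "(\<Sum>k\<in>{1..n}. \<integral>x. (real (m k))\<^sup>2 / real n * indicator (spike n m k) x \<partial>circle) =
      (\<Sum>k\<in>{1..n}. (real (m k))\<^sup>2 / real n * measure circle (spike n m k))"
      using spike_in_period by (intro sum.cong refl) (auto simp: Int_absorb2 subset_iff less_le)
  qed
  also have "\<dots> = (\<Sum>k\<in>{1..n}. 2 / real n)"
    using m_pos by (intro sum.cong refl) (auto simp: measure_spike)
  also have "\<dots> = 2" using n2 by simp
  finally show ?thesis .
qed

definition kernel_integral :: "nat \<Rightarrow> real \<Rightarrow> nat \<Rightarrow> real" where
  "kernel_integral r x k = (LINT t:spike n m k|lebesgue. dirichlet_kernel r (t - x))"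

abbreviation contribution :: "nat \<Rightarrow> real \<Rightarrow> nat \<Rightarrow> real" where
  "contribution r x k \<equiv> (real (m k))\<^sup>2 / (pi * real n) * kernel_integral r x k"

lemma integrable_spike_kernel:
  assumes "k \<in> {1..n}"
  shows "integrable circle (\<lambda>t. (real (m k))\<^sup>2 / real n * (indicator (spike n m k) t * dirichlet_kernel r (t - x)))"
proof (rule integrable_mult_right, rule Bochner_Integration.integrable_bound[OF dirichlet_kernel_integral_circle(1)[of r x]])
  have [measurable]: "spike n m k \<in> sets circle" using assms by simp
  show "(\<lambda>t. indicator (spike n m k) t * dirichlet_kernel r (t - x)) \<in> borel_measurable circle"
    unfolding dirichlet_kernel_def by measurable
qed (auto simp: indicator_def)

lemma set_integral_spikes:
  assumes J: "J \<subseteq> {1..n}"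
  shows "1 / pi * (LINT t:(\<Union>j\<in>J. spike n m j)|lebesgue. f t * dirichlet_kernel r (t - x)) =
    (\<Sum>j\<in>J. contribution r x j)"
proof -
  have fin: "finite J" using J finite_subset by blast
  have sub: "(\<Union>j\<in>J. spike n m j) \<subseteq> {0..<2 * pi}" using J spike_in_period by fastforce
  have "(LINT t:(\<Union>j\<in>J. spike n m j)|lebesgue. f t * dirichlet_kernel r (t - x)) =
     (\<integral>t. indicator (\<Union>j\<in>J. spike n m j) t * (f t * dirichlet_kernel r (t - x)) \<partial>circle)"
    using circle_integral_indicator[OF sub] by simp
  also have "\<dots> = (\<integral>t. (\<Sum>j\<in>J. (real (m j))\<^sup>2 / real n * (indicator (spike n m j) t * dirichlet_kernel r (t - x))) \<partial>circle)"
  proof (rule Bochner_Integration.integral_cong[OF refl])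
    fix t
    show "indicator (\<Union>j\<in>J. spike n m j) t * (f t * dirichlet_kernel r (t - x)) =
       (\<Sum>j\<in>J. (real (m j))\<^sup>2 / real n * (indicator (spike n m j) t * dirichlet_kernel r (t - x)))"
    proof (cases "\<exists>k\<in>J. t \<in> spike n m k")
      case True
      then obtain k where k: "k \<in> J" "t \<in> spike n m k" by blast
      have "(\<Sum>j\<in>J. (real (m j))\<^sup>2 / real n * (indicator (spike n m j) t * dirichlet_kernel r (t - x))) =
         (\<Sum>j\<in>J. if j = k then (real (m k))\<^sup>2 / real n * dirichlet_kernel r (t - x) else 0)"
        using k spike_disjoint[of _ k] J by (intro sum.cong) (auto simp: indicator_def subset_iff)
      also have "\<dots> = f t * dirichlet_kernel r (t - x)" using f_spike[of k t] k J fin by (simp add: subset_iff)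
      finally show ?thesis using k by (auto simp: indicator_def)
    qed (auto simp: indicator_def)
  qed
  also have "\<dots> = (\<Sum>j\<in>J. (real (m j))\<^sup>2 / real n * kernel_integral r x j)"
  proof (subst Bochner_Integration.integral_sum)
    show "(\<Sum>k\<in>J. \<integral>t. (real (m k))\<^sup>2 / real n * (indicator (spike n m k) t * dirichlet_kernel r (t - x)) \<partial>circle) =
      (\<Sum>k\<in>J. (real (m k))\<^sup>2 / real n * kernel_integral r x k)"
    proof (intro sum.cong refl)
      fix k assume "k \<in> J"
      then have "spike n m k \<subseteq> {0..<2 * pi}" using sub by auto
      from circle_integral_indicator[OF this]
      show "(\<integral>t. (real (m k))\<^sup>2 / real n * (indicator (spike n m k) t * dirichlet_kernel r (t - x)) \<partial>circle) =
         (real (m k))\<^sup>2 / real n * kernel_integral r x k"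
        by (simp add: kernel_integral_def)
    qed
  next
    fix j assume "j \<in> J"
    then show "integrable circle (\<lambda>t. (real (m j))\<^sup>2 / real n * (indicator (spike n m j) t * dirichlet_kernel r (t - x)))"
      using J by (intro integrable_spike_kernel) auto
  qed
  finally show ?thesis
    by (simp add: sum_distrib_left mult.commute)
qed

lemma fourier_sum_f:
  "partial_sum f r x =
    complex_of_real (\<Sum>k\<in>{1..n}. contribution r x k)"
proof -
  have sub: "(\<Union>k\<in>{1..n}. spike n m k) \<subseteq> {0..<2 * pi}" using spike_in_period by fastforce
  have "(\<integral>t. f t * dirichlet_kernel r (t - x) \<partial>circle) =
    (\<integral>t. indicator (\<Union>k\<in>{1..n}. spike n m k) t * (f t * dirichlet_kernel r (t - x)) \<partial>circle)"
    by (rule Bochner_Integration.integral_cong) (auto simp: indicator_def f_zero)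
  also have "\<dots> = (LINT t:(\<Union>k\<in>{1..n}. spike n m k)|lebesgue. f t * dirichlet_kernel r (t - x))"
    by (rule circle_integral_indicator[OF sub])
  finally show ?thesis
    unfolding fourier_sum_eq_dirichlet(2)[OF integrable_f] set_integral_spikes[OF order_refl, symmetric] by simp
qed

text \<open>
  A spike function is a step function, so it suffices to localise at the endpoints of the spikes.
\<close>

lemma fourier_sum_f_tendsto:
  assumes x: "x \<in> {0<..<2 * pi}" "\<And>k. k \<in> {1..n} \<Longrightarrow> x \<noteq> node n k \<and> x \<noteq> node n k + 2 / (real (m k))\<^sup>2"
  shows "(\<lambda>r. partial_sum f r x) \<longlonglongrightarrow> complex_of_real (f x)"
proof -
  have "(\<lambda>r. kernel_integral r x k) \<longlonglongrightarrow> pi * indicator (spike n m k) x" if k: "k \<in> {1..n}" for k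
  proof -
    have "{node n k<..<node n k + 2 / (real (m k))\<^sup>2} \<subseteq> {0<..<2 * pi}"
      using spike_in_period[OF k] by (simp add: spike_def)
    moreover have "node n k < node n k + 2 / (real (m k))\<^sup>2" using m_pos[OF k] by simp
    ultimately show ?thesis
      using x(1) x(2)[OF k] unfolding kernel_integral_def spike_def
      by (intro dirichlet_integral_tendsto_indicator) (auto simp: greaterThanLessThan_subseteq_greaterThanLessThan)
  qed
  then have "(\<lambda>r. \<Sum>k\<in>{1..n}. contribution r x k) \<longlonglongrightarrow>
     (\<Sum>k\<in>{1..n}. (real (m k))\<^sup>2 / (pi * real n) * (pi * indicator (spike n m k) x))"
    by (intro tendsto_sum tendsto_mult tendsto_const)
  also have "(\<Sum>k\<in>{1..n}. (real (m k))\<^sup>2 / (pi * real n) * (pi * indicator (spike n m k) x)) = f x"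
    using x by (simp add: f_eq_sum)
  finally show ?thesis unfolding fourier_sum_f by (rule tendsto_of_real)
qed

lemma AE_fourier_sum_f_tendsto:
  "AE x in circle. (\<lambda>r. partial_sum f r x) \<longlonglongrightarrow> complex_of_real (f x)"
proof -
  have "AE x in circle. x \<notin> {0} \<union> (node n ` {1..n} \<union> (\<lambda>k. node n k + 2 / (real (m k))\<^sup>2) ` {1..n})"
    by (rule AE_circle_countable) (auto intro: countable_finite)
  then show ?thesis
    by (rule AE_mp, intro AE_I2 impI fourier_sum_f_tendsto) auto
qed

text \<open>
  A spike has mass \<open>2/n\<close> whatever its height, so only the size of the kernel on it matters.
\<close>

lemma spike_kernel_le:
  assumes k: "k \<in> {1..n}" and B: "\<And>t. t \<in> spike n m k \<Longrightarrow> \<bar>dirichlet_kernel r (t - x)\<bar> \<le> B" "0 \<le> B"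
  shows "(real (m k))\<^sup>2 / (pi * real n) * \<bar>kernel_integral r x k\<bar> \<le> 2 / (pi * real n) * B"
proof -
  have sp: "spike n m k \<subseteq> {0..<2 * pi}" using spike_in_period[OF k] by auto
  have [measurable]: "spike n m k \<in> sets circle" using k by simp
  have i: "integrable circle (indicator (spike n m k) :: real \<Rightarrow> real)"
    by (intro integrable_real_indicator) (auto simp: less_top[symmetric] circle.emeasure_finite)
  have "\<bar>kernel_integral r x k\<bar> = \<bar>\<integral>t. indicator (spike n m k) t * dirichlet_kernel r (t - x) \<partial>circle\<bar>"
    unfolding kernel_integral_def circle_integral_indicator[OF sp] ..
  also have "\<dots> \<le> (\<integral>t. \<bar>indicator (spike n m k) t * dirichlet_kernel r (t - x)\<bar> \<partial>circle)"
    by (rule integral_abs_bound)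
  also have "\<dots> \<le> (\<integral>t. B * indicator (spike n m k) t \<partial>circle)"
    by (rule integral_mono'[OF integrable_mult_right[OF i]]) (use B in \<open>auto simp: indicator_def\<close>)
  also have "\<dots> = B * (2 / (real (m k))\<^sup>2)"
    using sp by (simp add: measure_spike[OF k] Int_absorb2)
  finally have "(real (m k))\<^sup>2 / (pi * real n) * \<bar>kernel_integral r x k\<bar> \<le> (real (m k))\<^sup>2 / (pi * real n) * (B * (2 / (real (m k))\<^sup>2))"
    by (rule mult_left_mono) simp
  also have "\<dots> = 2 / (pi * real n) * B" using m_pos[OF k] by simp
  finally show ?thesis .
qed

end

section \<open>Upper and lower bounds for the Fourier sums\<close>

lemma abs_sin_diff_le: "\<bar>sin a - sin b\<bar> \<le> \<bar>a - b\<bar>" for a b :: real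
proof -
  have "\<bar>sin a - sin b\<bar> = 2 * \<bar>sin ((a - b) / 2)\<bar> * \<bar>cos ((a + b) / 2)\<bar>"
    by (simp add: sin_diff_sin abs_mult)
  also have "\<dots> \<le> 2 * \<bar>(a - b) / 2\<bar> * 1"
    by (intro mult_mono mult_left_mono abs_sin_x_le_abs_x) auto
  finally show ?thesis by simp
qed

context spike_geometry
begin

text \<open>
  The distance that the intervals \<open>D\<^sub>k\<close> keep from the nodes.
\<close>

definition margin :: real where "margin = 1 / (real n * ln (real n))"

lemma ln_n_ge: "1 / 2 \<le> ln (real n)"
  using ln_2_ge_half n2 ln_le_cancel_iff[of 2 "real n"] by linarith

lemma margin_pos: "0 < margin"
  using ln_n_ge n2 by (simp add: margin_def)

lemma inverse_margin: "1 / margin = real n * ln (real n)"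
  by (simp add: margin_def)

lemma cell:
  assumes "x \<in> {0..<2 * pi}"
  obtains i where "i \<le> n" "d * real i \<le> x" "x < d * (real i + 1)"
proof
  let ?i = "nat \<lfloor>x / d\<rfloor>"
  have nn: "0 \<le> x / d" using assms d_pos by auto
  then have ri: "real ?i = of_int \<lfloor>x / d\<rfloor>" by simp
  show 1: "d * real ?i \<le> x"
    unfolding ri using mult_left_mono[OF of_int_floor_le[of "x / d"], of d] d_pos by simp
  have "x / d < of_int \<lfloor>x / d\<rfloor> + 1" by linarith
  then show "x < d * (real ?i + 1)" unfolding ri using d_pos by (simp add: field_simps)
  have "d * real ?i < d * (real n + 1 / 2)" using 1 assms d_mult(2) by simp
  then have "real ?i < real n + 1 / 2" using d_pos by simp
  then show "?i \<le> n" by linarith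
qed

text \<open>
  Spikes in the cell of \<open>x\<close> and at its right end may be as near as \<open>margin\<close>; all the others are away
  by a multiple of \<open>d\<close> that grows linearly with the number of cells in between.
\<close>

lemma inverse_distance_le:
  assumes k: "k \<in> {1..n}" and t: "t \<in> spike n m k"
    and i: "d * real i \<le> x" "x < d * (real i + 1)"
    and away: "x \<notin> {node n k - margin..node n k + 2 / (real (m k))\<^sup>2 + margin}"
  shows "1 / \<bar>t - x\<bar> \<le> (if k = i \<or> k = Suc i then real n * ln (real n) else 0)
     + (if i + 2 \<le> k then 1 / (d * real (k - Suc i)) else 0) + (if k < i then 2 / (d * real (i - k)) else 0)"
proof -
  have tt: "node n k < t" "t < node n k + 2 / (real (m k))\<^sup>2" "t < d * real k + d / 4" "d * real k < t"
    using t spike_subset[OF k] by (auto simp: spike_def node_eq)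
  consider "k = i \<or> k = Suc i" | "i + 2 \<le> k" | "k < i" by linarith
  then show ?thesis
  proof cases
    case 1
    have "margin \<le> \<bar>t - x\<bar>" using tt away by (auto simp: not_le)
    then have "1 / \<bar>t - x\<bar> \<le> 1 / margin" using margin_pos by (intro frac_le) auto
    then show ?thesis using 1 by (auto simp: inverse_margin)
  next
    case 2
    have "d * real (k - Suc i) = d * real k - d * (real i + 1)"
      using 2 by (simp add: of_nat_diff algebra_simps)
    then have "d * real (k - Suc i) \<le> \<bar>t - x\<bar>" using tt i by linarith
    then have "1 / \<bar>t - x\<bar> \<le> 1 / (d * real (k - Suc i))" using d_pos 2 by (intro frac_le) auto
    then show ?thesis using 2 by simp
  next
    case 3
    have "d * real (i - k) = d * real i - d * real k" using 3 by (simp add: of_nat_diff algebra_simps)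
    moreover have "d * 1 \<le> d * real (i - k)" using 3 d_pos by (intro mult_left_mono) auto
    ultimately have "d * real (i - k) / 2 \<le> \<bar>t - x\<bar>" using tt i d_pos by linarith
    then have "1 / \<bar>t - x\<bar> \<le> 1 / (d * real (i - k) / 2)" using d_pos 3 by (intro frac_le) auto
    then show ?thesis using 3 by simp
  qed
qed

text \<open>
  The way from the spike to \<open>x\<close> through the end of the period is at least as long as the distance of
  the spike from \<open>2\<pi>\<close> if the spike is to the right of \<open>x\<close>, and from \<open>0\<close> otherwise.
\<close>

lemma inverse_codistance_le:
  assumes k: "k \<in> {1..n}" and t: "t \<in> spike n m k" and x: "x \<in> {0..<2 * pi}"
  shows "1 / (2 * pi - \<bar>t - x\<bar>) \<le> 4 / (d * real (n - k + 1)) + 1 / (d * real k)"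
proof (cases "x \<le> t")
  case True
  have "d * real (n - k + 1) = d * real n - d * real k + d" using k by (simp add: of_nat_diff algebra_simps)
  moreover have "d * real k \<le> d * real n" using k d_pos by auto
  moreover have "t < d * real k + d / 4" using t spike_subset[OF k] by auto
  ultimately have "d * real (n - k + 1) / 4 \<le> 2 * pi - \<bar>t - x\<bar>" using True x d_mult(1) d_pos by auto
  then have "1 / (2 * pi - \<bar>t - x\<bar>) \<le> 1 / (d * real (n - k + 1) / 4)" using d_pos by (intro frac_le) auto
  also have "\<dots> \<le> 4 / (d * real (n - k + 1)) + 1 / (d * real k)" using d_pos by simp
  finally show ?thesis .
next
  case False
  have "d * real k < t" using t spike_subset[OF k] by auto
  then have "d * real k \<le> 2 * pi - \<bar>t - x\<bar>" using False x by auto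
  then have "1 / (2 * pi - \<bar>t - x\<bar>) \<le> 1 / (d * real k)" using d_pos k by (intro frac_le) auto
  also have "\<dots> \<le> 4 / (d * real (n - k + 1)) + 1 / (d * real k)" using d_pos by simp
  finally show ?thesis .
qed

end

context spike_function
begin

text \<open>
  Only the size of the kernel is used here. The two nearest spikes contribute at most
  \<open>(1/n) \<cdot> n log n\<close> each, the others a harmonic sum.
\<close>

lemma fourier_sum_f_le:
  assumes x: "x \<in> {0..<2 * pi}"
    and away: "\<And>k. k \<in> {1..n} \<Longrightarrow> x \<notin> {node n k - margin..node n k + 2 / (real (m k))\<^sup>2 + margin}"
  shows "cmod (partial_sum f r x) \<le> 8 * ln (real n)"
proof -
  obtain i where i: "i \<le> n" "d * real i \<le> x" "x < d * (real i + 1)" using cell[OF x] .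
  define A1 where "A1 = (\<lambda>k. if k = i \<or> k = Suc i then real n * ln (real n) else 0)"
  define A2 where "A2 = (\<lambda>k. if i + 2 \<le> k then 1 / (d * real (k - Suc i)) else 0)"
  define A3 where "A3 = (\<lambda>k. if k < i then 2 / (d * real (i - k)) else 0)"
  define B where "B = (\<lambda>k. 4 / (d * real (n - k + 1)) + 1 / (d * real k))"
  let ?T = "\<lambda>k. A1 k + A2 k + A3 k + B k"
  have T0: "0 \<le> ?T k" for k
    unfolding A1_def A2_def A3_def B_def using d_pos ln_n_ge by auto
  have "(real (m k))\<^sup>2 / (pi * real n) * \<bar>kernel_integral r x k\<bar> \<le> 2 / (pi * real n) * (pi / 2 * ?T k)"
    if k: "k \<in> {1..n}" for k
  proof (rule spike_kernel_le[OF k])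
    fix t assume t: "t \<in> spike n m k"
    have "t \<in> {0<..<2 * pi}" using spike_in_period[OF k] t by auto
    moreover have "t \<noteq> x" using away[OF k] t margin_pos by (auto simp: spike_def)
    ultimately have "1 / (2 * \<bar>sin ((t - x) / 2)\<bar>) \<le> pi / 2 * (1 / \<bar>t - x\<bar> + 1 / (2 * pi - \<bar>t - x\<bar>))"
      using x by (intro inverse_sin_half_le) auto
    also have "\<dots> \<le> pi / 2 * ?T k"
      using inverse_distance_le[OF k t i(2,3) away[OF k]] inverse_codistance_le[OF k t x]
      unfolding A1_def A2_def A3_def B_def by (intro mult_left_mono) auto
    finally show "\<bar>dirichlet_kernel r (t - x)\<bar> \<le> pi / 2 * ?T k"
      using abs_dirichlet_kernel_le order_trans by blast
  next
    show "0 \<le> pi / 2 * ?T k" using T0 by simp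
  qed
  note term_le = this
  have abs_term_le: "\<bar>contribution r x k\<bar> \<le> ?T k / real n" if "k \<in> {1..n}" for k
  proof -
    have "2 / (pi * real n) * (pi / 2 * ?T k) = ?T k / real n" using n2 by (simp add: divide_simps)
    with term_le[OF that] show ?thesis by (simp add: abs_mult)
  qed
  have "cmod (partial_sum f r x) = \<bar>\<Sum>k\<in>{1..n}. contribution r x k\<bar>"
    unfolding fourier_sum_f norm_of_real ..
  also have "\<dots> \<le> (\<Sum>k\<in>{1..n}. ?T k / real n)"
    by (rule order_trans[OF sum_abs sum_mono]) (rule abs_term_le)
  also have "\<dots> = ((\<Sum>k\<in>{1..n}. A1 k) + (\<Sum>k\<in>{1..n}. A2 k) + (\<Sum>k\<in>{1..n}. A3 k) + (\<Sum>k\<in>{1..n}. B k)) / real n"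
    by (simp add: sum_divide_distrib[symmetric] sum.distrib)
  also have "\<dots> \<le> (2 * (real n * ln (real n)) + harm n / d + 2 * (harm n / d) + 5 * (harm n / d)) / real n"
  proof (intro divide_right_mono add_mono)
    have "(\<Sum>k\<in>{1..n}. A1 k) \<le> (\<Sum>k\<in>{i, Suc i}. real n * ln (real n))"
      unfolding A1_def using ln_n_ge
      by (subst sum.inter_filter[symmetric], simp) (rule sum_mono2, auto)
    then show "(\<Sum>k\<in>{1..n}. A1 k) \<le> 2 * (real n * ln (real n))" by simp
    have "(\<Sum>k\<in>{1..n}. A2 k) = (\<Sum>k\<in>{k \<in> {1..n}. i + 2 \<le> k}. 1 / real (k - Suc i)) / d"
      unfolding A2_def by (subst sum.inter_filter[symmetric]) (auto simp: sum_divide_distrib mult.commute)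
    also have "\<dots> \<le> harm n / d"
      using d_pos by (intro divide_right_mono sum_inverse_le_harm) (auto simp: inj_on_def)
    finally show "(\<Sum>k\<in>{1..n}. A2 k) \<le> harm n / d" .
    have "(\<Sum>k\<in>{1..n}. A3 k) = 2 * ((\<Sum>k\<in>{k \<in> {1..n}. k < i}. 1 / real (i - k)) / d)"
      unfolding A3_def by (subst sum.inter_filter[symmetric])
        (auto simp: sum_divide_distrib sum_distrib_left mult.commute)
    also have "\<dots> \<le> 2 * (harm n / d)"
      using d_pos i(1) by (intro mult_left_mono divide_right_mono sum_inverse_le_harm) (auto simp: inj_on_def)
    finally show "(\<Sum>k\<in>{1..n}. A3 k) \<le> 2 * (harm n / d)" .
    have "(\<Sum>k\<in>{1..n}. B k) = 4 * ((\<Sum>k\<in>{1..n}. 1 / real (n - k + 1)) / d) + (\<Sum>k\<in>{1..n}. 1 / real k) / d"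
      unfolding B_def by (simp add: sum.distrib sum_divide_distrib sum_distrib_left mult.commute)
    also have "\<dots> \<le> 4 * (harm n / d) + harm n / d"
      using d_pos by (intro add_mono mult_left_mono divide_right_mono sum_inverse_le_harm) (auto simp: inj_on_def)
    finally show "(\<Sum>k\<in>{1..n}. B k) \<le> 5 * (harm n / d)" by simp
  qed simp
  also have "\<dots> = 2 * ln (real n) + 8 * harm n / (d * real n)"
    using n2 d_pos by (simp add: field_simps)
  also have "\<dots> \<le> 2 * ln (real n) + 8 * harm n / 4"
    using d_ge n2 harm_nonneg[of n] by (intro add_mono divide_left_mono mult_pos_pos) (auto simp: field_simps d_pos)
  also have "\<dots> \<le> 8 * ln (real n)"
    using harm_le_ln[of n] ln_n_ge n2 by simp
  finally show ?thesis .
qed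

text \<open>
  In the application \<open>s\<close> is a sign that makes the oscillating kernel positive on the spike.
\<close>

lemma kernel_integral_ge:
  assumes k: "k \<in> {1..n}"
    and nz: "\<And>t. t \<in> {node n k..node n k + 2 / (real (m k))\<^sup>2} \<Longrightarrow> sin ((t - x) / 2) \<noteq> 0"
    and B: "\<And>t. t \<in> spike n m k \<Longrightarrow> B \<le> s * dirichlet_kernel r (t - x)"
  shows "2 / (pi * real n) * B \<le> s * (contribution r x k)"
proof -
  have i: "set_integrable lebesgue (spike n m k) (\<lambda>t. dirichlet_kernel r (t - x))"
    unfolding spike_def by (rule dirichlet_kernel_set_integrable[OF nz])
  have "B * (2 / (real (m k))\<^sup>2) = (LINT t:spike n m k|lebesgue. B)"
    by (simp add: spike_def set_lebesgue_integral_def)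
  also have "\<dots> \<le> (LINT t:spike n m k|lebesgue. s * dirichlet_kernel r (t - x))"
  proof (rule set_integral_mono)
    show "set_integrable lebesgue (spike n m k) (\<lambda>t. B)"
      unfolding spike_def set_integrable_def by simp
  qed (use i B in \<open>auto intro: set_integrable_mult_right\<close>)
  also have "\<dots> = s * kernel_integral r x k"
    by (simp add: kernel_integral_def)
  finally have "(real (m k))\<^sup>2 / (pi * real n) * (B * (2 / (real (m k))\<^sup>2)) \<le> (real (m k))\<^sup>2 / (pi * real n) * (s * kernel_integral r x k)"
    by (rule mult_left_mono) simp
  then show ?thesis using m_pos[OF k] by (simp add: mult_ac)
qed

end

text \<open>
  The last requirement on \<open>\<phi>\<^sub>n\<close>: at points of the interval \<open>D\<^sub>k\<^sub>-\<^sub>1\<close> the spikes before the node \<open>k\<close>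
  contribute little to the Fourier sum of order \<open>m\<^sub>k\<close>.
\<close>

locale admissible_spikes = spike_function +
  assumes earlier_spikes: "\<And>k x. k \<in> {2..n} \<Longrightarrow> x \<in> gap n (k - 1) \<Longrightarrow>
      \<bar>1 / pi * (LINT t:(\<Union>j\<in>{1..k - 1}. spike n m j)|lebesgue.
              f t * dirichlet_kernel (m k) (t - x))\<bar> < 1"
begin

text \<open>
  Since \<open>m\<^sub>k + 1/2\<close> is \<open>\<lambda>\<^sub>k (2n + 1)/2\<close>, the phase \<open>(m\<^sub>k + 1/2) A\<^sub>j\<close> is a multiple of \<open>2\<pi>\<close> for every node, and
  the spikes \<open>j \<ge> k\<close> are so narrow that the phase hardly changes on them. So the numerator of the kernel
  is close to \<open>- sin ((m\<^sub>k + 1/2) x)\<close> on all of them, whereas its denominator is positive and at most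
  a constant times \<open>(j - k + 1)/n\<close>. The resulting harmonic sum produces the logarithm.
\<close>

lemma fourier_sum_f_ge:
  assumes k: "k \<in> {2..n}" and x: "x \<in> gap n (k - 1)"
    and sin: "\<delta> \<le> \<bar>sin ((real (m k) + 1 / 2) * x)\<bar>" and \<delta>: "0 < \<delta>" "8 \<le> \<delta> * real n"
  shows "\<delta> / (10 * pi) * ln (real (n - k + 1)) - 1 \<le>
    cmod (partial_sum f (m k) x)"
proof -
  define M where "M = real (m k) + 1 / 2"
  \<comment> \<open>the common sign of the kernel on the spikes to the right of \<open>x\<close>\<close>
  define s where "s = - sgn (sin (M * x))"
  have k1: "k \<in> {1..n}" using k by auto
  have s1: "\<bar>s\<bar> \<le> 1" by (simp add: s_def abs_sgn_eq)
  have x_bd: "d * (real k - 1) < x" "x < d * real k" "0 < x"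
  proof -
    have "node n (k - 1) + margin \<le> x" "x \<le> node n k - margin"
      using x k by (simp_all add: gap_def margin_def)
    then show "d * (real k - 1) < x" "x < d * real k"
      using margin_pos k by (auto simp: node_eq of_nat_diff)
    have "0 \<le> d * (real k - 1)" using d_pos k by auto
    then show "0 < x" using \<open>d * (real k - 1) < x\<close> by simp
  qed
  have term_ge: "\<delta> / (10 * pi) * (1 / real (j - k + 1)) \<le>
      s * (contribution (m k) x j)" if j: "j \<in> {k..n}" for j
  proof -
    have j1: "j \<in> {1..n}" using j k by auto
    have w: "2 / (real (m j))\<^sup>2 \<le> 2 / (real n)\<^sup>2" by (rule width_le[OF j1])
    have wk: "2 / (real (m j))\<^sup>2 \<le> 2 / (real (m k))\<^sup>2"
      using m_mono[OF k1 j1] m_pos[OF k1] j by (intro divide_left_mono power_mono) auto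
    have jk: "d * real k \<le> d * real j" "d * real j \<le> d * real n" using j d_pos by auto
    have range: "0 < t - x \<and> t - x < 2 * pi \<and> t - x \<le> 10 * real (j - k + 1) / real n"
      if t: "t \<in> {node n j..node n j + 2 / (real (m j))\<^sup>2}" for t
    proof -
      have t': "d * real j \<le> t" "t \<le> d * real j + d / 4"
        using t w width_le_d by (auto simp: node_eq)
      have "d * real (j - k + 1) = d * real j - d * (real k - 1)"
        using j by (simp add: of_nat_diff algebra_simps)
      moreover have "d * 1 \<le> d * real (j - k + 1)" using d_pos by (intro mult_left_mono) auto
      ultimately have "t - x \<le> 5 / 4 * (d * real (j - k + 1))" using t' x_bd by linarith
      also have "\<dots> \<le> 5 / 4 * (8 / real n * real (j - k + 1))"
      proof (intro mult_left_mono mult_right_mono)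
        have "d \<le> 4 * pi / (2 * real n)" unfolding d_def using n2 by (intro divide_left_mono) auto
        also have "\<dots> \<le> 8 / real n" using pi_less_4 n2 by (simp add: field_simps)
        finally show "d \<le> 8 / real n" .
      qed auto
      also have "\<dots> = 10 * real (j - k + 1) / real n" using n2 by (simp add: field_simps)
      finally show ?thesis using t' x_bd jk d_mult(1) d_pos by linarith
    qed
    have "2 / (pi * real n) * (\<delta> / 2 * (real n / (10 * real (j - k + 1)))) \<le>
       s * (contribution (m k) x j)"
    proof (rule kernel_integral_ge[OF j1])
      fix t assume "t \<in> {node n j..node n j + 2 / (real (m j))\<^sup>2}"
      then show "sin ((t - x) / 2) \<noteq> 0" using range[of t] by (intro sin_half_nonzero) auto
    next
      fix t assume t: "t \<in> spike n m j"
      then have r: "0 < t - x" "t - x < 2 * pi" "t - x \<le> 10 * real (j - k + 1) / real n"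
        using range[of t] by (auto simp: spike_def)
      define h where "h = t - node n j"
      have h: "0 < h" "h < 2 / (real (m k))\<^sup>2" using t wk by (auto simp: spike_def h_def)
      \<comment> \<open>the resonance between the frequency and the nodes\<close>
      have Mn: "M * node n j = 2 * pi * of_int (int (l k * j))"
      proof -
        have "2 * real (m k) + 1 = real (l k) * (2 * real n + 1)"
          using two_m[OF k1] by (metis of_nat_1 of_nat_add of_nat_mult of_nat_numeral)
        then have "M = real (l k) * (2 * real n + 1) / 2" by (simp add: M_def)
        then show ?thesis using n2 by (simp add: node_def divide_simps)
      qed
      \<comment> \<open>\<open>h\<close> is at most the width of the spike, so \<open>M h\<close> is a small perturbation of the phase\<close>
      have "M * (t - x) = (M * h - M * x) + 2 * pi * of_int (int (l k * j))"
        using Mn by (simp add: h_def algebra_simps)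
      then have sine: "sin (M * (t - x)) = sin (M * h - M * x)"
        using sin_cos_eq_iff by metis
      have "\<bar>sin (M * h - M * x) - sin (- (M * x))\<bar> \<le> \<bar>M * h\<bar>"
        using abs_sin_diff_le[of "M * h - M * x" "- (M * x)"] by simp
      also have "\<dots> \<le> (2 * real (m k)) * (2 / (real (m k))\<^sup>2)"
      proof -
        have "\<bar>M * h\<bar> = M * h" using h by (simp add: M_def)
        also have "\<dots> \<le> (2 * real (m k)) * (2 / (real (m k))\<^sup>2)"
          using h m_pos[OF k1] unfolding M_def by (intro mult_mono) auto
        finally show ?thesis .
      qed
      also have "\<dots> = 4 / real (m k)" using m_pos[OF k1] by (simp add: power2_eq_square)
      also have "\<dots> \<le> 4 / real n" using m_ge[OF k1] n2 by (intro divide_left_mono) auto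
      also have "\<dots> \<le> \<delta> / 2" using \<delta> n2 by (simp add: field_simps)
      finally have close: "\<bar>sin (M * (t - x)) + sin (M * x)\<bar> \<le> \<delta> / 2" by (simp add: sine)
      have "\<delta> / 2 \<le> s * sin (M * (t - x))"
        using close sin \<delta> unfolding s_def M_def[symmetric]
        by (auto simp: sgn_if abs_if split: if_splits)
      moreover have sp: "0 < sin ((t - x) / 2)" using r by (intro sin_gt_zero) auto
      moreover have "real n / (10 * real (j - k + 1)) \<le> 1 / (2 * sin ((t - x) / 2))"
      proof -
        have "2 * sin ((t - x) / 2) \<le> t - x" using sin_x_le_x[of "(t - x) / 2"] r by simp
        then have "2 * sin ((t - x) / 2) \<le> 10 * real (j - k + 1) / real n" using r by linarith
        then have "1 / (10 * real (j - k + 1) / real n) \<le> 1 / (2 * sin ((t - x) / 2))"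
          using sp by (intro frac_le) auto
        then show ?thesis by simp
      qed
      ultimately have "\<delta> / 2 * (real n / (10 * real (j - k + 1))) \<le> s * sin (M * (t - x)) * (1 / (2 * sin ((t - x) / 2)))"
        using \<delta> by (intro mult_mono) auto
      then show "\<delta> / 2 * (real n / (10 * real (j - k + 1))) \<le> s * dirichlet_kernel (m k) (t - x)"
        by (simp add: dirichlet_kernel_def M_def)
    qed
    moreover have "2 / (pi * real n) * (\<delta> / 2 * (real n / (10 * real (j - k + 1)))) = \<delta> / (10 * pi) * (1 / real (j - k + 1))"
      using n2 by (simp add: divide_simps)
    ultimately show ?thesis by simp
  qed
  let ?c = "\<lambda>j. contribution (m k) x j"
  have "harm (n - k + 1) = (\<Sum>j\<in>{k..n}. 1 / real (j - k + 1))"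
    unfolding harm_def
    by (rule sum.reindex_bij_witness[where i = "\<lambda>j. j - k + 1" and j = "\<lambda>i. i + k - 1"])
      (use k in \<open>auto simp: inverse_eq_divide\<close>)
  then have "\<delta> / (10 * pi) * ln (real (n - k + 1)) \<le> \<delta> / (10 * pi) * (\<Sum>j\<in>{k..n}. 1 / real (j - k + 1))"
    using harm_ge_ln[of "n - k + 1"] \<delta> k
    by (intro mult_left_mono) (auto intro: order_trans[rotated])
  also have "\<dots> \<le> (\<Sum>j\<in>{k..n}. s * ?c j)"
    unfolding sum_distrib_left by (rule sum_mono[OF term_ge])
  also have "\<dots> = s * (\<Sum>j\<in>{k..n}. ?c j)" by (simp add: sum_distrib_left)
  also have "\<dots> \<le> \<bar>\<Sum>j\<in>{k..n}. ?c j\<bar>"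
    using s1 abs_le_D1[OF order_refl, of "s * (\<Sum>j\<in>{k..n}. ?c j)"]
      mult_right_mono[OF s1 abs_ge_zero[of "\<Sum>j\<in>{k..n}. ?c j"]] by (simp add: abs_mult)
  finally have late: "\<delta> / (10 * pi) * ln (real (n - k + 1)) \<le> \<bar>\<Sum>j\<in>{k..n}. ?c j\<bar>" .
  have early: "\<bar>\<Sum>j\<in>{1..k - 1}. ?c j\<bar> < 1"
  proof -
    have "{1..k - 1} \<subseteq> {1..n}" using k by auto
    from set_integral_spikes[OF this, of "m k" x] earlier_spikes[OF k x] show ?thesis by presburger
  qed
  have "{1..n} = {1..k - 1} \<union> {k..n}" using k by auto
  then have "(\<Sum>j\<in>{1..n}. ?c j) = (\<Sum>j\<in>{1..k - 1}. ?c j) + (\<Sum>j\<in>{k..n}. ?c j)"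
    by (simp only:) (rule sum.union_disjoint, auto)
  then show ?thesis unfolding fourier_sum_f norm_of_real using late early by linarith
qed

end

section \<open>Exceptional sets of one level\<close>

lemma measure_circle_UN_Icc_le:
  assumes "finite I" "\<And>i. i \<in> I \<Longrightarrow> a i \<le> b i"
  shows "measure circle ({0..<2 * pi} \<inter> (\<Union>i\<in>I. {a i..b i})) \<le> (\<Sum>i\<in>I. b i - a i)"
proof -
  have s: "{0..<2 * pi} \<inter> {a i..b i} \<in> sets circle" for i
    unfolding circle_def by (subst sets_restrict_space_iff) auto
  have "measure circle ({0..<2 * pi} \<inter> {a i..b i}) \<le> b i - a i" if "i \<in> I" for i
  proof -
    have "emeasure circle ({0..<2 * pi} \<inter> {a i..b i}) = emeasure lebesgue ({0..<2 * pi} \<inter> {a i..b i})"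
      by (rule emeasure_circle) auto
    also have "\<dots> \<le> emeasure lebesgue {a i..b i}" by (rule emeasure_mono) auto
    also have "\<dots> = ennreal (b i - a i)" using assms(2)[OF that] by simp
    finally show ?thesis using assms(2)[OF that]
      by (simp add: circle.emeasure_eq_measure)
  qed
  then have "(\<Sum>i\<in>I. measure circle ({0..<2 * pi} \<inter> {a i..b i})) \<le> (\<Sum>i\<in>I. b i - a i)"
    by (rule sum_mono)
  moreover have "measure circle (\<Union>i\<in>I. {0..<2 * pi} \<inter> {a i..b i}) \<le> (\<Sum>i\<in>I. measure circle ({0..<2 * pi} \<inter> {a i..b i}))"
    using assms(1) s by (intro measure_UNION_le) auto
  moreover have "(\<Union>i\<in>I. {0..<2 * pi} \<inter> {a i..b i}) = {0..<2 * pi} \<inter> (\<Union>i\<in>I. {a i..b i})" by auto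
  ultimately show ?thesis by simp
qed

lemma UN_Icc_sets_circle: "finite I \<Longrightarrow> {0..<2 * pi} \<inter> (\<Union>i\<in>I. {a i..b i}) \<in> sets circle"
  unfolding circle_def by (subst sets_restrict_space_iff) auto

lemma abs_sin_diff_int_pi: "\<bar>sin (y - pi * of_int i)\<bar> = \<bar>sin y\<bar>" for y :: real
proof -
  have "sin (pi * of_int i) = 0" by (simp add: sin_zero_iff_int2)
  moreover have "\<bar>cos (pi * of_int i)\<bar> = 1"
  proof -
    have "(cos (pi * of_int i))\<^sup>2 = 1\<^sup>2" using sin_cos_squared_add[of "pi * of_int i"] calculation by simp
    then show ?thesis by (simp add: power2_eq_iff abs_if)
  qed
  ultimately show ?thesis by (simp add: sin_diff abs_mult)
qed

lemma near_int_pi_of_abs_sin_less: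
  fixes y :: real
  assumes "\<bar>sin y\<bar> < \<delta>"
  shows "\<bar>y - pi * of_int (round (y / pi))\<bar> \<le> pi * \<delta> / 2"
proof -
  define v where "v = \<bar>y - pi * of_int (round (y / pi))\<bar>"
  have "\<bar>of_int (round (y / pi)) - y / pi\<bar> \<le> 1 / 2" by (rule of_int_round_abs_le)
  then have "pi * \<bar>of_int (round (y / pi)) - y / pi\<bar> \<le> pi * (1 / 2)" by (intro mult_left_mono) auto
  moreover have "pi * \<bar>of_int (round (y / pi)) - y / pi\<bar> = v"
  proof -
    have "pi * \<bar>of_int (round (y / pi)) - y / pi\<bar> = \<bar>pi * (of_int (round (y / pi)) - y / pi)\<bar>"
      by (simp add: abs_mult)
    also have "\<dots> = v" by (simp add: v_def right_diff_distrib abs_minus_commute)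
    finally show ?thesis .
  qed
  ultimately have v: "0 \<le> v" "v \<le> pi / 2" by (auto simp: v_def)
  have "2 * v / pi \<le> sin v" by (rule jordan_sin_inequality[OF v])
  also have "sin \<bar>w\<bar> \<le> \<bar>sin w\<bar>" for w :: real
    by (cases "0 \<le> w") auto
  then have "sin v \<le> \<bar>sin (y - pi * of_int (round (y / pi)))\<bar>"
    unfolding v_def .
  also have "\<dots> < \<delta>" using assms by (simp add: abs_sin_diff_int_pi)
  finally show ?thesis unfolding v_def[symmetric] by (simp add: field_simps)
qed

context spike_geometry
begin

lemma measure_near_spikes:
  "measure circle ({0..<2 * pi} \<inter> (\<Union>k\<in>{1..n}. {node n k - margin..node n k + 2 / (real (m k))\<^sup>2 + margin}))
     \<le> 2 / ln (real n) + 2 / real n"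
proof -
  have "measure circle ({0..<2 * pi} \<inter> (\<Union>k\<in>{1..n}. {node n k - margin..node n k + 2 / (real (m k))\<^sup>2 + margin}))
     \<le> (\<Sum>k\<in>{1..n}. node n k + 2 / (real (m k))\<^sup>2 + margin - (node n k - margin))"
    using margin_pos by (intro measure_circle_UN_Icc_le) (auto simp: add_nonneg_nonneg intro: order_trans[of _ 0])
  also have "\<dots> \<le> (\<Sum>k\<in>{1..n}. 2 / (real n)\<^sup>2 + 2 * margin)"
    by (intro sum_mono) (use width_le in auto)
  also have "\<dots> = 2 / ln (real n) + 2 / real n"
    using n2 ln_n_ge by (simp add: margin_def divide_simps power2_eq_square)
  finally show ?thesis .
qed

text \<open>
  A point where no order \<open>m\<^sub>k\<close> is good lies in the first cell, beyond the node \<open>n - s\<close> (where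
  \<open>log (n - k + 1)\<close> may be too small), within \<open>margin\<close> of a node, or near a zero of the sine that
  belongs to its cell.
\<close>

lemma bad_points_cover:
  assumes x: "x \<in> {0..<2 * pi}" and s: "s \<le> n"
    and bad: "\<And>k. k \<in> {2..n - s} \<Longrightarrow> x \<in> gap n (k - 1) \<Longrightarrow> \<bar>sin ((real (m k) + 1 / 2) * x)\<bar> < \<delta>"
  shows "x \<in> {0..d} \<or> x \<in> {d * (real n - real s)..2 * pi} \<or>
    x \<in> (\<Union>k\<in>{2..n}. {d * (real k - 1)..d * (real k - 1) + margin}) \<or>
    x \<in> (\<Union>k\<in>{2..n}. {d * real k - margin..d * real k}) \<or>
    x \<in> (\<Union>(k, i)\<in>Sigma {2..n} (\<lambda>k. {2 * int (l k) * (int k - 1)..2 * int (l k) * int k}).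
         {(pi * of_int i - pi * \<delta> / 2) / (real (m k) + 1 / 2)..(pi * of_int i + pi * \<delta> / 2) / (real (m k) + 1 / 2)})"
proof -
  obtain i0 where i0: "i0 \<le> n" "d * real i0 \<le> x" "x < d * (real i0 + 1)" using cell[OF x] .
  define k where "k = Suc i0"
  have "real k = real i0 + 1" by (simp add: k_def)
  then have kx: "d * (real k - 1) \<le> x" "x < d * real k" using i0 by (simp_all only: add_diff_cancel_right')
  show ?thesis
  proof (cases "k = 1 \<or> n - s < k")
    case True
    then show ?thesis
    proof
      assume "k = 1" then show ?thesis using kx x by auto
    next
      assume "n - s < k"
      then have "real n - real s \<le> real k - 1" using s by linarith
      then have "d * (real n - real s) \<le> d * (real k - 1)" using d_pos by simp
      then show ?thesis using kx x by auto
    qed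
  next
    case False
    then have k: "k \<in> {2..n - s}" "k \<in> {2..n}" by (auto simp: k_def)
    show ?thesis
    proof (cases "x \<in> gap n (k - 1)")
      case True
      define M where "M = real (m k) + 1 / 2"
      have M0: "0 < M" by (simp add: M_def)
      have Md: "M * d = 2 * pi * real (l k)"
      proof -
        have "2 * real (m k) + 1 = real (l k) * (2 * real n + 1)"
          using arg_cong[OF m_eq[OF k(2)], of real] by (simp add: algebra_simps)
        then have "M = real (l k) * (2 * real n + 1) / 2" by (simp add: M_def)
        then show ?thesis by (simp add: d_def divide_simps)
      qed
      define i where "i = round (M * x / pi)"
      have "\<bar>M * x - pi * of_int i\<bar> \<le> pi * \<delta> / 2"
        unfolding i_def using bad[OF k(1) True] by (intro near_int_pi_of_abs_sin_less) (simp add: M_def)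
      then have "(pi * of_int i - pi * \<delta> / 2) / M \<le> x" "x \<le> (pi * of_int i + pi * \<delta> / 2) / M"
        unfolding pos_divide_le_eq[OF M0] pos_le_divide_eq[OF M0] abs_le_iff by (simp_all add: mult.commute)
      moreover have "2 * int (l k) * (int k - 1) \<le> i"
      proof -
        have "M * (d * (real k - 1)) \<le> M * x" using kx M0 by simp
        also have "M * (d * (real k - 1)) = 2 * real (l k) * (real k - 1) * pi"
          unfolding mult.assoc[symmetric] Md by simp
        finally have "2 * real (l k) * (real k - 1) \<le> M * x / pi"
          by (simp only: pos_le_divide_eq[OF pi_gt_zero])
        then have "round (real_of_int (2 * int (l k) * (int k - 1))) \<le> i"
          unfolding i_def by (intro round_mono) simp
        then show ?thesis by (simp only: round_of_int)
      qed
      moreover have "i \<le> 2 * int (l k) * int k"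
      proof -
        have "M * x \<le> M * (d * real k)" using kx M0 by simp
        also have "M * (d * real k) = 2 * real (l k) * real k * pi"
          unfolding mult.assoc[symmetric] Md by simp
        finally have "M * x / pi \<le> 2 * real (l k) * real k"
          by (simp only: pos_divide_le_eq[OF pi_gt_zero])
        then have "i \<le> round (real_of_int (2 * int (l k) * int k))"
          unfolding i_def by (intro round_mono) simp
        then show ?thesis by (simp only: round_of_int)
      qed
      ultimately have ki: "(k, i) \<in> Sigma {2..n} (\<lambda>k. {2 * int (l k) * (int k - 1)..2 * int (l k) * int k})"
        and xi: "x \<in> {(pi * of_int i - pi * \<delta> / 2) / (real (m k) + 1 / 2)..(pi * of_int i + pi * \<delta> / 2) / (real (m k) + 1 / 2)}"
        using k(2) by (simp_all add: M_def)
      show ?thesis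
        by (intro disjI2, rule UN_I[OF ki]) (simp only: prod.case xi)
    next
      case False
      then have "x < d * (real k - 1) + margin \<or> d * real k - margin < x"
      proof -
        have "real (k - 1) = real k - 1" "k - 1 + 1 = k" using k by auto
        then have "gap n (k - 1) = {d * (real k - 1) + margin..d * real k - margin}"
          by (simp only: gap_def node_eq margin_def)
        then show ?thesis using False by (auto simp: not_le)
      qed
      then have "x \<in> {d * (real k - 1)..d * (real k - 1) + margin} \<or> x \<in> {d * real k - margin..d * real k}"
        using kx by auto
      then show ?thesis using k(2) by blast
    qed
  qed
qed

text \<open>
  The zeros of \<open>sin ((m\<^sub>k + 1/2) x)\<close> cut each cell into \<open>2\<lambda>\<^sub>k\<close> pieces, as the cell consists of exactly
  \<open>\<lambda>\<^sub>k\<close> periods. The neighbourhoods of the zeros therefore cover a proportion \<open>O(\<delta>)\<close> of the cell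
  independently of \<open>\<lambda>\<^sub>k\<close>.
\<close>

lemma measure_bad_points:
  assumes s: "s \<le> n" and \<delta>: "0 < \<delta>"
    and B: "B \<subseteq> {0..<2 * pi}" "\<And>x k. x \<in> B \<Longrightarrow> k \<in> {2..n - s} \<Longrightarrow> x \<in> gap n (k - 1) \<Longrightarrow> \<bar>sin ((real (m k) + 1 / 2) * x)\<bar> < \<delta>"
  shows "measure circle B \<le> d + d * (real s + 1 / 2) + 2 / ln (real n) + 3 * pi * \<delta>"
proof -
  define M where "M = (\<lambda>k. real (m k) + 1 / 2)"
  define I where "I = (Sigma {2..n} (\<lambda>k. {2 * int (l k) * (int k - 1)..2 * int (l k) * int k}))"
  let ?S = "{0..<2 * pi}"
  let ?a = "\<lambda>p. (pi * of_int (snd p) - pi * \<delta> / 2) / M (fst p)"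
  let ?b = "\<lambda>p. (pi * of_int (snd p) + pi * \<delta> / 2) / M (fst p)"
  define C1 where "C1 = ?S \<inter> (\<Union>i\<in>{()}. {0..d})"
  define C2 where "C2 = ?S \<inter> (\<Union>i\<in>{()}. {d * (real n - real s)..2 * pi})"
  define C3 where "C3 = ?S \<inter> (\<Union>k\<in>{2..n}. {d * (real k - 1)..d * (real k - 1) + margin})"
  define C4 where "C4 = ?S \<inter> (\<Union>k\<in>{2..n}. {d * real k - margin..d * real k})"
  define C5 where "C5 = ?S \<inter> (\<Union>p\<in>I. {?a p..?b p})"
  have fI: "finite I" unfolding I_def by auto
  have sub: "B \<subseteq> C1 \<union> (C2 \<union> (C3 \<union> (C4 \<union> C5)))"
  proof
    fix x assume x: "x \<in> B"
    with B have xs: "x \<in> ?S" by auto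
    show "x \<in> C1 \<union> (C2 \<union> (C3 \<union> (C4 \<union> C5)))"
      using bad_points_cover[OF xs s B(2)[OF x]] xs
      unfolding C1_def C2_def C3_def C4_def C5_def M_def I_def case_prod_beta by simp
  qed
  have meas: "C1 \<in> sets circle" "C2 \<in> sets circle" "C3 \<in> sets circle" "C4 \<in> sets circle" "C5 \<in> sets circle"
    unfolding C1_def C2_def C3_def C4_def C5_def by (rule UN_Icc_sets_circle; use fI in simp)+
  have "measure circle B \<le> measure circle (C1 \<union> (C2 \<union> (C3 \<union> (C4 \<union> C5))))"
    using sub meas by (intro circle.finite_measure_mono) auto
  also have "\<dots> \<le> measure circle C1 + (measure circle C2 + (measure circle C3 + (measure circle C4 + measure circle C5)))"
    using meas by (intro order_trans[OF measure_Un_le] add_mono order_refl) auto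
  also have "measure circle C1 \<le> d"
    unfolding C1_def using d_pos by (intro order_trans[OF measure_circle_UN_Icc_le]) auto
  also have "measure circle C2 \<le> d * (real s + 1 / 2)"
  proof -
    have e: "2 * pi - d * (real n - real s) = d * (real s + 1 / 2)" using d_mult(1) by (simp add: algebra_simps)
    have "d * (real n - real s) \<le> 2 * pi" using e d_pos mult_nonneg_nonneg[of d "real s + 1 / 2"] by linarith
    then show ?thesis unfolding C2_def using e by (intro order_trans[OF measure_circle_UN_Icc_le]) auto
  qed
  also have "measure circle C3 \<le> real (n - 1) * margin"
    unfolding C3_def using margin_pos by (intro order_trans[OF measure_circle_UN_Icc_le]) auto
  also have "measure circle C4 \<le> real (n - 1) * margin"
    unfolding C4_def using margin_pos by (intro order_trans[OF measure_circle_UN_Icc_le]) auto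
  also have "measure circle C5 \<le> 3 * pi * \<delta>"
  proof -
    \<comment> \<open>a cell meets \<open>2\<lambda>\<^sub>k + 1 \<le> 3\<lambda>\<^sub>k\<close> zeros, its ends included, and \<open>m\<^sub>k + 1/2 \<ge> \<lambda>\<^sub>k n\<close>\<close>
    have "measure circle C5 \<le> (\<Sum>p\<in>I. ?b p - ?a p)"
      unfolding C5_def using fI \<delta>
      by (intro measure_circle_UN_Icc_le) (auto simp: M_def intro!: divide_right_mono)
    also have "\<dots> = (\<Sum>k\<in>{2..n}. \<Sum>i\<in>{2 * int (l k) * (int k - 1)..2 * int (l k) * int k}. pi * \<delta> / M k)"
      unfolding I_def by (subst sum.Sigma) (auto simp: diff_divide_distrib[symmetric] intro!: sum.cong)
    also have "\<dots> \<le> (\<Sum>k\<in>{2..n}. 3 * pi * \<delta> / real n)"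
    proof (rule sum_mono)
      fix k assume k: "k \<in> {2..n}"
      have l3: "3 \<le> l k" by (rule l_ge[OF k])
      have Mk: "real (l k) * real n \<le> M k"
      proof -
        have "2 * real (m k) + 1 = real (l k) * (2 * real n + 1)"
          using arg_cong[OF m_eq[OF k], of real] by (simp add: algebra_simps)
        then have "M k = real (l k) * real n + real (l k) / 2" by (simp add: M_def algebra_simps)
        then show ?thesis by simp
      qed
      have pos: "0 < real (l k) * real n" using l3 n2 by simp
      have "(\<Sum>i\<in>{2 * int (l k) * (int k - 1)..2 * int (l k) * int k}. pi * \<delta> / M k) = (2 * real (l k) + 1) * (pi * \<delta> / M k)"
        by (simp add: algebra_simps)
      also have "\<dots> \<le> (3 * real (l k)) * (pi * \<delta> / (real (l k) * real n))"
        using l3 \<delta> Mk pos by (intro mult_mono divide_left_mono) auto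
      also have "\<dots> = 3 * pi * \<delta> / real n" using l3 by simp
      finally show "(\<Sum>i\<in>{2 * int (l k) * (int k - 1)..2 * int (l k) * int k}. pi * \<delta> / M k) \<le> 3 * pi * \<delta> / real n" .
    qed
    also have "\<dots> = real (n - 1) * (3 * pi * \<delta> / real n)" by simp
    also have "\<dots> \<le> real n * (3 * pi * \<delta> / real n)" using \<delta> by (intro mult_right_mono) auto
    also have "\<dots> = 3 * pi * \<delta>" using n2 by simp
    finally show ?thesis .
  qed
  finally have "measure circle B \<le> d + (d * (real s + 1 / 2) + (real (n - 1) * margin + (real (n - 1) * margin + 3 * pi * \<delta>)))"
    by simp
  moreover have "real (n - 1) * margin \<le> 1 / ln (real n)"
  proof -
    have "real (n - 1) * margin \<le> real n * margin" using margin_pos by (intro mult_right_mono) auto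
    also have "\<dots> = 1 / ln (real n)" using n2 by (simp add: margin_def)
    finally show ?thesis .
  qed
  moreover have "2 / ln (real n) = 1 / ln (real n) + 1 / ln (real n)" by simp
  ultimately show ?thesis by linarith
qed

end

section \<open>Existence of admissible spike functions\<close>

context spike_geometry
begin

definition step :: "real \<Rightarrow> real" where
  "step x = (\<Sum>k\<in>{1..n}. (real (m k))\<^sup>2 / real n * indicator (spike n m k) (x - 2 * pi * of_int \<lfloor>x / (2 * pi)\<rfloor>))"

lemma spike_function_step: "spike_function n l m step"
proof
  fix x :: real
  have "\<lfloor>(x + 2 * pi) / (2 * pi)\<rfloor> = \<lfloor>x / (2 * pi)\<rfloor> + 1" by (simp add: add_divide_distrib)
  then have "(x + 2 * pi) - 2 * pi * of_int \<lfloor>(x + 2 * pi) / (2 * pi)\<rfloor> = x - 2 * pi * of_int \<lfloor>x / (2 * pi)\<rfloor>"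
    by (simp add: algebra_simps)
  then show "step (x + 2 * pi) = step x" by (simp only: step_def)
next
  fix k x assume k: "k \<in> {1..n}" and x: "x \<in> spike n m k"
  have "x \<in> {0<..<2 * pi}" using spike_in_period[OF k] x by auto
  then have "\<lfloor>x / (2 * pi)\<rfloor> = 0" by (simp add: floor_eq_iff)
  then have "step x = (\<Sum>j\<in>{1..n}. (real (m j))\<^sup>2 / real n * indicator (spike n m j) x)" by (simp add: step_def)
  also have "\<dots> = (\<Sum>j\<in>{1..n}. if j = k then (real (m k))\<^sup>2 / real n else 0)"
    using x spike_disjoint[OF _ k] by (intro sum.cong) (auto simp: indicator_def)
  finally show "step x = (real (m k))\<^sup>2 / real n" using k by simp
next
  fix x assume x: "x \<in> {0..2 * pi} - (\<Union>k\<in>{1..n}. spike n m k)"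
  show "step x = 0"
  proof (cases "x = 2 * pi")
    case True
    have "(0::real) \<notin> spike n m k" if "k \<in> {1..n}" for k
      using spike_in_period[OF that] by auto
    then show ?thesis unfolding step_def True by (intro sum.neutral) auto
  next
    case False
    then have "\<lfloor>x / (2 * pi)\<rfloor> = 0" using x by (simp add: floor_eq_iff)
    then show ?thesis unfolding step_def using x by (intro sum.neutral) auto
  qed
qed

text \<open>
  A lower bound for the distance between a point of \<open>D\<^sub>k\<^sub>-\<^sub>1\<close> and the spikes before the node \<open>k\<close>,
  modulo the period. It depends on \<open>n\<close> alone, so that the numbers \<open>m\<^sub>k\<close> can be chosen after it.
\<close>

definition clearance :: real where "clearance = margin - 2 / (real n)\<^sup>2"

text \<open>
  This amounts to \<open>2 log n < n\<close>.
\<close>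

lemma clearance_pos: "0 < clearance"
proof -
  have "ln (real n / 2) \<le> real n / 2 - 1" using n2 by (intro ln_le_minus_one) simp
  then have "2 * ln (real n) < real n" using n2 ln2_le_25_over_36 by (simp add: ln_div)
  then have "real n * (2 * ln (real n)) < real n * real n" using n2 by simp
  then have "2 / (real n)\<^sup>2 < margin"
    using n2 ln_n_ge by (simp add: margin_def divide_simps power2_eq_square mult_ac)
  then show ?thesis by (simp add: clearance_def)
qed

lemma clearance_le: "clearance \<le> d" "clearance \<le> pi"
proof -
  have "margin \<le> 1 / (real n * (1 / 2))"
    unfolding margin_def using ln_n_ge n2 by (intro divide_left_mono mult_left_mono) auto
  then have "margin \<le> 2 / real n" by simp
  moreover have "0 \<le> 2 / (real n)\<^sup>2" by simp
  ultimately have m: "clearance \<le> 2 / real n" unfolding clearance_def by linarith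
  also have "\<dots> \<le> 4 / real n" by (simp add: divide_right_mono)
  finally show "clearance \<le> d" using d_ge by linarith
  have "2 / real n \<le> 1" using n2 by simp
  then show "clearance \<le> pi" using m pi_gt3 by linarith
qed

lemma sin_half_ge_clearance:
  assumes k: "k \<in> {2..n}" and x: "x \<in> gap n (k - 1)" and j: "j \<in> {1..k - 1}"
    and t: "t \<in> {node n j..node n j + 2 / (real (m j))\<^sup>2}"
  shows "sin (clearance / 2) \<le> \<bar>sin ((t - x) / 2)\<bar>"
proof -
  have j1: "j \<in> {1..n}" using j k by auto
  have "k - 1 + 1 = k" using k by simp
  then have "d * real (k - 1) + margin \<le> x" "x \<le> d * real k - margin"
    using x unfolding gap_def node_eq margin_def[symmetric] by auto
  moreover have "d * real j \<le> t" "t \<le> d * real j + 2 / (real (m j))\<^sup>2"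
    using t by (auto simp: node_eq)
  moreover have "d * real j \<le> d * real (k - 1)" "d * real 1 \<le> d * real j" "d * real k \<le> d * real n"
    using j k d_pos by (auto intro!: mult_left_mono)
  ultimately have u: "clearance \<le> x - t" "x - t \<le> 2 * pi - clearance"
    using width_le[OF j1] d_mult(1) margin_pos clearance_le(1) d_pos
    unfolding clearance_def by linarith+
  have "sin (clearance / 2) \<le> sin ((x - t) / 2)"
  proof (cases "x - t \<le> pi")
    case True
    show ?thesis
    proof (rule sin_monotone_2pi_le)
      show "- (pi / 2) \<le> clearance / 2" using clearance_pos pi_gt_zero by linarith
      show "clearance / 2 \<le> (x - t) / 2" using u by simp
      show "(x - t) / 2 \<le> pi / 2" using True by simp
    qed
  next
    case False
    have "sin (clearance / 2) \<le> sin (pi - (x - t) / 2)"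
    proof (rule sin_monotone_2pi_le)
      show "- (pi / 2) \<le> clearance / 2" using clearance_pos pi_gt_zero by linarith
      show "clearance / 2 \<le> pi - (x - t) / 2" using u by (simp add: field_simps)
      show "pi - (x - t) / 2 \<le> pi / 2" using False by (simp add: field_simps)
    qed
    then show ?thesis by simp
  qed
  also have "\<dots> \<le> \<bar>sin ((x - t) / 2)\<bar>" by simp
  also have "\<dots> = \<bar>sin ((t - x) / 2)\<bar>"
  proof -
    have "(x - t) / 2 = - ((t - x) / 2)" by (simp add: field_simps)
    then show ?thesis by (simp only: sin_minus abs_minus_cancel)
  qed
  finally show ?thesis .
qed

text \<open>
  The spikes before the node \<open>k\<close> have height at most \<open>m\<^sub>k\<^sub>-\<^sub>1\<^sup>2/n\<close>, and the oscillation of the kernel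
  makes each of the fewer than \<open>n\<close> integrals \<open>O(1/m\<^sub>k)\<close>; so \<open>m\<^sub>k\<close> has to be large compared with
  \<open>m\<^sub>k\<^sub>-\<^sub>1\<^sup>2\<close>.
\<close>

lemma admissible_spikes_step:
  assumes growth: "\<And>k. k \<in> {2..n} \<Longrightarrow> (real (m (k - 1)))\<^sup>2 < real (m k) * (sin (clearance / 2))\<^sup>2"
  shows "admissible_spikes n l m step"
proof -
  interpret spike_function n l m step by (rule spike_function_step)
  define s where "s = sin (clearance / 2)"
  have s: "0 < s" unfolding s_def using clearance_pos clearance_le pi_gt_zero by (intro sin_gt_zero) auto
  show ?thesis
  proof
    fix k x assume k: "k \<in> {2..n}" and x: "x \<in> gap n (k - 1)"
    have sub: "{1..k - 1} \<subseteq> {1..n}" using k by auto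
    have mk: "0 < m k" using k by (intro m_pos) auto
    have "\<bar>contribution (m k) x j\<bar> \<le> (real (m (k - 1)))\<^sup>2 / (pi * real n) * (3 / (real (m k) * s\<^sup>2))"
      if j: "j \<in> {1..k - 1}" for j
    proof -
      have j1: "j \<in> {1..n}" and k1: "k - 1 \<in> {1..n}" using j k by auto
      have w: "2 / (real (m j))\<^sup>2 \<le> 2 * pi"
        using width_le[OF j1] width_le_d d_mult(1) d_pos mult_nonneg_nonneg[of d "real n"] by simp
      have "\<bar>kernel_integral (m k) x j\<bar> \<le> 3 / ((real (m k) + 1 / 2) * s\<^sup>2)"
        unfolding kernel_integral_def spike_def
        using w s sin_half_ge_clearance[OF k x j, folded s_def]
        by (intro dirichlet_kernel_integral_le) auto
      also have "\<dots> \<le> 3 / (real (m k) * s\<^sup>2)"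
        using s mk by (intro divide_left_mono mult_right_mono) auto
      finally have "(real (m j))\<^sup>2 / (pi * real n) * \<bar>kernel_integral (m k) x j\<bar> \<le> (real (m (k - 1)))\<^sup>2 / (pi * real n) * (3 / (real (m k) * s\<^sup>2))"
        using m_mono[OF j1 k1] j by (intro mult_mono divide_right_mono power_mono) auto
      then show ?thesis by (simp add: abs_mult)
    qed
    then have "\<bar>\<Sum>j\<in>{1..k - 1}. contribution (m k) x j\<bar>
      \<le> (\<Sum>j\<in>{1..k - 1}. (real (m (k - 1)))\<^sup>2 / (pi * real n) * (3 / (real (m k) * s\<^sup>2)))"
      by (intro order_trans[OF sum_abs sum_mono])
    also have "\<dots> = real (k - 1) * ((real (m (k - 1)))\<^sup>2 / (pi * real n) * (3 / (real (m k) * s\<^sup>2)))" by simp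
    also have "\<dots> \<le> real n * ((real (m (k - 1)))\<^sup>2 / (pi * real n) * (3 / (real (m k) * s\<^sup>2)))"
      using k by (intro mult_right_mono) auto
    also have "\<dots> = 3 / pi * ((real (m (k - 1)))\<^sup>2 / (real (m k) * s\<^sup>2))"
      using n2 by simp
    also have "\<dots> \<le> 1 * ((real (m (k - 1)))\<^sup>2 / (real (m k) * s\<^sup>2))"
      using pi_gt3 by (intro mult_right_mono) auto
    also have "\<dots> < 1"
      using growth[OF k] mk s by (simp add: s_def[symmetric])
    finally show "\<bar>1 / pi * (LINT t:(\<Union>j\<in>{1..k - 1}. spike n m j)|lebesgue.
              step t * dirichlet_kernel (m k) (t - x))\<bar> < 1"
      unfolding set_integral_spikes[OF sub] .
  qed
qed

end

text \<open>
  The choice \<open>\<lambda>\<^sub>k = Q \<lambda>\<^sub>k\<^sub>-\<^sub>1\<^sup>2\<close> makes \<open>m\<^sub>k\<close> exceed \<open>m\<^sub>k\<^sub>-\<^sub>1\<^sup>2\<close> by any prescribed factor, so that a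
  closed recursion replaces an inductive choice. The value at \<open>i\<close> is \<open>\<lambda>\<^sub>i\<^sub>+\<^sub>1\<close>. An odd \<open>Q\<close> keeps the multipliers odd.
\<close>

primrec multiplier :: "nat \<Rightarrow> nat \<Rightarrow> nat" where
  "multiplier Q 0 = 1"
| "multiplier Q (Suc i) = Q * (multiplier Q i)\<^sup>2"

lemma multiplier_pos: "0 < Q \<Longrightarrow> 0 < multiplier Q i"
  by (induction i) auto

lemma odd_multiplier: "odd Q \<Longrightarrow> odd (multiplier Q i)"
  by (induction i) auto

lemma strict_mono_multiplier: assumes "1 < Q" shows "strict_mono (multiplier Q)"
  unfolding strict_mono_Suc_iff
proof
  fix i
  have p: "0 < multiplier Q i" using assms by (intro multiplier_pos) auto
  have "multiplier Q i \<le> multiplier Q i * multiplier Q i" using p by simp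
  moreover have "1 * (multiplier Q i * multiplier Q i) < Q * (multiplier Q i * multiplier Q i)"
    by (rule mult_strict_right_mono[OF assms]) (use p in simp)
  ultimately have "multiplier Q i < Q * (multiplier Q i * multiplier Q i)" by linarith
  then show "multiplier Q i < multiplier Q (Suc i)" by (simp add: power2_eq_square)
qed

lemma exists_admissible_phi:
  assumes n2: "2 \<le> n"
  shows "\<exists>f. admissible_phi n f"
proof -
  define \<eta> where "\<eta> = 1 / (real n * ln (real n)) - 2 / (real n)\<^sup>2"
  define s where "s = sin (\<eta> / 2)"
  define Q where "Q = 2 * nat \<lceil>4 * real n / s\<^sup>2\<rceil> + 3"
  define l where "l = (\<lambda>k. multiplier Q (k - 1))"
  define m where "m = (\<lambda>k. (l k * (2 * n + 1)) div 2)"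
  have Q: "odd Q" "1 < Q" by (simp_all add: Q_def)
  have odd_eq: "2 * m k + 1 = l k * (2 * n + 1)" for k
  proof -
    have "odd (l k * (2 * n + 1))" using odd_multiplier[OF Q(1)] by (simp add: l_def)
    then show ?thesis unfolding m_def by (metis odd_two_times_div_two_succ)
  qed
  interpret spike_geometry n l m
  proof
    show "strict_mono_on {1..n} l"
      using strict_monoD[OF strict_mono_multiplier[OF Q(2)]] by (auto simp: strict_mono_on_def l_def)
    show "odd (l k)" for k using odd_multiplier[OF Q(1)] by (simp add: l_def)
    show "m 1 = n" using odd_eq[of 1] by (simp add: l_def)
  qed (use n2 odd_eq in \<open>auto simp: l_def\<close>)
  have cl: "clearance = \<eta>" by (simp add: clearance_def margin_def \<eta>_def)
  have s: "0 < s"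
    unfolding s_def cl[symmetric] using clearance_pos clearance_le pi_gt_zero by (intro sin_gt_zero) auto
  have "admissible_spikes n l m step"
  proof (rule admissible_spikes_step)
    fix k assume k: "k \<in> {2..n}"
    have lk: "l k = Q * (l (k - 1))\<^sup>2"
    proof -
      have "k - 1 = Suc (k - 1 - 1)" using k by auto
      then show ?thesis unfolding l_def by (metis multiplier.simps(2))
    qed
    have l0: "0 < l (k - 1)" using Q unfolding l_def by (intro multiplier_pos) auto
    have "2 * m (k - 1) \<le> 4 * n * l (k - 1)"
    proof -
      have "2 * m (k - 1) \<le> l (k - 1) * (2 * n + 1)" using odd_eq[of "k - 1"] by linarith
      also have "\<dots> \<le> l (k - 1) * (4 * n)" using n2 by (intro mult_le_mono2) auto
      finally show ?thesis by (simp add: mult_ac)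
    qed
    then have "real (m (k - 1)) \<le> 2 * real n * real (l (k - 1))"
    proof -
      have "m (k - 1) \<le> 2 * n * l (k - 1)" using \<open>2 * m (k - 1) \<le> 4 * n * l (k - 1)\<close> by linarith
      then have "real (m (k - 1)) \<le> real (2 * n * l (k - 1))" by (rule of_nat_mono)
      then show ?thesis by simp
    qed
    then have a: "(real (m (k - 1)))\<^sup>2 \<le> 4 * (real n)\<^sup>2 * (real (l (k - 1)))\<^sup>2"
      using power_mono[of "real (m (k - 1))" "2 * real n * real (l (k - 1))" 2] by (simp add: power_mult_distrib)
    have "4 * real n / s\<^sup>2 \<le> of_int \<lceil>4 * real n / s\<^sup>2\<rceil>" by (rule le_of_int_ceiling)
    also have "\<dots> \<le> real (nat \<lceil>4 * real n / s\<^sup>2\<rceil>)" by simp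
    also have "\<dots> < real Q" unfolding Q_def of_nat_add of_nat_mult of_nat_numeral by linarith
    finally have "4 * real n < real Q * s\<^sup>2" using s by (simp add: pos_divide_less_eq)
    then have "4 * real n * (real n * (real (l (k - 1)))\<^sup>2) < real Q * s\<^sup>2 * (real n * (real (l (k - 1)))\<^sup>2)"
      using l0 n2 by (intro mult_strict_right_mono) auto
    then have b: "4 * (real n)\<^sup>2 * (real (l (k - 1)))\<^sup>2 < real (l k) * real n * s\<^sup>2"
      by (simp add: lk power2_eq_square mult_ac)
    have "real (l k) * real n \<le> real (m k)"
    proof -
      have "l k * (2 * n) + l k = 2 * m k + 1" using odd_eq[of k] by simp
      moreover have "0 < l k" using Q unfolding l_def by (intro multiplier_pos) auto
      ultimately have "l k * (2 * n) \<le> 2 * m k" by linarith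
      then have "l k * n \<le> m k" by simp
      then show ?thesis by (metis of_nat_le_iff of_nat_mult)
    qed
    then have "real (l k) * real n * s\<^sup>2 \<le> real (m k) * s\<^sup>2" by (intro mult_right_mono) auto
    with a b show "(real (m (k - 1)))\<^sup>2 < real (m k) * (sin (clearance / 2))\<^sup>2"
      unfolding cl s_def[symmetric] by linarith
  qed
  then interpret admissible_spikes n l m step .
  show ?thesis
    unfolding admissible_phi_def
    using l1 l_mono l_odd m1 m_eq periodic f_spike f_zero earlier_spikes by blast
qed

lemma admissible_phi_imp_spikes:
  assumes "2 \<le> n" "admissible_phi n f"
  obtains l m where "admissible_spikes n l m f"
proof -
  obtain l m where "l 1 = 1 \<and> strict_mono_on {1..n} l \<and> (\<forall>k\<in>{1..n}. odd (l k)) \<and>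
        m 1 = n \<and> (\<forall>k\<in>{2..n}. 2 * m k + 1 = l k * (2 * n + 1)) \<and>
        circle_periodic f \<and>
        (\<forall>k\<in>{1..n}. \<forall>x\<in>spike n m k. f x = (real (m k))\<^sup>2 / real n) \<and>
        (\<forall>x\<in>{0..2 * pi} - (\<Union>k\<in>{1..n}. spike n m k). f x = 0) \<and>
        (\<forall>k\<in>{2..n}. \<forall>x\<in>gap n (k - 1).
           \<bar>1 / pi * (LINT t:(\<Union>j\<in>{1..k - 1}. spike n m j)|lebesgue.
              f t * dirichlet_kernel (m k) (t - x))\<bar> < 1)"
    using assms(2) unfolding admissible_phi_def by blast
  then have "admissible_spikes n l m f"
    using assms(1)
    by (intro admissible_spikes.intro spike_function.intro spike_geometry.intro
        spike_function_axioms.intro admissible_spikes_axioms.intro) blast+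
  then show ?thesis by (rule that)
qed

lemma admissible_phi_periodic: "2 \<le> n \<Longrightarrow> admissible_phi n f \<Longrightarrow> f (x + 2 * pi) = f x"
  unfolding admissible_phi_def periodic_fun_simple_def by blast

lemma admissible_phi_basic:
  assumes "2 \<le> n" "admissible_phi n f"
  shows "integrable circle f" and "(\<integral>x. f x \<partial>circle) = 2" and "x \<in> {0..<2 * pi} \<Longrightarrow> 0 \<le> f x"
    and "AE x in circle. (\<lambda>r. partial_sum f r x) \<longlonglongrightarrow> complex_of_real (f x)"
proof -
  obtain l m where "admissible_spikes n l m f" using admissible_phi_imp_spikes[OF assms] .
  then interpret admissible_spikes n l m f .
  show "integrable circle f" "(\<integral>x. f x \<partial>circle) = 2"
    "AE x in circle. (\<lambda>r. partial_sum f r x) \<longlonglongrightarrow> complex_of_real (f x)"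
    by (rule integrable_f integral_f AE_fourier_sum_f_tendsto)+
  show "x \<in> {0..<2 * pi} \<Longrightarrow> 0 \<le> f x" by (rule f_nonneg)
qed

text \<open>
  The exceptional set contains the spikes themselves, so that the function vanishes off it.
\<close>

lemma admissible_phi_upper_bound:
  assumes "2 \<le> n" "admissible_phi n f"
  shows "\<exists>B\<in>sets circle. measure circle B \<le> 2 / ln (real n) + 2 / real n \<and>
    (\<forall>x\<in>{0..<2 * pi} - B. f x = 0 \<and> (\<forall>r. cmod (partial_sum f r x) \<le> 8 * ln (real n)))"
proof -
  obtain l m where "admissible_spikes n l m f" using admissible_phi_imp_spikes[OF assms] .
  then interpret admissible_spikes n l m f .
  let ?B = "{0..<2 * pi} \<inter> (\<Union>k\<in>{1..n}. {node n k - margin..node n k + 2 / (real (m k))\<^sup>2 + margin})"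
  show ?thesis
  proof (intro bexI conjI ballI allI)
    show "?B \<in> sets circle" by (rule UN_Icc_sets_circle) simp
    show "measure circle ?B \<le> 2 / ln (real n) + 2 / real n" by (rule measure_near_spikes)
    fix x assume x: "x \<in> {0..<2 * pi} - ?B"
    then show "cmod (partial_sum f r x) \<le> 8 * ln (real n)" for r
      by (intro fourier_sum_f_le) auto
    have "x \<notin> spike n m k" if "k \<in> {1..n}" for k
    proof
      assume "x \<in> spike n m k"
      then have "x \<in> {node n k - margin..node n k + 2 / (real (m k))\<^sup>2 + margin}"
        using margin_pos by (auto simp: spike_def)
      then show False using x that by blast
    qed
    then show "f x = 0" using x by (intro f_zero) auto
  qed
qed

text \<open>
  The hypotheses on \<open>\<delta>\<close> hold for all large \<open>n\<close>. They say that discarding a proportion \<open>\<delta>\<close> of the cells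
  leaves \<open>log (n - k + 1) \<ge> (log n)/2\<close>, that the logarithm absorbs the error \<open>1\<close> from the
  earlier spikes, that the phase changes by at most \<open>\<delta>/2\<close> on a spike, and that the remaining exceptional
  sets have measure at most \<open>\<delta>\<close>. The number \<open>T\<close>
  bounds the orders that are involved, independently of \<open>\<delta>\<close>.
\<close>

lemma admissible_phi_lower_bound:
  assumes "2 \<le> n" "admissible_phi n f"
  shows "\<exists>T. \<forall>\<delta>. 0 < \<delta> \<and> \<delta> < 1 \<and> 8 \<le> \<delta> * real n \<and> ln (real n) / 2 \<le> ln (\<delta> * real n) \<and>
      1 \<le> \<delta> / (40 * pi) * ln (real n) \<and> 12 / real n + 2 / ln (real n) \<le> \<delta> \<longrightarrow>
    measure circle {x \<in> space circle. \<forall>r\<in>{n..T}.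
      cmod (partial_sum f r x) < \<delta> / (40 * pi) * ln (real n)} \<le> 21 * \<delta>"
proof -
  obtain l m where "admissible_spikes n l m f" using admissible_phi_imp_spikes[OF assms] .
  then interpret admissible_spikes n l m f .
  show ?thesis
  proof (intro exI[of _ "m n"] allI impI; elim conjE)
    fix \<delta> :: real
    assume \<delta>: "0 < \<delta>" "\<delta> < 1" "8 \<le> \<delta> * real n" "ln (real n) / 2 \<le> ln (\<delta> * real n)"
      "1 \<le> \<delta> / (40 * pi) * ln (real n)" "12 / real n + 2 / ln (real n) \<le> \<delta>"
    define s where "s = nat \<lfloor>\<delta> * real n\<rfloor>"
    have s_le: "real s \<le> \<delta> * real n" using \<delta> by (simp add: s_def)
    have s_ge: "\<delta> * real n \<le> real s + 1" unfolding s_def using \<delta> by linarith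
    have "\<delta> * real n \<le> 1 * real n" using \<delta> by (intro mult_right_mono) auto
    then have sn: "s \<le> n" using s_le by linarith
    let ?B = "{x \<in> space circle. \<forall>r\<in>{n..m n}.
      cmod (partial_sum f r x) < \<delta> / (40 * pi) * ln (real n)}"
    have "measure circle ?B \<le> d + d * (real s + 1 / 2) + 2 / ln (real n) + 3 * pi * \<delta>"
    proof (rule measure_bad_points[OF sn \<delta>(1)])
      show "?B \<subseteq> {0..<2 * pi}" by auto
      fix x k assume x: "x \<in> ?B" and k: "k \<in> {2..n - s}" and g: "x \<in> gap n (k - 1)"
      have k2: "k \<in> {2..n}" using k by auto
      show "\<bar>sin ((real (m k) + 1 / 2) * x)\<bar> < \<delta>"
      proof (rule ccontr)
        assume "\<not> \<bar>sin ((real (m k) + 1 / 2) * x)\<bar> < \<delta>"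
        then have "\<delta> / (10 * pi) * ln (real (n - k + 1)) - 1 \<le>
            cmod (partial_sum f (m k) x)"
          using g k2 \<delta> by (intro fourier_sum_f_ge) auto
        moreover have "\<delta> / (10 * pi) * (ln (real n) / 2) \<le> \<delta> / (10 * pi) * ln (real (n - k + 1))"
        proof (intro mult_left_mono)
          have "\<delta> * real n \<le> real (n - k + 1)" using s_ge k by auto
          then have "ln (\<delta> * real n) \<le> ln (real (n - k + 1))" using \<delta> n2 by (subst ln_le_cancel_iff) auto
          then show "ln (real n) / 2 \<le> ln (real (n - k + 1))" using \<delta>(4) by linarith
        qed (use \<delta> in auto)
        moreover have "\<delta> / (10 * pi) * (ln (real n) / 2) = 2 * (\<delta> / (40 * pi) * ln (real n))" by simp
        moreover have "cmod (partial_sum f (m k) x) < \<delta> / (40 * pi) * ln (real n)"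
        proof -
          have "m k \<in> {n..m n}" using m_ge[of k] m_mono[of k n] k2 by auto
          then show ?thesis using x by blast
        qed
        ultimately show False using \<delta>(5) by argo
      qed
    qed
    also have "\<dots> \<le> 21 * \<delta>"
    proof -
      have d8: "d \<le> 8 / real n"
      proof -
        have "d \<le> 4 * pi / (2 * real n)" unfolding d_def using n2 by (intro divide_left_mono) auto
        also have "\<dots> \<le> 8 / real n" using pi_less_4 n2 by (simp add: field_simps)
        finally show ?thesis .
      qed
      have "d * (real s + 1 / 2) \<le> 8 / real n * (\<delta> * real n + 1 / 2)"
        using d8 d_pos s_le by (intro mult_mono) auto
      also have "\<dots> = 8 * \<delta> + 4 / real n" using n2 by (simp add: field_simps)
      finally have "d * (real s + 1 / 2) \<le> 8 * \<delta> + 4 / real n" .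
      moreover have "3 * pi * \<delta> \<le> 12 * \<delta>" using \<delta> pi_less_4 by (intro mult_right_mono) auto
      moreover have "12 / real n = 8 / real n + 4 / real n" by simp
      ultimately show ?thesis using d8 \<delta>(6) by linarith
    qed
    finally show "measure circle ?B \<le> 21 * \<delta>" .
  qed
qed

section \<open>Sums with one active level at a time\<close>

text \<open>
  The situation at a single point: \<open>s r k\<close> stands for the Fourier sum of order \<open>r\<close> of level \<open>k\<close>, \<open>v k\<close>
  for the value of level \<open>k\<close>, \<open>a\<close> for the weights, and \<open>\<sigma>\<close> for the Fourier sums of the weighted series.
  From the order \<open>R k\<close> on, the levels up to \<open>k\<close> have converged; \<open>small\<close> says that
  level \<open>k + 1\<close> is still invisible at order \<open>R k\<close>.
\<close>

locale lacunary_blocks =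
  fixes s :: "nat \<Rightarrow> nat \<Rightarrow> complex" and v a :: "nat \<Rightarrow> real" and R :: "nat \<Rightarrow> nat"
    and \<sigma> :: "nat \<Rightarrow> complex"
  assumes sums: "\<And>r. (\<lambda>k. complex_of_real (a k) * s r k) sums \<sigma> r"
    and a_nonneg: "\<And>k. 0 \<le> a k" and a_le: "\<And>k. a k \<le> 2"
    and R_mono: "strict_mono R"
    and v_zero: "\<forall>\<^sub>F k in sequentially. v k = 0"
    and finished: "\<forall>\<^sub>F k in sequentially. \<forall>r\<ge>R k. (\<Sum>j\<le>k. cmod (s r j - complex_of_real (v j))) \<le> (1 / 2) ^ k"
    and trivial_bound: "\<And>r k. cmod (s r k) \<le> 2 * real r + 1"
    and small: "\<And>k. a (Suc k) * (2 * real (R k) + 1) \<le> (1 / 2) ^ k"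
begin

text \<open>
  The value of the weighted series. By \<open>v_zero\<close> it is a finite sum.
\<close>

definition V :: complex where "V = (\<Sum>k. complex_of_real (a k * v k))"

lemma V_eq: "\<forall>\<^sub>F k in sequentially. (\<Sum>j\<le>k. complex_of_real (a j * v j)) = V"
proof -
  obtain K where K: "\<And>k. K \<le> k \<Longrightarrow> v k = 0" using v_zero by (auto simp: eventually_sequentially)
  have "(\<Sum>j\<le>k. complex_of_real (a j * v j)) = V" if "K \<le> k" for k
    unfolding V_def using K that by (intro suminf_finite[symmetric]) auto
  then show ?thesis by (auto simp: eventually_sequentially)
qed

text \<open>
  Between the orders \<open>R k\<close> and \<open>R (k + 1)\<close> the levels up to \<open>k\<close> contribute \<open>V\<close> up to an error
  \<open>2 \<cdot> 2\<^bsup>-k\<^esup>\<close>, and the levels from \<open>k + 2\<close> on contribute a geometric tail. Level \<open>k + 1\<close> is left over.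
\<close>

lemma block_estimate:
  "\<forall>\<^sub>F k in sequentially. \<forall>r. R k \<le> r \<and> r \<le> R (Suc k) \<longrightarrow>
     cmod (\<sigma> r - V - complex_of_real (a (Suc k)) * s r (Suc k)) \<le> 3 * (1 / 2) ^ k"
  using V_eq finished
proof eventually_elim
  case (elim k)
  show ?case
  proof (intro allI impI, elim conjE)
    fix r assume r: "R k \<le> r" "r \<le> R (Suc k)"
    let ?t = "\<lambda>j. complex_of_real (a j) * s r j"
    have tail_term: "cmod (?t (j + Suc (Suc k))) \<le> (1 / 2) ^ Suc k * (1 / 2) ^ j" for j
    proof -
      let ?i = "j + Suc k"
      have "R (Suc k) \<le> R ?i" using strict_mono_less_eq[OF R_mono] by simp
      then have "cmod (s r (Suc ?i)) \<le> 2 * real (R ?i) + 1"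
        using trivial_bound[of r "Suc ?i"] r by linarith
      then have "a (Suc ?i) * cmod (s r (Suc ?i)) \<le> a (Suc ?i) * (2 * real (R ?i) + 1)"
        by (rule mult_left_mono[OF _ a_nonneg])
      then have "a (Suc ?i) * cmod (s r (Suc ?i)) \<le> (1 / 2) ^ ?i"
        using small[of ?i] by (rule order_trans)
      moreover have "cmod (?t (Suc ?i)) = a (Suc ?i) * cmod (s r (Suc ?i))"
        using a_nonneg[of "Suc ?i"] by (simp only: norm_mult norm_of_real abs_of_nonneg)
      moreover have "(1 / 2 :: real) ^ ?i = (1 / 2) ^ Suc k * (1 / 2) ^ j"
        by (simp only: power_add mult.commute)
      ultimately show ?thesis by (simp only: add_Suc_right)
    qed
    have geo: "(\<lambda>j. (1 / 2) ^ Suc k * (1 / 2) ^ j) sums ((1 / 2 :: real) ^ k)"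
      using sums_mult[OF geometric_sums[of "1 / 2 :: real"], of "(1 / 2) ^ Suc k"] by simp
    have tail: "cmod (\<Sum>j. ?t (j + Suc (Suc k))) \<le> (1 / 2) ^ k"
    proof -
      have sm: "summable (\<lambda>j. cmod (?t (j + Suc (Suc k))))"
        by (rule summable_comparison_test[OF _ sums_summable[OF geo]]) (use tail_term in auto)
      have "cmod (\<Sum>j. ?t (j + Suc (Suc k))) \<le> (\<Sum>j. cmod (?t (j + Suc (Suc k))))"
        by (rule summable_norm[OF sm])
      also have "\<dots> \<le> (\<Sum>j. (1 / 2) ^ Suc k * (1 / 2) ^ j)"
        by (rule suminf_le[OF tail_term sm sums_summable[OF geo]])
      also have "\<dots> = (1 / 2) ^ k" using sums_unique[OF geo] by simp
      finally show ?thesis .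
    qed
    have split: "\<sigma> r = (\<Sum>j<Suc (Suc k). ?t j) + (\<Sum>j. ?t (j + Suc (Suc k)))"
      unfolding sums_unique[OF sums[of r]]
      by (subst suminf_split_initial_segment[OF sums_summable[OF sums[of r]], of "Suc (Suc k)"]) (rule add.commute)
    have e: "\<sigma> r - V - ?t (Suc k) = (\<Sum>j\<le>k. complex_of_real (a j) * (s r j - complex_of_real (v j))) + (\<Sum>j. ?t (j + Suc (Suc k)))"
    proof -
      have 1: "(\<Sum>j<Suc (Suc k). ?t j) = (\<Sum>j\<le>k. ?t j) + ?t (Suc k)"
        by (simp only: lessThan_Suc_atMost sum.atMost_Suc)
      have 2: "(\<Sum>j\<le>k. complex_of_real (a j) * (s r j - complex_of_real (v j))) = (\<Sum>j\<le>k. ?t j) - V"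
        unfolding elim(1)[symmetric] sum_subtractf[symmetric]
        by (intro sum.cong refl) (simp only: right_diff_distrib of_real_mult)
      show ?thesis unfolding split 1 2 by simp
    qed
    have "cmod (\<sigma> r - V - ?t (Suc k)) \<le> (\<Sum>j\<le>k. 2 * cmod (s r j - complex_of_real (v j))) + (1 / 2) ^ k"
      unfolding e using tail a_le a_nonneg
      by (intro norm_triangle_mono sum_norm_le) (auto simp: norm_mult intro!: mult_right_mono)
    also have "\<dots> \<le> 2 * (1 / 2) ^ k + (1 / 2) ^ k"
      using elim(2) r by (simp add: sum_distrib_left[symmetric])
    finally show "cmod (\<sigma> r - V - ?t (Suc k)) \<le> 3 * (1 / 2) ^ k" by simp
  qed
qed

text \<open>
  At the first order of a block not even the active level has become visible.
\<close>

lemma sigma_R_tendsto: "(\<lambda>k. \<sigma> (R k)) \<longlonglongrightarrow> V"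
proof -
  have "\<forall>\<^sub>F k in sequentially. norm (\<sigma> (R k) - V) \<le> 4 * (1 / 2) ^ k"
    using block_estimate
  proof eventually_elim
    case (elim k)
    have "R k \<le> R (Suc k)" using strict_monoD[OF R_mono, of k "Suc k"] by simp
    with elim have 1: "cmod (\<sigma> (R k) - V - complex_of_real (a (Suc k)) * s (R k) (Suc k)) \<le> 3 * (1 / 2) ^ k" by blast
    have "cmod (complex_of_real (a (Suc k)) * s (R k) (Suc k)) \<le> a (Suc k) * (2 * real (R k) + 1)"
      using mult_left_mono[OF trivial_bound a_nonneg] by (simp add: norm_mult a_nonneg)
    also have "\<dots> \<le> (1 / 2) ^ k" by (rule small)
    finally have 2: "cmod (complex_of_real (a (Suc k)) * s (R k) (Suc k)) \<le> (1 / 2) ^ k" .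
    have "cmod (\<sigma> (R k) - V) \<le> cmod (\<sigma> (R k) - V - complex_of_real (a (Suc k)) * s (R k) (Suc k))
       + cmod (complex_of_real (a (Suc k)) * s (R k) (Suc k))"
      using norm_triangle_ineq[of "\<sigma> (R k) - V - complex_of_real (a (Suc k)) * s (R k) (Suc k)"
          "complex_of_real (a (Suc k)) * s (R k) (Suc k)"] by simp
    with 1 2 show ?case by linarith
  qed
  moreover have "(\<lambda>k. 4 * (1 / 2 :: real) ^ k) \<longlonglongrightarrow> 0"
    using tendsto_mult_right_zero[OF LIMSEQ_power_zero[of "1 / 2 :: real"]] by simp
  ultimately have "(\<lambda>k. \<sigma> (R k) - V) \<longlonglongrightarrow> 0"
    by (rule Lim_null_comparison)
  then show ?thesis by (simp add: LIM_zero_cancel)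
qed

lemma sigma_bounded:
  assumes le: "\<forall>\<^sub>F k in sequentially. \<forall>r. a k * cmod (s r k) \<le> C"
  shows "\<forall>\<^sub>F r in sequentially. cmod (\<sigma> r) \<le> cmod V + C + 3"
proof -
  obtain K where K: "\<And>k r. K \<le> k \<Longrightarrow> R k \<le> r \<Longrightarrow> r \<le> R (Suc k) \<Longrightarrow>
     cmod (\<sigma> r - V - complex_of_real (a (Suc k)) * s r (Suc k)) \<le> 3 * (1 / 2) ^ k"
    "\<And>k r. K \<le> k \<Longrightarrow> a k * cmod (s r k) \<le> C"
    using eventually_conj[OF block_estimate le] unfolding eventually_sequentially by metis
  have "cmod (\<sigma> r) \<le> cmod V + C + 3" if r: "R K \<le> r" for r
  proof -
    have "\<exists>k\<ge>K. R k \<le> r \<and> r \<le> R (Suc k)"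
    proof -
      have "finite {k. R k \<le> r}"
        by (rule finite_subset[of _ "{..r}"]) (use order_trans[OF strict_mono_imp_increasing[OF R_mono]] in auto)
      moreover define k where "k = Max {k. R k \<le> r}"
      moreover have "K \<in> {k. R k \<le> r}" using r by simp
      ultimately have "k \<in> {k. R k \<le> r}" "K \<le> k" and max: "\<And>j. j \<in> {k. R k \<le> r} \<Longrightarrow> j \<le> k"
        using Max_in[of "{k. R k \<le> r}"] Max_ge[of "{k. R k \<le> r}"] by blast+
      moreover have "\<not> R (Suc k) \<le> r" using max[of "Suc k"] by auto
      ultimately show ?thesis by (intro exI[of _ k]) auto
    qed
    then obtain k where k: "K \<le> k" "R k \<le> r" "r \<le> R (Suc k)" by blast
    have "cmod (complex_of_real (a (Suc k)) * s r (Suc k)) \<le> C"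
      using K(2)[of "Suc k" r] k by (simp add: norm_mult a_nonneg)
    moreover have "3 * (1 / 2 :: real) ^ k \<le> 3" by (simp add: power_le_one)
    moreover have "cmod (\<sigma> r) \<le> cmod V + cmod (complex_of_real (a (Suc k)) * s r (Suc k))
        + cmod (\<sigma> r - V - complex_of_real (a (Suc k)) * s r (Suc k))"
      using norm_triangle_ineq[of "V + complex_of_real (a (Suc k)) * s r (Suc k)" "\<sigma> r - V - complex_of_real (a (Suc k)) * s r (Suc k)"]
        norm_triangle_ineq[of V "complex_of_real (a (Suc k)) * s r (Suc k)"] by simp
    ultimately show ?thesis using K(1)[OF k] by linarith
  qed
  then show ?thesis unfolding eventually_sequentially by blast
qed

lemma sigma_frequently_far:
  assumes ge: "\<exists>\<^sub>F k in sequentially. P k \<and> (\<exists>r. R k \<le> r \<and> r \<le> R (Suc k) \<and> B k \<le> a (Suc k) * cmod (s r (Suc k)))"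
  shows "\<exists>\<^sub>F k in sequentially. P k \<and> (\<exists>r\<ge>k. B k - 3 * (1 / 2) ^ k \<le> cmod (\<sigma> r - V))"
  using frequently_eventually_conj[OF ge block_estimate]
proof (rule frequently_elim1)
  fix k
  assume *: "(\<forall>r. R k \<le> r \<and> r \<le> R (Suc k) \<longrightarrow> cmod (\<sigma> r - V - complex_of_real (a (Suc k)) * s r (Suc k)) \<le> 3 * (1 / 2) ^ k)
    \<and> P k \<and> (\<exists>r. R k \<le> r \<and> r \<le> R (Suc k) \<and> B k \<le> a (Suc k) * cmod (s r (Suc k)))"
  then obtain r where r: "R k \<le> r" "r \<le> R (Suc k)" "B k \<le> a (Suc k) * cmod (s r (Suc k))" by blast
  have "k \<le> r" using strict_mono_imp_increasing[OF R_mono, of k] r by linarith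
  moreover have "a (Suc k) * cmod (s r (Suc k)) = cmod (complex_of_real (a (Suc k)) * s r (Suc k))"
    by (simp add: norm_mult a_nonneg)
  moreover have "cmod (complex_of_real (a (Suc k)) * s r (Suc k)) \<le> cmod (\<sigma> r - V) + cmod (\<sigma> r - V - complex_of_real (a (Suc k)) * s r (Suc k))"
    using norm_triangle_ineq4[of "\<sigma> r - V" "\<sigma> r - V - complex_of_real (a (Suc k)) * s r (Suc k)"] by simp
  ultimately show "P k \<and> (\<exists>r\<ge>k. B k - 3 * (1 / 2) ^ k \<le> cmod (\<sigma> r - V))"
    using * r by (smt (verit))
qed

text \<open>
  By \<open>sigma_R_tendsto\<close> the only possible limit is \<open>V\<close>.
\<close>

lemma sigma_not_convergent:
  assumes e: "0 < \<epsilon>"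
    and ge: "\<exists>\<^sub>F k in sequentially. \<exists>r. R k \<le> r \<and> r \<le> R (Suc k) \<and> \<epsilon> \<le> a (Suc k) * cmod (s r (Suc k))"
  shows "\<not> convergent \<sigma>"
proof
  assume "convergent \<sigma>"
  then obtain l where l: "\<sigma> \<longlonglongrightarrow> l" by (auto simp: convergent_def)
  have "(\<lambda>k. \<sigma> (R k)) \<longlonglongrightarrow> l" using LIMSEQ_subseq_LIMSEQ[OF l R_mono] by (simp add: o_def)
  then have "l = V" using sigma_R_tendsto LIMSEQ_unique by blast
  then have "\<forall>\<^sub>F r in sequentially. cmod (\<sigma> r - V) < \<epsilon> / 2"
    using tendstoD[OF l, of "\<epsilon> / 2"] e by (simp add: dist_norm)
  then obtain N where N: "\<And>r. N \<le> r \<Longrightarrow> cmod (\<sigma> r - V) < \<epsilon> / 2" by (auto simp: eventually_sequentially)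
  have "(\<lambda>k. 3 * (1 / 2 :: real) ^ k) \<longlonglongrightarrow> 0"
    using tendsto_mult_right_zero[OF LIMSEQ_power_zero[of "1 / 2 :: real"]] by simp
  then have "\<forall>\<^sub>F k in sequentially. 3 * (1 / 2 :: real) ^ k < \<epsilon> / 2"
    by (rule order_tendstoD(2)) (use e in simp)
  with eventually_ge_at_top[of N] have ev: "\<forall>\<^sub>F k in sequentially. N \<le> k \<and> 3 * (1 / 2 :: real) ^ k < \<epsilon> / 2"
    by eventually_elim auto
  have "\<exists>\<^sub>F k in sequentially. True \<and> (\<exists>r\<ge>k. \<epsilon> - 3 * (1 / 2) ^ k \<le> cmod (\<sigma> r - V))"
    by (rule sigma_frequently_far) (use ge in simp)
  from frequently_ex[OF frequently_eventually_conj[OF this ev]]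
  obtain k r where "N \<le> k" "3 * (1 / 2 :: real) ^ k < \<epsilon> / 2" "k \<le> r" "\<epsilon> - 3 * (1 / 2) ^ k \<le> cmod (\<sigma> r - V)" by blast
  then show False using N[of r] by auto
qed

lemma sigma_unbounded:
  assumes e: "0 < \<epsilon>" and L: "filterlim L at_top sequentially"
    and ge: "\<exists>\<^sub>F k in sequentially. \<exists>r. R k \<le> r \<and> r \<le> R (Suc k) \<and> \<epsilon> * L k \<le> a (Suc k) * cmod (s r (Suc k))"
  shows "limsup (\<lambda>r. ereal (cmod (\<sigma> r))) = \<infinity>"
proof -
  have "ereal B \<le> limsup (\<lambda>r. ereal (cmod (\<sigma> r)))" for B :: real
  proof -
    have fr: "\<exists>\<^sub>F r in sequentially. ereal B \<le> ereal (cmod (\<sigma> r))"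
      unfolding frequently_sequentially
    proof
      fix N :: nat
      have "\<forall>\<^sub>F k in sequentially. (B + cmod V + 3) / \<epsilon> \<le> L k" using L by (simp add: filterlim_at_top)
      with eventually_ge_at_top[of N] have ev: "\<forall>\<^sub>F k in sequentially. N \<le> k \<and> (B + cmod V + 3) / \<epsilon> \<le> L k"
        by eventually_elim auto
      have "\<exists>\<^sub>F k in sequentially. True \<and> (\<exists>r\<ge>k. \<epsilon> * L k - 3 * (1 / 2) ^ k \<le> cmod (\<sigma> r - V))"
        by (rule sigma_frequently_far) (use ge in simp)
      from frequently_ex[OF frequently_eventually_conj[OF this ev]]
      obtain k r where k: "N \<le> k" "(B + cmod V + 3) / \<epsilon> \<le> L k" "k \<le> r" "\<epsilon> * L k - 3 * (1 / 2) ^ k \<le> cmod (\<sigma> r - V)" by blast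
      have "B + cmod V + 3 \<le> \<epsilon> * L k" using k(2) e by (simp add: pos_divide_le_eq mult.commute)
      moreover have "3 * (1 / 2 :: real) ^ k \<le> 3" by (simp add: power_le_one)
      moreover have "cmod (\<sigma> r - V) \<le> cmod (\<sigma> r) + cmod V" by (rule norm_triangle_ineq4)
      ultimately have "B \<le> cmod (\<sigma> r)" using k(4) by linarith
      then show "\<exists>r\<ge>N. ereal B \<le> ereal (cmod (\<sigma> r))" using k by (intro exI[of _ r]) auto
    qed
    show ?thesis
    proof (rule ccontr)
      assume "\<not> ?thesis"
      then have "limsup (\<lambda>r. ereal (cmod (\<sigma> r))) < ereal B" by simp
      then have "\<forall>\<^sub>F r in sequentially. ereal (cmod (\<sigma> r)) < ereal B" by (rule Limsup_lessD)
      from frequently_ex[OF frequently_eventually_conj[OF fr this]] show False by auto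
    qed
  qed
  then show ?thesis by (intro ereal_top) auto
qed

end

section \<open>Choice of the levels\<close>

text \<open>
  Egorov's theorem in the form in which it is used: almost everywhere convergence is uniform off a set
  of small measure.
\<close>

lemma circle_uniform_tail:
  fixes g :: "nat \<Rightarrow> real \<Rightarrow> real"
  assumes [measurable]: "\<And>r. g r \<in> borel_measurable circle"
    and lim: "AE x in circle. (\<lambda>r. g r x) \<longlonglongrightarrow> 0" and \<epsilon>: "0 < \<epsilon>" "0 < e"
  shows "\<forall>\<^sub>F R in sequentially. measure circle {x \<in> space circle. \<exists>r\<ge>R. \<epsilon> < g r x} < e"
proof -
  define A where "A = (\<lambda>R. {x \<in> space circle. \<exists>r\<ge>R. \<epsilon> < g r x})"
  have A: "A R \<in> sets circle" for R unfolding A_def by measurable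
  have "decseq A" unfolding A_def decseq_def by (blast intro: order_trans)
  then have conv: "(\<lambda>R. measure circle (A R)) \<longlonglongrightarrow> measure circle (\<Inter>R. A R)"
    using A by (intro circle.finite_Lim_measure_decseq) auto
  have "AE x in circle. x \<notin> (\<Inter>R. A R)"
    using lim
  proof (rule AE_mp, intro AE_I2 impI notI)
    fix x assume l: "(\<lambda>r. g r x) \<longlonglongrightarrow> 0" and x: "x \<in> (\<Inter>R. A R)"
    obtain N where "\<And>r. N \<le> r \<Longrightarrow> g r x < \<epsilon>"
      using order_tendstoD(2)[OF l \<epsilon>(1)] by (auto simp: eventually_sequentially)
    moreover from x have "x \<in> A N" by blast
    ultimately show False unfolding A_def by force
  qed
  then have "measure circle (\<Inter>R. A R) = 0"
    using A by (subst (asm) AE_iff_null_sets[symmetric]) (auto intro: measure_eq_0_null_sets)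
  then have "(\<lambda>R. measure circle (A R)) \<longlonglongrightarrow> 0" using conv by simp
  then show ?thesis using order_tendstoD(2)[of _ 0 sequentially e] \<epsilon> unfolding A_def by blast
qed

text \<open>
  The points that lie in all but finitely many of the sets form an increasing union of intersections
  of measure at most \<open>c\<close>.
\<close>

lemma measure_circle_liminf_le:
  assumes A: "\<And>k. A k \<in> sets circle" and le: "\<forall>\<^sub>F k in sequentially. measure circle (A k) \<le> c"
  shows "measure circle {x \<in> space circle. \<forall>\<^sub>F k in sequentially. x \<in> A k} \<le> c"
proof -
  define C where "C = (\<lambda>K. \<Inter>k\<in>{K..}. A k)"
  have Cs: "C K \<in> sets circle" for K unfolding C_def using A by (intro sets.countable_INT) auto
  have "incseq C" unfolding C_def incseq_def by auto
  then have conv: "(\<lambda>K. measure circle (C K)) \<longlonglongrightarrow> measure circle (\<Union>K. C K)"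
    using Cs by (intro circle.finite_Lim_measure_incseq) auto
  obtain K0 where K0: "\<And>k. K0 \<le> k \<Longrightarrow> measure circle (A k) \<le> c" using le by (auto simp: eventually_sequentially)
  have "measure circle (C K) \<le> c" if "K0 \<le> K" for K
  proof -
    have "measure circle (C K) \<le> measure circle (A K)"
      using A by (intro circle.finite_measure_mono) (auto simp: C_def)
    then show ?thesis using K0[OF that] by simp
  qed
  then have "measure circle (\<Union>K. C K) \<le> c" using conv by (intro LIMSEQ_le_const2) auto
  moreover have "{x \<in> space circle. \<forall>\<^sub>F k in sequentially. x \<in> A k} = (\<Union>K. C K)"
  proof -
    have "x \<in> space circle" if "x \<in> A k" for x k using sets.sets_into_space[OF A[of k]] that by blast
    then show ?thesis unfolding C_def eventually_sequentially by blast
  qed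
  ultimately show ?thesis by simp
qed

lemma circle_borel_cantelli:
  assumes A: "\<And>k. A k \<in> sets circle" and le: "\<And>k. measure circle (A k) \<le> (1 / 2) ^ k"
  shows "AE x in circle. \<forall>\<^sub>F k in sequentially. x \<notin> A k"
proof -
  have "summable (\<lambda>k. measure circle (A k))"
    by (rule summable_comparison_test[of _ "\<lambda>k. (1 / 2) ^ k"]) (use le in auto)
  then have "AE x in circle. \<forall>\<^sub>F k in sequentially. x \<in> space circle - A k"
    using A by (intro borel_cantelli_AE1) (auto simp: circle.emeasure_finite less_top[symmetric])
  then show ?thesis by (rule AE_mp) (intro AE_I2 impI; auto elim: eventually_mono)
qed

text \<open>
  A sequence of levels that grows so fast that every level is settled before the next one matters.
  Here \<open>R k\<close> is an order from which the levels up to \<open>k\<close> have converged, and \<open>T k\<close> bounds the orders that make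
  level \<open>k\<close> large. The assumption \<open>fast\<close> makes the weight of the next level small compared with
  \<open>1 / R k\<close>, and \<open>small_support\<close> makes the exceptional sets summable.
\<close>

locale lacunary_sequence =
  fixes \<phi> :: "nat \<Rightarrow> real \<Rightarrow> real" and \<nu> R T :: "nat \<Rightarrow> nat"
  assumes adm: "\<And>k. admissible_phi (\<nu> k) (\<phi> (\<nu> k))"
    and nu_mono: "strict_mono \<nu>" and nu_ge: "\<And>k. 2 \<le> \<nu> k"
    and R_mono: "strict_mono R" and R_le: "\<And>k. R k \<le> \<nu> (Suc k)" and T_le: "\<And>k. T k \<le> R k"
    and finished_measure: "\<And>k. measure circle {x \<in> space circle. \<exists>r\<ge>R k. (1 / 2) ^ k <
        (\<Sum>j\<le>k. cmod (partial_sum (\<phi> (\<nu> j)) r x - complex_of_real (\<phi> (\<nu> j) x)))} \<le> (1 / 2) ^ k"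
    and fast: "\<And>k. 2 ^ k * (2 * real (R k) + 1) \<le> sqrt (ln (real (\<nu> (Suc k))))"
    and small_support: "\<And>k. 2 / ln (real (\<nu> (Suc k))) + 2 / real (\<nu> (Suc k)) \<le> (1 / 2) ^ k"
    and lower: "\<And>k \<delta>. 0 < \<delta> \<Longrightarrow> \<delta> < 1 \<Longrightarrow> 8 \<le> \<delta> * real (\<nu> k) \<Longrightarrow> ln (real (\<nu> k)) / 2 \<le> ln (\<delta> * real (\<nu> k)) \<Longrightarrow>
      1 \<le> \<delta> / (40 * pi) * ln (real (\<nu> k)) \<Longrightarrow> 12 / real (\<nu> k) + 2 / ln (real (\<nu> k)) \<le> \<delta> \<Longrightarrow>
      measure circle {x \<in> space circle. \<forall>r\<in>{\<nu> k..T k}.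
      cmod (partial_sum (\<phi> (\<nu> k)) r x) < \<delta> / (40 * pi) * ln (real (\<nu> k))} \<le> 21 * \<delta>"

lemma borel_measurable_fourier_errors:
  fixes \<phi> :: "nat \<Rightarrow> real \<Rightarrow> real"
  assumes "\<And>j. j \<in> J \<Longrightarrow> \<phi> j \<in> borel_measurable circle"
  shows "(\<lambda>x. \<Sum>j\<in>J. cmod (partial_sum (\<phi> j) r x - complex_of_real (\<phi> j x)))
    \<in> borel_measurable circle"
proof (rule borel_measurable_sum)
  fix j assume "j \<in> J"
  note [measurable] = assms[OF this]
  show "(\<lambda>x. cmod (partial_sum (\<phi> j) r x - complex_of_real (\<phi> j x))) \<in> borel_measurable circle"
    by measurable
qed

lemma exists_fourier_threshold:
  assumes adm: "\<And>n. 2 \<le> n \<Longrightarrow> admissible_phi n (\<phi> n)"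
  shows "\<exists>R\<ge>N. measure circle {x \<in> space circle. \<exists>r\<ge>R. (1 / 2) ^ n <
        (\<Sum>j\<in>{2..n}. cmod (partial_sum (\<phi> j) r x - complex_of_real (\<phi> j x)))} \<le> (1 / 2) ^ n"
proof -
  let ?g = "\<lambda>r x. \<Sum>j\<in>{2..n}. cmod (partial_sum (\<phi> j) r x - complex_of_real (\<phi> j x))"
  have "\<forall>\<^sub>F R in sequentially. measure circle {x \<in> space circle. \<exists>r\<ge>R. (1 / 2) ^ n < ?g r x} < (1 / 2) ^ n"
  proof (rule circle_uniform_tail)
    fix r
    show "?g r \<in> borel_measurable circle"
      using admissible_phi_basic(1) adm by (intro borel_measurable_fourier_errors borel_measurable_integrable) auto
  next
    have "AE x in circle. \<forall>j\<in>{2..n}. (\<lambda>r. partial_sum (\<phi> j) r x) \<longlonglongrightarrow> complex_of_real (\<phi> j x)"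
      using admissible_phi_basic(4) adm by (intro AE_finite_allI) auto
    then show "AE x in circle. (\<lambda>r. ?g r x) \<longlonglongrightarrow> 0"
    proof (rule AE_mp, intro AE_I2 impI)
      fix x assume *: "\<forall>j\<in>{2..n}. (\<lambda>r. partial_sum (\<phi> j) r x) \<longlonglongrightarrow> complex_of_real (\<phi> j x)"
      show "(\<lambda>r. ?g r x) \<longlonglongrightarrow> 0"
        by (rule tendsto_null_sum, rule tendsto_norm_zero, rule LIM_zero) (use * in blast)
    qed
  qed auto
  with eventually_ge_at_top[of N]
  have "\<forall>\<^sub>F R in sequentially. N \<le> R \<and> measure circle {x \<in> space circle. \<exists>r\<ge>R. (1 / 2) ^ n < ?g r x} < (1 / 2) ^ n"
    by (rule eventually_conj)
  then obtain R where "N \<le> R \<and> measure circle {x \<in> space circle. \<exists>r\<ge>R. (1 / 2) ^ n < ?g r x} < (1 / 2) ^ n"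
    unfolding eventually_sequentially by blast
  then show ?thesis by (intro exI[of _ R]) auto
qed

lemma exists_fast_index:
  fixes N :: nat and B e :: real
  assumes "0 < e"
  shows "\<exists>n>N. B \<le> sqrt (ln (real n)) \<and> 2 / ln (real n) + 2 / real n \<le> e"
proof -
  have "filterlim (\<lambda>n::nat. sqrt (ln (real n))) at_top sequentially" by real_asymp
  then have 1: "\<forall>\<^sub>F n in sequentially. B \<le> sqrt (ln (real n))" by (simp add: filterlim_at_top)
  have "(\<lambda>n::nat. 2 / ln (real n) + 2 / real n) \<longlonglongrightarrow> 0" by real_asymp
  then have 2: "\<forall>\<^sub>F n::nat in sequentially. 2 / ln (real n) + 2 / real n < e"
    by (rule order_tendstoD(2)) (rule assms)
  have "\<forall>\<^sub>F n in sequentially. N < n \<and> B \<le> sqrt (ln (real n)) \<and> 2 / ln (real n) + 2 / real n \<le> e"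
    using 1 2 eventually_gt_at_top[of N] by eventually_elim auto
  then show ?thesis using eventually_happens[of _ sequentially] by auto
qed

text \<open>
  The thresholds are taken for all functions \<open>\<phi>\<^sub>j\<close> with \<open>2 \<le> j \<le> n\<close> at once. They dominate
  those for the levels chosen so far, and the next level depends on the previous one alone, so the
  sequence is an iteration of one map \<open>G\<close>.
\<close>

lemma exists_lacunary_sequence:
  assumes adm: "\<And>n. 2 \<le> n \<Longrightarrow> admissible_phi n (\<phi> n)"
  shows "\<exists>\<nu> R T. lacunary_sequence \<phi> \<nu> R T"
proof -
  define good_T where "good_T = (\<lambda>n T. \<forall>\<delta>. 0 < \<delta> \<and> \<delta> < 1 \<and> 8 \<le> \<delta> * real n \<and> ln (real n) / 2 \<le> ln (\<delta> * real n) \<and>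
      1 \<le> \<delta> / (40 * pi) * ln (real n) \<and> 12 / real n + 2 / ln (real n) \<le> \<delta> \<longrightarrow>
    measure circle {x \<in> space circle. \<forall>r\<in>{n..T}.
      cmod (partial_sum (\<phi> n) r x) < \<delta> / (40 * pi) * ln (real n)} \<le> 21 * \<delta>)"
  have "\<exists>T. good_T n T" if n: "2 \<le> n" for n
    unfolding good_T_def by (rule admissible_phi_lower_bound[OF n adm[OF n]])
  then obtain T where T: "\<And>n. 2 \<le> n \<Longrightarrow> good_T n (T n)" by metis
  define good_R where "good_R = (\<lambda>n R. measure circle {x \<in> space circle. \<exists>r\<ge>R. (1 / 2) ^ n <
        (\<Sum>j\<in>{2..n}. cmod (partial_sum (\<phi> j) r x - complex_of_real (\<phi> j x)))} \<le> (1 / 2) ^ n)"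
  have "\<exists>R\<ge>max n (T n). good_R n R" for n
    unfolding good_R_def by (rule exists_fourier_threshold[OF adm])
  then obtain \<rho> where \<rho>: "\<And>n. max n (T n) \<le> \<rho> n" "\<And>n. good_R n (\<rho> n)" by metis
  have "\<exists>n'>\<rho> n. 2 ^ n * (2 * real (\<rho> n) + 1) \<le> sqrt (ln (real n')) \<and> 2 / ln (real n') + 2 / real n' \<le> (1 / 2) ^ n" for n
    by (rule exists_fast_index) simp
  then obtain G where G: "\<And>n. \<rho> n < G n" "\<And>n. 2 ^ n * (2 * real (\<rho> n) + 1) \<le> sqrt (ln (real (G n)))"
     "\<And>n. 2 / ln (real (G n)) + 2 / real (G n) \<le> (1 / 2) ^ n" by metis
  define \<nu> where "\<nu> = (\<lambda>k. (G ^^ k) 2)"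
  have \<nu>_Suc: "\<nu> (Suc k) = G (\<nu> k)" for k by (simp add: \<nu>_def)
  have \<nu>_less: "\<nu> k < \<nu> (Suc k)" "\<nu> k \<le> \<rho> (\<nu> k)" "\<rho> (\<nu> k) < \<nu> (Suc k)" for k
    using \<rho>(1)[of "\<nu> k"] G(1)[of "\<nu> k"] by (auto simp: \<nu>_Suc)
  have mono: "strict_mono \<nu>" using \<nu>_less by (simp add: strict_mono_Suc_iff)
  have ge: "2 \<le> \<nu> k" for k
    using monoD[OF strict_mono_mono[OF mono], of 0 k] by (simp add: \<nu>_def)
  have k_le: "k \<le> \<nu> k" for k by (rule strict_mono_imp_increasing[OF mono])
  have "lacunary_sequence \<phi> \<nu> (\<lambda>k. \<rho> (\<nu> k)) (\<lambda>k. T (\<nu> k))"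
  proof
    show "admissible_phi (\<nu> k) (\<phi> (\<nu> k))" for k using adm ge by simp
    show "strict_mono \<nu>" "2 \<le> \<nu> k" for k by (rule mono ge)+
    show "strict_mono (\<lambda>k. \<rho> (\<nu> k))"
      unfolding strict_mono_Suc_iff using less_le_trans[OF \<nu>_less(3) \<nu>_less(2)] by blast
    show "\<rho> (\<nu> k) \<le> \<nu> (Suc k)" for k using \<nu>_less(3)[of k] by simp
    show "T (\<nu> k) \<le> \<rho> (\<nu> k)" for k using \<rho>(1)[of "\<nu> k"] by simp
    show "2 ^ k * (2 * real (\<rho> (\<nu> k)) + 1) \<le> sqrt (ln (real (\<nu> (Suc k))))" for k
    proof -
      have "(2::real) ^ k * (2 * real (\<rho> (\<nu> k)) + 1) \<le> 2 ^ \<nu> k * (2 * real (\<rho> (\<nu> k)) + 1)"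
        using k_le by (intro mult_right_mono power_increasing) auto
      then show ?thesis using G(2)[of "\<nu> k"] by (simp only: \<nu>_Suc)
    qed
    have half: "(1 / 2 :: real) ^ \<nu> k \<le> (1 / 2) ^ k" for k by (intro power_decreasing k_le) auto
    show "2 / ln (real (\<nu> (Suc k))) + 2 / real (\<nu> (Suc k)) \<le> (1 / 2) ^ k" for k
      using G(3)[of "\<nu> k"] half[of k] by (simp only: \<nu>_Suc)
    show "measure circle {x \<in> space circle. \<exists>r\<ge>\<rho> (\<nu> k). (1 / 2) ^ k <
        (\<Sum>j\<le>k. cmod (partial_sum (\<phi> (\<nu> j)) r x - complex_of_real (\<phi> (\<nu> j) x)))} \<le> (1 / 2) ^ k" for k
    proof -
      let ?h = "\<lambda>r x n. cmod (partial_sum (\<phi> n) r x - complex_of_real (\<phi> n x))"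
      have "measure circle {x \<in> space circle. \<exists>r\<ge>\<rho> (\<nu> k). (1 / 2) ^ k < (\<Sum>j\<le>k. ?h r x (\<nu> j))} \<le>
        measure circle {x \<in> space circle. \<exists>r\<ge>\<rho> (\<nu> k). (1 / 2) ^ \<nu> k < (\<Sum>n\<in>{2..\<nu> k}. ?h r x n)}"
      proof (rule circle.finite_measure_mono)
        have "(1 / 2) ^ \<nu> k < (\<Sum>n\<in>{2..\<nu> k}. ?h r x n)" if "(1 / 2) ^ k < (\<Sum>j\<le>k. ?h r x (\<nu> j))" for r x
        proof -
          have "(\<Sum>j\<le>k. ?h r x (\<nu> j)) = (\<Sum>n\<in>\<nu> ` {..k}. ?h r x n)"
            using strict_mono_imp_inj_on[OF mono] by (subst sum.reindex) (auto intro: inj_on_subset)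
          also have "\<dots> \<le> (\<Sum>n\<in>{2..\<nu> k}. ?h r x n)"
            using ge monoD[OF strict_mono_mono[OF mono]] by (intro sum_mono2) auto
          finally show ?thesis using that half[of k] by linarith
        qed
        then show "{x \<in> space circle. \<exists>r\<ge>\<rho> (\<nu> k). (1 / 2) ^ k < (\<Sum>j\<le>k. ?h r x (\<nu> j))} \<subseteq>
          {x \<in> space circle. \<exists>r\<ge>\<rho> (\<nu> k). (1 / 2) ^ \<nu> k < (\<Sum>n\<in>{2..\<nu> k}. ?h r x n)}" by blast
        have [measurable]: "(\<lambda>x. \<Sum>n\<in>{2..\<nu> k}. ?h r x n) \<in> borel_measurable circle" for r
          using admissible_phi_basic(1) adm by (intro borel_measurable_fourier_errors borel_measurable_integrable) auto
        show "{x \<in> space circle. \<exists>r\<ge>\<rho> (\<nu> k). (1 / 2) ^ \<nu> k < (\<Sum>n\<in>{2..\<nu> k}. ?h r x n)} \<in> sets circle"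
          by measurable
      qed
      also have "\<dots> \<le> (1 / 2) ^ \<nu> k" using \<rho>(2)[of "\<nu> k"] unfolding good_R_def .
      also have "\<dots> \<le> (1 / 2) ^ k" by (rule half)
      finally show ?thesis .
    qed
  next
    fix k and \<delta> :: real
    assume "0 < \<delta>" "\<delta> < 1" "8 \<le> \<delta> * real (\<nu> k)" "ln (real (\<nu> k)) / 2 \<le> ln (\<delta> * real (\<nu> k))"
      "1 \<le> \<delta> / (40 * pi) * ln (real (\<nu> k))" "12 / real (\<nu> k) + 2 / ln (real (\<nu> k)) \<le> \<delta>"
    then show "measure circle {x \<in> space circle. \<forall>r\<in>{\<nu> k..T (\<nu> k)}.
      cmod (partial_sum (\<phi> (\<nu> k)) r x) < \<delta> / (40 * pi) * ln (real (\<nu> k))} \<le> 21 * \<delta>"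
      using T[OF ge[of k]] unfolding good_T_def by blast
  qed
  then show ?thesis by blast
qed

section \<open>Almost everywhere behaviour along a lacunary sequence\<close>

lemma eventually_lower_bound_conditions:
  fixes \<delta> :: real
  assumes "0 < \<delta>"
  shows "\<forall>\<^sub>F n::nat in sequentially. 8 \<le> \<delta> * real n \<and> ln (real n) / 2 \<le> ln (\<delta> * real n) \<and>
      1 \<le> \<delta> / (40 * pi) * ln (real n) \<and> 12 / real n + 2 / ln (real n) \<le> \<delta>"
proof -
  have "filterlim (\<lambda>n::nat. ln (real n)) at_top sequentially" by real_asymp
  then have ln: "\<forall>\<^sub>F n::nat in sequentially. B \<le> ln (real n)" for B by (simp add: filterlim_at_top)
  have "filterlim (\<lambda>n::nat. real n) at_top sequentially" by real_asymp
  then have n: "\<forall>\<^sub>F n::nat in sequentially. B \<le> real n" for B by (simp add: filterlim_at_top)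
  have "(\<lambda>n::nat. 12 / real n + 2 / ln (real n)) \<longlonglongrightarrow> 0" by real_asymp
  then have lim: "\<forall>\<^sub>F n::nat in sequentially. 12 / real n + 2 / ln (real n) < \<delta>"
    by (rule order_tendstoD(2)) (rule assms)
  show ?thesis
    using ln[of "- 2 * ln \<delta>"] ln[of "40 * pi / \<delta>"] n[of "8 / \<delta>"] eventually_gt_at_top[of "0::nat"] lim
  proof eventually_elim
    case (elim n)
    have "ln (\<delta> * real n) = ln \<delta> + ln (real n)" using elim assms by (simp add: ln_mult)
    moreover have "1 \<le> \<delta> / (40 * pi) * ln (real n)" using elim assms by (simp add: field_simps)
    moreover have "8 \<le> \<delta> * real n" using elim assms by (simp add: field_simps)
    ultimately show ?case using elim by (simp add: field_simps)
  qed
qed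

context lacunary_sequence
begin

abbreviation S :: "nat \<Rightarrow> nat \<Rightarrow> real \<Rightarrow> complex" where
  "S r k x \<equiv> partial_sum (\<phi> (\<nu> k)) r x"

lemma integrable_phi: "integrable circle (\<phi> (\<nu> k))"
  and integral_phi: "(\<integral>x. \<phi> (\<nu> k) x \<partial>circle) = 2"
  and phi_nonneg: "x \<in> {0..<2 * pi} \<Longrightarrow> 0 \<le> \<phi> (\<nu> k) x"
  using admissible_phi_basic[OF nu_ge adm] by blast+

lemma phi_measurable [measurable]: "\<phi> (\<nu> k) \<in> borel_measurable circle"
  using integrable_phi by (rule borel_measurable_integrable)

lemma integral_abs_phi: "(\<integral>x. \<bar>\<phi> (\<nu> k) x\<bar> \<partial>circle) = 2"
  unfolding integral_phi[of k, symmetric] by (rule Bochner_Integration.integral_cong) (auto simp: phi_nonneg)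

lemma nu_tendsto: "filterlim \<nu> at_top sequentially"
  by (rule filterlim_subseq[OF nu_mono])

lemma AE_finished:
  "AE x in circle. \<forall>\<^sub>F k in sequentially. \<forall>r\<ge>R k.
     (\<Sum>j\<le>k. cmod (S r j x - complex_of_real (\<phi> (\<nu> j) x))) \<le> (1 / 2) ^ k"
proof -
  have "AE x in circle. \<forall>\<^sub>F k in sequentially. x \<notin> {x \<in> space circle. \<exists>r\<ge>R k. (1 / 2) ^ k <
        (\<Sum>j\<le>k. cmod (S r j x - complex_of_real (\<phi> (\<nu> j) x)))}"
    by (rule circle_borel_cantelli[OF _ finished_measure]) measurable
  then show ?thesis
    by (rule AE_mp) (intro AE_I2 impI; auto elim: eventually_mono simp: not_less)
qed

lemma AE_upper:
  "AE x in circle. \<forall>\<^sub>F k in sequentially. \<phi> (\<nu> k) x = 0 \<and> (\<forall>r. cmod (S r k x) \<le> 8 * ln (real (\<nu> k)))"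
proof -
  have "\<forall>k. \<exists>B\<in>sets circle. measure circle B \<le> 2 / ln (real (\<nu> k)) + 2 / real (\<nu> k) \<and>
    (\<forall>x\<in>{0..<2 * pi} - B. \<phi> (\<nu> k) x = 0 \<and> (\<forall>r. cmod (S r k x) \<le> 8 * ln (real (\<nu> k))))"
    using admissible_phi_upper_bound[OF nu_ge adm] by blast
  then obtain B where B: "\<And>k. B k \<in> sets circle" "\<And>k. measure circle (B k) \<le> 2 / ln (real (\<nu> k)) + 2 / real (\<nu> k)"
    "\<And>k x. x \<in> {0..<2 * pi} - B k \<Longrightarrow> \<phi> (\<nu> k) x = 0 \<and> (\<forall>r. cmod (S r k x) \<le> 8 * ln (real (\<nu> k)))"
    by metis
  have "AE x in circle. \<forall>\<^sub>F k in sequentially. x \<notin> B (Suc k)"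
    using B(1) order_trans[OF B(2) small_support] by (rule circle_borel_cantelli)
  then show ?thesis
  proof (rule AE_mp, intro AE_I2 impI)
    fix x assume x: "x \<in> space circle" "\<forall>\<^sub>F k in sequentially. x \<notin> B (Suc k)"
    from x(2) have "\<forall>\<^sub>F k in sequentially. x \<notin> B k"
      by (rule eventually_sequentially_Suc[THEN iffD1])
    then show "\<forall>\<^sub>F k in sequentially. \<phi> (\<nu> k) x = 0 \<and> (\<forall>r. cmod (S r k x) \<le> 8 * ln (real (\<nu> k)))"
      by eventually_elim (use B(3) x(1) in auto)
  qed
qed

text \<open>
  For each fixed \<open>\<delta>\<close> the exceptional sets have measure at most \<open>21 \<delta>\<close>, but they need not shrink with \<open>k\<close>. So the
  points that lie in all but finitely many of them have measure at most \<open>21 \<delta>\<close>, and letting \<open>\<delta>\<close> tend to \<open>0\<close>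
  leaves a null set. The constant \<open>\<epsilon>\<close> depends on the point for this reason.
\<close>

lemma AE_lower:
  "AE x in circle. \<exists>\<epsilon>>0. \<exists>\<^sub>F k in sequentially. \<exists>r\<in>{\<nu> k..T k}. \<epsilon> * ln (real (\<nu> k)) \<le> cmod (S r k x)"
proof -
  define \<delta> where "\<delta> = (\<lambda>i::nat. 1 / (real i + 2))"
  define B where "B = (\<lambda>i k. {x \<in> space circle. \<forall>r\<in>{\<nu> k..T k}. cmod (S r k x) < \<delta> i / (40 * pi) * ln (real (\<nu> k))})"
  define E where "E = (\<lambda>i. {x \<in> space circle. \<forall>\<^sub>F k in sequentially. x \<in> B i k})"
  have \<delta>: "0 < \<delta> i" "\<delta> i < 1" for i by (simp_all add: \<delta>_def)
  have B_sets [measurable]: "B i k \<in> sets circle" for i k unfolding B_def by measurable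
  have E_sets: "E i \<in> sets circle" for i unfolding E_def eventually_sequentially by measurable
  have "measure circle (E i) \<le> 21 * \<delta> i" for i
    unfolding E_def
  proof (rule measure_circle_liminf_le[of "B i"])
    show "B i k \<in> sets circle" for k by (rule B_sets)
    have "\<forall>\<^sub>F k in sequentially. 8 \<le> \<delta> i * real (\<nu> k) \<and> ln (real (\<nu> k)) / 2 \<le> ln (\<delta> i * real (\<nu> k)) \<and>
      1 \<le> \<delta> i / (40 * pi) * ln (real (\<nu> k)) \<and> 12 / real (\<nu> k) + 2 / ln (real (\<nu> k)) \<le> \<delta> i"
      using eventually_lower_bound_conditions[OF \<delta>(1)] nu_tendsto by (rule eventually_compose_filterlim)
    then show "\<forall>\<^sub>F k in sequentially. measure circle (B i k) \<le> 21 * \<delta> i"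
      unfolding B_def by (rule eventually_mono) (intro lower \<delta>; simp)
  qed
  note E_le = this
  define D where "D = (\<Inter>i. E i)"
  have D_sets: "D \<in> sets circle" unfolding D_def by (rule sets.countable_INT) (use E_sets in auto)
  have D_le: "measure circle D \<le> 21 * \<delta> i" for i
  proof -
    have "measure circle D \<le> measure circle (E i)"
      by (rule circle.finite_measure_mono[OF _ E_sets]) (auto simp: D_def)
    then show ?thesis using E_le[of i] by (rule order_trans)
  qed
  have \<delta>_lim: "(\<lambda>i. 21 * \<delta> i) \<longlonglongrightarrow> 0" unfolding \<delta>_def by real_asymp
  have "measure circle D \<le> 0" by (rule LIMSEQ_le_const[OF \<delta>_lim]) (use D_le in blast)
  then have "emeasure circle D = 0"
    by (simp add: circle.emeasure_eq_measure measure_le_0_iff)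
  then have "D \<in> null_sets circle" using D_sets by (rule null_setsI)
  then have "AE x in circle. x \<notin> D" by (rule AE_not_in)
  then show ?thesis
  proof (rule AE_mp, intro AE_I2 impI)
    fix x assume x: "x \<in> space circle" "x \<notin> D"
    then obtain i where "\<exists>\<^sub>F k in sequentially. x \<notin> B i k" unfolding D_def E_def by (auto simp: not_eventually)
    then have "\<exists>\<^sub>F k in sequentially. \<exists>r\<in>{\<nu> k..T k}. \<delta> i / (40 * pi) * ln (real (\<nu> k)) \<le> cmod (S r k x)"
      by (rule frequently_elim1) (use x(1) in \<open>auto simp: B_def not_less\<close>)
    then show "\<exists>\<epsilon>>0. \<exists>\<^sub>F k in sequentially. \<exists>r\<in>{\<nu> k..T k}. \<epsilon> * ln (real (\<nu> k)) \<le> cmod (S r k x)"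
      using \<delta>(1)[of i] by (intro exI[of _ "\<delta> i / (40 * pi)"]) auto
  qed
qed

text \<open>
  Almost every point lies in the support of finitely many levels only, so the weights are arbitrary.
\<close>

lemma AE_summable: "AE x in circle. summable (\<lambda>k. \<bar>c k * \<phi> (\<nu> k) x\<bar>)"
  using AE_upper
proof (rule AE_mp, intro AE_I2 impI)
  fix x assume "\<forall>\<^sub>F k in sequentially. \<phi> (\<nu> k) x = 0 \<and> (\<forall>r. cmod (S r k x) \<le> 8 * ln (real (\<nu> k)))"
  then have "\<forall>\<^sub>F k in sequentially. \<phi> (\<nu> k) x = 0" by (rule eventually_mono) simp
  then obtain K where K: "\<And>k. K \<le> k \<Longrightarrow> \<phi> (\<nu> k) x = 0" by (auto simp: eventually_sequentially)
  show "summable (\<lambda>k. \<bar>c k * \<phi> (\<nu> k) x\<bar>)"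
    by (rule summable_finite[of "{..<K}"]) (use K in \<open>auto simp: not_less\<close>)
qed

lemma ln_nu_Suc_ge: "1 \<le> ln (real (\<nu> (Suc k)))"
proof -
  have "1 * 1 \<le> 2 ^ k * (2 * real (R k) + 1)" by (intro mult_mono) auto
  then have "1 \<le> sqrt (ln (real (\<nu> (Suc k))))" using fast[of k] by linarith
  then show ?thesis by simp
qed

lemma ln_nu_ge: "1 / 2 \<le> ln (real (\<nu> k))"
  using ln_2_ge_half nu_ge[of k] ln_le_cancel_iff[of 2 "real (\<nu> k)"] by linarith

lemma ln_nu_tendsto: "filterlim (\<lambda>k. ln (real (\<nu> k))) at_top sequentially"
proof -
  have "filterlim (\<lambda>n::nat. ln (real n)) at_top sequentially" by real_asymp
  then show ?thesis using nu_tendsto by (rule filterlim_compose)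
qed

end

text \<open>
  Both examples have this form, with \<open>a k = 1 / sqrt (ln (\<nu> k))\<close> and \<open>a k = 1 / ln (\<nu> k)\<close>.
\<close>

locale weighted_lacunary = lacunary_sequence +
  fixes a :: "nat \<Rightarrow> real"
  assumes a_nonneg: "\<And>k. 0 \<le> a k" and a_le: "\<And>k. a k \<le> 2"
    and a_small: "\<And>k. a (Suc k) \<le> 1 / sqrt (ln (real (\<nu> (Suc k))))"
begin

lemma small: "a (Suc k) * (2 * real (R k) + 1) \<le> (1 / 2) ^ k"
proof -
  let ?q = "sqrt (ln (real (\<nu> (Suc k))))"
  have q: "1 \<le> ?q" using ln_nu_Suc_ge[of k] by simp
  have "a (Suc k) * (2 * real (R k) + 1) \<le> 1 / ?q * (2 * real (R k) + 1)"
    using a_small[of k] by (intro mult_right_mono) auto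
  also have "\<dots> \<le> (1 / 2) ^ k"
    using fast[of k] q by (simp add: divide_simps power_divide mult.commute)
  finally show ?thesis .
qed

lemma summable_a: "summable a"
proof -
  have "summable (\<lambda>k. a (Suc k))"
  proof (rule summable_comparison_test[of _ "\<lambda>k. (1 / 2) ^ k"])
    have "a (Suc k) \<le> (1 / 2) ^ k" for k
    proof -
      have "a (Suc k) * 1 \<le> a (Suc k) * (2 * real (R k) + 1)" using a_nonneg by (intro mult_left_mono) auto
      then show ?thesis using small[of k] by simp
    qed
    then show "\<exists>N. \<forall>n\<ge>N. norm (a (Suc n)) \<le> (1 / 2) ^ n" using a_nonneg by auto
  qed simp
  then show ?thesis by (simp only: summable_Suc_iff)
qed

definition series :: "real \<Rightarrow> real" where "series x = (\<Sum>k. a k * \<phi> (\<nu> k) x)"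

lemma integral_term: "(\<integral>x. \<bar>a k * \<phi> (\<nu> k) x\<bar> \<partial>circle) = 2 * a k"
proof -
  have "(\<integral>x. \<bar>a k * \<phi> (\<nu> k) x\<bar> \<partial>circle) = (\<integral>x. a k * \<bar>\<phi> (\<nu> k) x\<bar> \<partial>circle)"
    using a_nonneg by (simp add: abs_mult)
  then show ?thesis by (simp add: integral_abs_phi)
qed

lemma summable_integrals: "summable (\<lambda>k. \<integral>x. \<bar>a k * \<phi> (\<nu> k) x\<bar> \<partial>circle)"
  unfolding integral_term using summable_a by (rule summable_mult)

lemma integrable_series: "integrable circle series"
  unfolding series_def using integrable_phi AE_summable[of a] summable_integrals
  by (intro integrable_suminf) auto

lemma fourier_sum_series: "(\<lambda>k. complex_of_real (a k) * S r k x) sums partial_sum series r x"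
proof -
  have "(\<lambda>k. fourier_sum r x (\<lambda>t. complex_of_real (a k * \<phi> (\<nu> k) t))) sums partial_sum series r x"
    unfolding series_def using integrable_phi AE_summable[of a] summable_integrals
    by (intro fourier_sum_suminf) auto
  moreover have "fourier_sum r x (\<lambda>t. complex_of_real (a k * \<phi> (\<nu> k) t)) = complex_of_real (a k) * S r k x" for k
    by (simp add: fourier_sum_def fourier_coeff_def sum_distrib_left mult.assoc mult.left_commute)
  ultimately show ?thesis by simp
qed

lemma norm_S_le: "cmod (S r k x) \<le> 2 * real r + 1"
proof -
  have "cmod (S r k x) \<le> (2 * real r + 1) * ((\<integral>x. cmod (complex_of_real (\<phi> (\<nu> k) x)) \<partial>circle) / (2 * pi))"
    using integrable_phi by (intro norm_fourier_sum_le) simp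
  also have "\<dots> = (2 * real r + 1) * (1 / pi)" by (simp add: integral_abs_phi)
  also have "\<dots> \<le> (2 * real r + 1) * 1" using pi_gt3 by (intro mult_left_mono) auto
  finally show ?thesis by simp
qed

lemma lacunary_blocks_at:
  assumes "\<forall>\<^sub>F k in sequentially. \<forall>r\<ge>R k. (\<Sum>j\<le>k. cmod (S r j x - complex_of_real (\<phi> (\<nu> j) x))) \<le> (1 / 2) ^ k"
    and "\<forall>\<^sub>F k in sequentially. \<phi> (\<nu> k) x = 0 \<and> (\<forall>r. cmod (S r k x) \<le> 8 * ln (real (\<nu> k)))"
  shows "lacunary_blocks (\<lambda>r k. S r k x) (\<lambda>k. \<phi> (\<nu> k) x) a R (\<lambda>r. partial_sum series r x)"
proof
  show "\<forall>\<^sub>F k in sequentially. \<phi> (\<nu> k) x = 0" using assms(2) by (rule eventually_mono) simp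
qed (use assms(1) fourier_sum_series a_nonneg a_le R_mono norm_S_le small in auto)

text \<open>
  The orders that make level \<open>k + 1\<close> large lie between \<open>\<nu>\<^sub>k\<^sub>+\<^sub>1 \<ge> R k\<close> and \<open>T (k + 1) \<le> R (k + 1)\<close>, hence
  in the block in which this level is active.
\<close>

lemma lower_in_block:
  assumes "\<exists>\<^sub>F k in sequentially. \<exists>r\<in>{\<nu> k..T k}. \<epsilon> * ln (real (\<nu> k)) \<le> cmod (S r k x)"
    and W: "\<And>k. W k \<le> a (Suc k) * ln (real (\<nu> (Suc k)))" and \<epsilon>: "0 < \<epsilon>"
  shows "\<exists>\<^sub>F k in sequentially. \<exists>r. R k \<le> r \<and> r \<le> R (Suc k) \<and> \<epsilon> * W k \<le> a (Suc k) * cmod (S r (Suc k) x)"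
proof -
  have "\<exists>\<^sub>F k in sequentially. \<exists>r\<in>{\<nu> (Suc k)..T (Suc k)}. \<epsilon> * ln (real (\<nu> (Suc k))) \<le> cmod (S r (Suc k) x)"
    using assms(1) unfolding frequently_def
    by (subst (asm) eventually_sequentially_Suc[symmetric]) simp
  then show ?thesis
  proof (rule frequently_elim1)
    fix k assume "\<exists>r\<in>{\<nu> (Suc k)..T (Suc k)}. \<epsilon> * ln (real (\<nu> (Suc k))) \<le> cmod (S r (Suc k) x)"
    then obtain r where r: "\<nu> (Suc k) \<le> r" "r \<le> T (Suc k)" "\<epsilon> * ln (real (\<nu> (Suc k))) \<le> cmod (S r (Suc k) x)" by auto
    have "\<epsilon> * W k \<le> \<epsilon> * (a (Suc k) * ln (real (\<nu> (Suc k))))" using W \<epsilon> by (intro mult_left_mono) auto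
    also have "\<dots> = a (Suc k) * (\<epsilon> * ln (real (\<nu> (Suc k))))" by simp
    also have "\<dots> \<le> a (Suc k) * cmod (S r (Suc k) x)" using r a_nonneg by (intro mult_left_mono) auto
    finally show "\<exists>r. R k \<le> r \<and> r \<le> R (Suc k) \<and> \<epsilon> * W k \<le> a (Suc k) * cmod (S r (Suc k) x)"
      using r R_le[of k] T_le[of "Suc k"] by (intro exI[of _ r]) auto
  qed
qed

lemma AE_limsup_infinite:
  assumes W: "\<And>k. W k \<le> a (Suc k) * ln (real (\<nu> (Suc k)))" "filterlim W at_top sequentially"
  shows "AE x in circle. limsup (\<lambda>r. ereal (cmod (partial_sum series r x))) = \<infinity>"
  using AE_finished AE_upper AE_lower
proof eventually_elim
  case (elim x)
  interpret lacunary_blocks "\<lambda>r k. S r k x" "\<lambda>k. \<phi> (\<nu> k) x" a R "\<lambda>r. partial_sum series r x"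
    using elim(1,2) by (rule lacunary_blocks_at)
  obtain \<epsilon> where \<epsilon>: "0 < \<epsilon>" "\<exists>\<^sub>F k in sequentially. \<exists>r\<in>{\<nu> k..T k}. \<epsilon> * ln (real (\<nu> k)) \<le> cmod (S r k x)"
    using elim(3) by blast
  show ?case by (rule sigma_unbounded[OF \<epsilon>(1) W(2)]) (rule lower_in_block[OF \<epsilon>(2) W(1) \<epsilon>(1)])
qed

lemma AE_bounded_divergent:
  assumes W: "\<And>k. a (Suc k) * ln (real (\<nu> (Suc k))) = 1"
  shows "AE x in circle. limsup (\<lambda>r. ereal (cmod (partial_sum series r x))) < \<infinity>"
    and "AE x in circle. \<not> convergent (\<lambda>r. partial_sum series r x)"
proof -
  have ev: "\<forall>\<^sub>F k in sequentially. a k * ln (real (\<nu> k)) = 1"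
    by (rule eventually_sequentially_Suc[THEN iffD1]) (simp add: W)
  show "AE x in circle. limsup (\<lambda>r. ereal (cmod (partial_sum series r x))) < \<infinity>"
    using AE_finished AE_upper
  proof eventually_elim
    case (elim x)
    interpret lacunary_blocks "\<lambda>r k. S r k x" "\<lambda>k. \<phi> (\<nu> k) x" a R "\<lambda>r. partial_sum series r x"
      using elim(1,2) by (rule lacunary_blocks_at)
    have "\<forall>\<^sub>F k in sequentially. \<forall>r. a k * cmod (S r k x) \<le> 8"
      using elim(2) ev
    proof eventually_elim
      case (elim k)
      show ?case
      proof
        fix r
        have "a k * cmod (S r k x) \<le> a k * (8 * ln (real (\<nu> k)))"
          using elim a_nonneg by (intro mult_left_mono) auto
        then show "a k * cmod (S r k x) \<le> 8" using elim by simp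
      qed
    qed
    from sigma_bounded[OF this]
    have "\<forall>\<^sub>F r in sequentially. ereal (cmod (partial_sum series r x)) \<le> ereal (cmod V + 8 + 3)"
      by (rule eventually_mono) simp
    then have "limsup (\<lambda>r. ereal (cmod (partial_sum series r x))) \<le> ereal (cmod V + 8 + 3)"
      by (rule Limsup_bounded)
    also have "\<dots> < \<infinity>" by simp
    finally show ?case .
  qed
  show "AE x in circle. \<not> convergent (\<lambda>r. partial_sum series r x)"
    using AE_finished AE_upper AE_lower
  proof eventually_elim
    case (elim x)
    interpret lacunary_blocks "\<lambda>r k. S r k x" "\<lambda>k. \<phi> (\<nu> k) x" a R "\<lambda>r. partial_sum series r x"
      using elim(1,2) by (rule lacunary_blocks_at)
    obtain \<epsilon> where \<epsilon>: "0 < \<epsilon>" "\<exists>\<^sub>F k in sequentially. \<exists>r\<in>{\<nu> k..T k}. \<epsilon> * ln (real (\<nu> k)) \<le> cmod (S r k x)"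
      using elim(3) by blast
    show ?case
      using lower_in_block[OF \<epsilon>(2) _ \<epsilon>(1), of "\<lambda>k. 1"] W
      by (intro sigma_not_convergent[OF \<epsilon>(1)]) simp
  qed
qed

end

section \<open>Closedness of the continuous functions\<close>

lemma modular_mono:
  assumes "0 < c" "c \<le> c'" "variable_exponent p"
  shows "modular p c' f \<le> modular p c f"
  unfolding modular_def
proof (intro nn_integral_mono ennreal_leI)
  fix x
  have "0 \<le> p x" using assms(3) by (auto simp: variable_exponent_def intro: order_trans[of _ 1])
  then show "(cmod (f x) / c') powr p x \<le> (cmod (f x) / c) powr p x"
    using assms by (intro powr_mono2 divide_left_mono) auto
qed

lemma modular_measurable [measurable]:
  assumes "variable_exponent p" "f \<in> borel_measurable circle"
  shows "(\<lambda>x. ennreal ((cmod (f x) / c) powr p x)) \<in> borel_measurable circle"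
proof -
  note [measurable] = assms(2)
  have [measurable]: "p \<in> borel_measurable circle" using assms(1) by (simp add: variable_exponent_def)
  show ?thesis by measurable
qed

text \<open>
  A substitute for the triangle inequality: \<open>|f - g| / 2\<close> is at most the larger of \<open>|f|\<close> and \<open>|g|\<close>.
\<close>

lemma modular_diff_le:
  assumes p: "variable_exponent p" and c: "0 < c"
    and f: "f \<in> borel_measurable circle" and g: "g \<in> borel_measurable circle"
  shows "modular p (2 * c) (\<lambda>x. f x - g x) \<le> modular p c f + modular p c g"
proof -
  have "modular p (2 * c) (\<lambda>x. f x - g x) \<le>
     (\<integral>\<^sup>+ x. ennreal ((cmod (f x) / c) powr p x) + ennreal ((cmod (g x) / c) powr p x) \<partial>circle)"
    unfolding modular_def
  proof (rule nn_integral_mono)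
    fix x
    have p0: "0 \<le> p x" using p by (auto simp: variable_exponent_def intro: order_trans[of _ 1])
    define z where "z = max (cmod (f x)) (cmod (g x))"
    have "cmod (f x - g x) \<le> 2 * z"
      using norm_triangle_ineq4[of "f x" "g x"] by (simp add: z_def)
    then have "(cmod (f x - g x) / (2 * c)) powr p x \<le> (z / c) powr p x"
      using c p0 by (intro powr_mono2) (auto simp: field_simps)
    also have "\<dots> \<le> (cmod (f x) / c) powr p x + (cmod (g x) / c) powr p x"
      by (cases "cmod (f x) \<le> cmod (g x)") (auto simp: z_def max_def)
    finally show "ennreal ((cmod (f x - g x) / (2 * c)) powr p x) \<le>
      ennreal ((cmod (f x) / c) powr p x) + ennreal ((cmod (g x) / c) powr p x)"
      by (simp add: ennreal_leI flip: ennreal_plus)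
  qed
  also have "\<dots> = modular p c f + modular p c g"
    unfolding modular_def by (rule nn_integral_add[OF modular_measurable[OF p f] modular_measurable[OF p g]])
  finally show ?thesis .
qed

text \<open>
  As \<open>p \<ge> 1\<close>, dividing the function by \<open>t \<ge> 1\<close> divides the modular by at least \<open>t\<close>. It follows that the
  infimum defining the norm is taken over a non-empty set, without which it would be unspecified.
\<close>

lemma exists_modular_le_one:
  assumes p: "variable_exponent p" and f: "f \<in> borel_measurable circle"
    and c: "0 < c" and fin: "modular p c f < \<infinity>"
  shows "\<exists>c'>0. modular p c' f \<le> 1"
proof -
  obtain B where B: "modular p c f = ennreal B" "0 \<le> B" using fin by (cases "modular p c f") auto
  define t where "t = B + 1"
  have t: "1 \<le> t" using B by (simp add: t_def)
  have "modular p (c * t) f \<le> (\<integral>\<^sup>+ x. ennreal (1 / t) * ennreal ((cmod (f x) / c) powr p x) \<partial>circle)"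
    unfolding modular_def
  proof (rule nn_integral_mono)
    fix x
    have p1: "1 \<le> p x" using p by (auto simp: variable_exponent_def)
    have "(cmod (f x) / (c * t)) powr p x = (cmod (f x) / c * (1 / t)) powr p x" by simp
    also have "\<dots> = (cmod (f x) / c) powr p x * (1 / t) powr p x"
      by (rule powr_mult)
    also have "\<dots> \<le> (cmod (f x) / c) powr p x * (1 / t) powr 1"
      using t p1 by (intro mult_left_mono powr_mono') auto
    also have "\<dots> = 1 / t * (cmod (f x) / c) powr p x" using t by simp
    finally show "ennreal ((cmod (f x) / (c * t)) powr p x) \<le> ennreal (1 / t) * ennreal ((cmod (f x) / c) powr p x)"
      using t by (simp add: ennreal_leI flip: ennreal_mult')
  qed
  also have "\<dots> = ennreal (1 / t) * modular p c f"
    unfolding modular_def by (rule nn_integral_cmult) (rule modular_measurable[OF p f])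
  also have "\<dots> = ennreal (1 / t * B)" using B t by (simp only: B ennreal_mult divide_nonneg_nonneg zero_le_one)
  also have "\<dots> \<le> 1" using t by (simp add: t_def field_simps)
  finally show ?thesis using c t by (intro exI[of _ "c * t"]) auto
qed

lemma circle_continuous_measurable: "f \<in> circle_continuous \<Longrightarrow> f \<in> borel_measurable circle"
  unfolding circle_continuous_def by (intro borel_measurable_circle borel_measurable_continuous_onI) auto

lemma circle_continuous_modular_finite:
  assumes p: "variable_exponent p" and f: "f \<in> circle_continuous"
  shows "\<exists>c>0. modular p c f < \<infinity>"
proof -
  have "continuous_on {0..2 * pi} f" using f continuous_on_subset by (auto simp: circle_continuous_def)
  then have "compact (f ` {0..2 * pi})" by (intro compact_continuous_image) auto
  then have "bounded (f ` {0..2 * pi})" by (rule compact_imp_bounded)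
  then obtain B where B: "0 < B" "\<And>x. x \<in> {0..2 * pi} \<Longrightarrow> cmod (f x) \<le> B"
    by (auto simp: bounded_pos)
  have "modular p B f \<le> (\<integral>\<^sup>+ x. 1 \<partial>circle)"
    unfolding modular_def
  proof (rule nn_integral_mono)
    fix x assume x: "x \<in> space circle"
    have "0 \<le> p x" using p by (auto simp: variable_exponent_def intro: order_trans[of _ 1])
    then have "(cmod (f x) / B) powr p x \<le> 1 powr p x"
      using B x by (intro powr_mono2) auto
    then show "ennreal ((cmod (f x) / B) powr p x) \<le> 1" by (simp add: ennreal_le_1)
  qed
  also have "\<dots> < \<infinity>" by (simp add: circle.emeasure_finite less_top[symmetric] del: space_circle)
  finally show ?thesis using B by blast
qed

lemma circle_continuous_diff:
  assumes "f \<in> circle_continuous" "g \<in> circle_continuous"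
  shows "(\<lambda>x. f x - g x) \<in> circle_continuous"
  using assms by (auto simp: circle_continuous_def periodic_fun_simple_def intro!: continuous_intros)

lemma circle_periodic_reduce:
  assumes "circle_periodic f"
  obtains y where "y \<in> {0..<2 * pi}" "f y = f x"
proof
  interpret periodic_fun_simple f "2 * pi" by (rule assms)
  let ?k = "\<lfloor>x / (2 * pi)\<rfloor>"
  have "of_int ?k \<le> x / (2 * pi)" "x / (2 * pi) < of_int ?k + 1" by linarith+
  then have "of_int ?k * (2 * pi) \<le> x" "x < (of_int ?k + 1) * (2 * pi)"
    by (simp_all only: pos_le_divide_eq pos_divide_less_eq pi_gt_zero zero_less_mult_iff zero_less_numeral simp_thms)
  then show "x - of_int ?k * (2 * pi) \<in> {0..<2 * pi}" by (simp add: distrib_right)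
  show "f (x - of_int ?k * (2 * pi)) = f x" by (rule minus_of_int)
qed

text \<open>
  If \<open>|h| > 2c\<close> at a point, then \<open>|h|/c \<ge> 2\<close> on an interval, where \<open>\<integral> 2\<^sup>p\<close> already exceeds the
  modular.
\<close>

lemma sup_le_of_modular:
  assumes p: "variable_exponent p"
    and big: "\<And>u w. 0 \<le> u \<Longrightarrow> u < w \<Longrightarrow> w \<le> 2 * pi \<Longrightarrow> 2 < (\<integral>\<^sup>+ x. indicator {u<..<w} x * ennreal (2 powr p x) \<partial>circle)"
    and h: "h \<in> circle_continuous" and c: "0 < c" and m: "modular p c h \<le> 2"
  shows "cmod (h x) \<le> 2 * c"
proof (rule ccontr)
  assume "\<not> cmod (h x) \<le> 2 * c"
  have per: "circle_periodic h" and cont: "continuous_on UNIV h" using h by (auto simp: circle_continuous_def)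
  obtain y where "y \<in> {0..<2 * pi}" "h y = h x" by (rule circle_periodic_reduce[OF per])
  then have y: "y \<in> {0..<2 * pi}" "2 * c < cmod (h y)" using \<open>\<not> cmod (h x) \<le> 2 * c\<close> by auto
  have op: "open {z. 2 * c < cmod (h z)}"
    by (rule open_Collect_less[OF continuous_on_const continuous_on_norm[OF cont]])
  obtain e where e: "0 < e" "ball y e \<subseteq> {z. 2 * c < cmod (h z)}"
    using openE[OF op, of y] y by blast
  define w where "w = min (y + e) (2 * pi)"
  have yw: "0 \<le> y" "y < w" "w \<le> 2 * pi" using y e by (auto simp: w_def)
  have "2 < (\<integral>\<^sup>+ x. indicator {y<..<w} x * ennreal (2 powr p x) \<partial>circle)" by (rule big[OF yw])
  also have "\<dots> \<le> modular p c h"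
    unfolding modular_def
  proof (rule nn_integral_mono)
    fix z
    show "indicator {y<..<w} z * ennreal (2 powr p z) \<le> ennreal ((cmod (h z) / c) powr p z)"
    proof (cases "z \<in> {y<..<w}")
      case True
      then have "z \<in> ball y e" by (auto simp: w_def dist_real_def)
      then have "2 \<le> cmod (h z) / c" using e c by (auto simp: field_simps)
      moreover have "0 \<le> p z" using p by (auto simp: variable_exponent_def intro: order_trans[of _ 1])
      ultimately have "2 powr p z \<le> (cmod (h z) / c) powr p z" by (intro powr_mono2) auto
      then show ?thesis using True by (simp add: ennreal_leI)
    qed simp
  qed
  finally show False using m by simp
qed

text \<open>
  From \<open>y \<le> 1 + y\<^sup>p\<close> for \<open>p \<ge> 1\<close>.
\<close>

lemma nn_integral_norm_le_of_modular:
  assumes p: "variable_exponent p" and c: "0 < c" and f: "f \<in> borel_measurable circle" and m: "modular p c f \<le> 1"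
  shows "(\<integral>\<^sup>+ x. ennreal (cmod (f x)) \<partial>circle) \<le> ennreal (c * (2 * pi + 1))"
proof -
  have "(\<integral>\<^sup>+ x. ennreal (cmod (f x)) \<partial>circle) \<le> (\<integral>\<^sup>+ x. ennreal c * (1 + ennreal ((cmod (f x) / c) powr p x)) \<partial>circle)"
  proof (rule nn_integral_mono)
    fix x
    define y where "y = cmod (f x) / c"
    have y0: "0 \<le> y" using c by (simp add: y_def)
    have "y \<le> 1 + y powr p x"
    proof (cases "y \<le> 1")
      case False
      have "1 \<le> p x" using p by (auto simp: variable_exponent_def)
      then have "y powr 1 \<le> y powr p x" using False by (intro powr_mono) auto
      then show ?thesis using False by simp
    qed (simp add: add_increasing2)
    then have "c * y \<le> c * (1 + y powr p x)" using c by simp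
    then have "cmod (f x) \<le> c * (1 + (cmod (f x) / c) powr p x)" using c by (simp add: y_def)
    then have "ennreal (cmod (f x)) \<le> ennreal (c * (1 + (cmod (f x) / c) powr p x))" by (rule ennreal_leI)
    also have "\<dots> = ennreal c * (1 + ennreal ((cmod (f x) / c) powr p x))"
      using c by (simp add: ennreal_mult' ennreal_plus)
    finally show "ennreal (cmod (f x)) \<le> ennreal c * (1 + ennreal ((cmod (f x) / c) powr p x))" .
  qed
  also have "\<dots> = ennreal c * (emeasure circle (space circle) + modular p c f)"
    unfolding modular_def using modular_measurable[OF p f]
    by (simp add: nn_integral_cmult nn_integral_add)
  also have "\<dots> \<le> ennreal c * (ennreal (2 * pi) + 1)"
    using m by (intro mult_left_mono add_mono) (auto simp: emeasure_circle)
  also have "\<dots> = ennreal (c * (2 * pi + 1))" using c by (simp add: ennreal_mult' ennreal_plus)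
  finally show ?thesis .
qed

text \<open>
  Continuous functions approximating \<open>f\<close> in \<open>L\<^sup>p\<close> are uniformly Cauchy by \<open>sup_le_of_modular\<close>. Their uniform
  limit is continuous, and it agrees with \<open>f\<close> almost everywhere because they converge to both in \<open>L\<^sup>1\<close>.
\<close>

lemma circle_continuous_closed_of_big_exponent:
  assumes p: "variable_exponent p"
    and big: "\<And>u w. 0 \<le> u \<Longrightarrow> u < w \<Longrightarrow> w \<le> 2 * pi \<Longrightarrow> 2 < (\<integral>\<^sup>+ x. indicator {u<..<w} x * ennreal (2 powr p x) \<partial>circle)"
  shows "closed_subspace_Lp p circle_continuous"
  unfolding closed_subspace_Lp_def
proof (intro conjI ballI allI impI)
  show "circle_continuous \<subseteq> variable_Lp p"
    using circle_continuous_measurable circle_continuous_modular_finite[OF p]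
    by (auto simp: variable_Lp_def circle_continuous_def)
  show "(\<lambda>x. 0) \<in> circle_continuous" by (simp add: circle_continuous_def periodic_fun_simple_def)
  show "(\<lambda>x. f x + g x) \<in> circle_continuous" if "f \<in> circle_continuous" "g \<in> circle_continuous" for f g
    using that by (auto simp: circle_continuous_def periodic_fun_simple_def intro!: continuous_intros)
  show "(\<lambda>x. a * f x) \<in> circle_continuous" if "f \<in> circle_continuous" for a f
    using that by (auto simp: circle_continuous_def periodic_fun_simple_def intro!: continuous_intros)
next
  fix f assume f: "f \<in> variable_Lp p" and approx: "\<forall>e>0. \<exists>g\<in>circle_continuous. variable_norm p (\<lambda>x. f x - g x) < e"
  have fm [measurable]: "f \<in> borel_measurable circle" using f by (simp add: variable_Lp_def)
  have "\<exists>g c. g \<in> circle_continuous \<and> 0 < c \<and> c \<le> (1 / 2) ^ n \<and> modular p c (\<lambda>x. f x - g x) \<le> 1" for n :: nat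
  proof -
    obtain g where g: "g \<in> circle_continuous" "variable_norm p (\<lambda>x. f x - g x) < (1 / 2) ^ n"
      using approx[rule_format, of "(1 / 2) ^ n"] by auto
    have gm [measurable]: "g \<in> borel_measurable circle" by (rule circle_continuous_measurable[OF g(1)])
    obtain c1 where c1: "0 < c1" "modular p c1 f < \<infinity>" using f by (auto simp: variable_Lp_def)
    obtain c2 where c2: "0 < c2" "modular p c2 g < \<infinity>" using circle_continuous_modular_finite[OF p g(1)] by blast
    define c0 where "c0 = max c1 c2"
    have "modular p (2 * c0) (\<lambda>x. f x - g x) \<le> modular p c0 f + modular p c0 g"
      using c1 by (intro modular_diff_le[OF p _ fm gm]) (auto simp: c0_def)
    also have "\<dots> \<le> modular p c1 f + modular p c2 g"
      using c1 c2 by (intro add_mono modular_mono[OF _ _ p]) (auto simp: c0_def)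
    also have "\<dots> < \<infinity>" using c1 c2 by (simp add: ennreal_add_less_top)
    finally have fin: "modular p (2 * c0) (\<lambda>x. f x - g x) < \<infinity>" .
    have dm: "(\<lambda>x. f x - g x) \<in> borel_measurable circle" by measurable
    have "\<exists>c'>0. modular p c' (\<lambda>x. f x - g x) \<le> 1"
      by (rule exists_modular_le_one[OF p dm _ fin]) (use c1 in \<open>auto simp: c0_def\<close>)
    then have ne: "{c. 0 < c \<and> modular p c (\<lambda>x. f x - g x) \<le> 1} \<noteq> {}" by blast
    obtain c where "c \<in> {c. 0 < c \<and> modular p c (\<lambda>x. f x - g x) \<le> 1}" "c < (1 / 2) ^ n"
      using cInf_lessD[OF ne] g(2) unfolding variable_norm_def by blast
    then show ?thesis using g(1) by (intro exI[of _ g] exI[of _ c]) auto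
  qed
  then obtain g c where g: "\<And>n. g n \<in> circle_continuous" and c: "\<And>n. 0 < c n" "\<And>n. c n \<le> (1 / 2) ^ n"
    and m: "\<And>n. modular p (c n) (\<lambda>x. f x - g n x) \<le> 1" by metis
  have gm [measurable]: "g n \<in> borel_measurable circle" for n by (rule circle_continuous_measurable[OF g])
  have close: "cmod (g n x - g k x) \<le> 4 * (1 / 2) ^ n" if "n \<le> k" for n k x
  proof -
    define b where "b = (1 / 2 :: real) ^ n"
    have b: "c n \<le> b" "c k \<le> b" "0 < b"
      using c(2)[of n] order_trans[OF c(2)[of k] power_decreasing[OF that, of "1 / 2 :: real"]] by (auto simp: b_def)
    have "modular p (2 * b) (\<lambda>x. (f x - g k x) - (f x - g n x)) \<le> modular p b (\<lambda>x. f x - g k x) + modular p b (\<lambda>x. f x - g n x)"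
      using b by (intro modular_diff_le[OF p]) measurable
    also have "\<dots> \<le> 1 + 1"
      using b c by (intro add_mono order_trans[OF modular_mono[OF _ _ p] m]) auto
    finally have "modular p (2 * b) (\<lambda>x. g n x - g k x) \<le> 2" by simp
    then have "cmod (g n x - g k x) \<le> 2 * (2 * b)"
      using b by (intro sup_le_of_modular[OF p big circle_continuous_diff[OF g g]]) auto
    then show ?thesis by (simp add: b_def)
  qed
  have half: "(\<lambda>n. 4 * (1 / 2 :: real) ^ n) \<longlonglongrightarrow> 0"
    using tendsto_mult_right_zero[OF LIMSEQ_power_zero[of "1 / 2 :: real"]] by simp
  have "Cauchy (\<lambda>n. g n x)" for x
  proof (rule CauchyI)
    fix e :: real assume "0 < e"
    then obtain N where N: "4 * (1 / 2 :: real) ^ N < e / 2"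
      using order_tendstoD(2)[OF half, of "e / 2"] by (auto simp: eventually_sequentially)
    have "cmod (g i x - g j x) < e" if "N \<le> i" "N \<le> j" for i j
    proof -
      have "cmod (g i x - g j x) \<le> cmod (g N x - g j x) + cmod (g N x - g i x)"
        using norm_triangle_ineq4[of "g N x - g j x" "g N x - g i x"] by simp
      then show ?thesis using close[OF that(1), of x] close[OF that(2), of x] N by linarith
    qed
    then show "\<exists>M. \<forall>m\<ge>M. \<forall>n\<ge>M. norm (g m x - g n x) < e" by blast
  qed
  then have "\<forall>x. \<exists>l. (\<lambda>n. g n x) \<longlonglongrightarrow> l" using Cauchy_convergent convergent_def by blast
  then obtain G where G: "\<And>x. (\<lambda>n. g n x) \<longlonglongrightarrow> G x" by metis
  have close_G: "cmod (g n x - G x) \<le> 4 * (1 / 2) ^ n" for n x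
  proof (rule LIMSEQ_le_const2)
    show "(\<lambda>k. cmod (g n x - g k x)) \<longlonglongrightarrow> cmod (g n x - G x)" by (intro tendsto_intros G)
    show "\<exists>N. \<forall>k\<ge>N. cmod (g n x - g k x) \<le> 4 * (1 / 2) ^ n" using close by blast
  qed
  have "uniform_limit UNIV g G sequentially"
  proof (rule uniform_limitI)
    fix e :: real assume "0 < e"
    from order_tendstoD(2)[OF half this]
    show "\<forall>\<^sub>F n in sequentially. \<forall>x\<in>UNIV. dist (g n x) (G x) < e"
      by eventually_elim (use close_G in \<open>auto simp: dist_norm intro: le_less_trans\<close>)
  qed
  then have "continuous_on UNIV G"
    using g by (intro uniform_limit_theorem[where F = sequentially and f = g])
      (auto simp: circle_continuous_def)
  moreover have "G (x + 2 * pi) = G x" for x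
  proof -
    have "g n (x + 2 * pi) = g n x" for n using g[of n] by (simp add: circle_continuous_def periodic_fun_simple_def)
    then show ?thesis using G[of "x + 2 * pi"] G[of x] LIMSEQ_unique by auto
  qed
  ultimately have GV: "G \<in> circle_continuous" by (simp add: circle_continuous_def periodic_fun_simple_def)
  have Gm [measurable]: "G \<in> borel_measurable circle" by (rule circle_continuous_measurable[OF GV])
  have "(\<integral>\<^sup>+ x. ennreal (cmod (f x - G x)) \<partial>circle) \<le> ennreal ((10 * pi + 1) * (1 / 2) ^ n)" for n
  proof -
    have "(\<integral>\<^sup>+ x. ennreal (cmod (f x - G x)) \<partial>circle) \<le> (\<integral>\<^sup>+ x. ennreal (cmod (f x - g n x)) + ennreal (4 * (1 / 2) ^ n) \<partial>circle)"
    proof (rule nn_integral_mono)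
      fix x
      have "cmod (f x - G x) \<le> cmod (f x - g n x) + 4 * (1 / 2) ^ n"
        using norm_triangle_ineq[of "f x - g n x" "g n x - G x"] close_G[of n x] by simp
      then show "ennreal (cmod (f x - G x)) \<le> ennreal (cmod (f x - g n x)) + ennreal (4 * (1 / 2) ^ n)"
        by (simp add: ennreal_leI flip: ennreal_plus)
    qed
    also have "\<dots> = (\<integral>\<^sup>+ x. ennreal (cmod (f x - g n x)) \<partial>circle) + ennreal (4 * (1 / 2) ^ n) * ennreal (2 * pi)"
      by (subst nn_integral_add) (auto simp: emeasure_circle)
    also have "\<dots> \<le> ennreal ((1 / 2) ^ n * (2 * pi + 1)) + ennreal (4 * (1 / 2) ^ n) * ennreal (2 * pi)"
    proof (intro add_mono order_refl)
      have "(\<integral>\<^sup>+ x. ennreal (cmod (f x - g n x)) \<partial>circle) \<le> ennreal (c n * (2 * pi + 1))"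
        by (rule nn_integral_norm_le_of_modular[OF p c(1) _ m]) measurable
      also have "\<dots> \<le> ennreal ((1 / 2) ^ n * (2 * pi + 1))"
        using c(2)[of n] by (intro ennreal_leI mult_right_mono) (auto simp: add_nonneg_nonneg)
      finally show "(\<integral>\<^sup>+ x. ennreal (cmod (f x - g n x)) \<partial>circle) \<le> ennreal ((1 / 2) ^ n * (2 * pi + 1))" .
    qed
    also have "\<dots> = ennreal ((1 / 2) ^ n * (2 * pi + 1) + 4 * (1 / 2) ^ n * (2 * pi))"
      by (simp only: ennreal_plus ennreal_mult zero_le_power mult_nonneg_nonneg add_nonneg_nonneg zero_le_numeral
          pi_ge_zero zero_le_one divide_nonneg_nonneg)
    also have "(1 / 2) ^ n * (2 * pi + 1) + 4 * (1 / 2) ^ n * (2 * pi) = (10 * pi + 1) * (1 / 2 :: real) ^ n"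
      by (simp add: algebra_simps)
    finally show ?thesis .
  qed
  note I_le = this
  have lim: "(\<lambda>n. ennreal ((10 * pi + 1) * (1 / 2) ^ n)) \<longlonglongrightarrow> ennreal 0"
    by (intro tendsto_ennrealI tendsto_mult_right_zero LIMSEQ_power_zero) auto
  have "(\<integral>\<^sup>+ x. ennreal (cmod (f x - G x)) \<partial>circle) \<le> ennreal 0"
    by (rule LIMSEQ_le_const[OF lim]) (use I_le in blast)
  then have "(\<integral>\<^sup>+ x. ennreal (cmod (f x - G x)) \<partial>circle) = 0" by simp
  then have "AE x in circle. ennreal (cmod (f x - G x)) = 0"
    by (subst (asm) nn_integral_0_iff_AE) measurable
  then have "AE x in circle. f x = G x" by (rule AE_mp) (intro AE_I2 impI; simp)
  with GV show "\<exists>g\<in>circle_continuous. AE x in circle. f x = g x" by blast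
qed

section \<open>The exponent and the two examples\<close>

lemma exists_spike_in_interval:
  assumes "2 \<le> n" "admissible_phi n f" and uw: "0 \<le> u" "w \<le> 2 * pi" "8 * pi / (2 * real n + 1) < w - u"
  shows "\<exists>A M. A \<in> sets circle \<and> A \<subseteq> {u<..<w} \<and> 0 < (M::nat) \<and> measure circle A = 2 / (real M)\<^sup>2 \<and>
     (\<forall>x\<in>A. real n * f x = (real M)\<^sup>2)"
proof -
  obtain l m where "admissible_spikes n l m f" using admissible_phi_imp_spikes[OF assms(1,2)] .
  then interpret admissible_spikes n l m f .
  have d2: "2 * d < w - u" using uw(3) by (simp add: d_def)
  then have "u \<in> {0..<2 * pi}" using uw d_pos by auto
  then obtain i where i: "i \<le> n" "d * real i \<le> u" "u < d * (real i + 1)" by (rule cell)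
  define k where "k = Suc i"
  have dk: "u < d * real k" "d * real k \<le> u + d" using i by (simp_all add: k_def algebra_simps)
  have "d * real k < d * (real n + 1 / 2)" using dk d2 d_pos uw d_mult(2) by linarith
  then have "real k < real n + 1 / 2" using d_pos by simp
  then have k: "k \<in> {1..n}" by (simp add: k_def)
  have "spike n m k \<subseteq> {u<..<w}"
  proof
    fix x assume "x \<in> spike n m k"
    then have "d * real k < x" "x < d * real k + d / 4" using spike_subset[OF k] by auto
    then have "u < x" "x < w" using dk d2 d_pos by linarith+
    then show "x \<in> {u<..<w}" by simp
  qed
  then show ?thesis
    using spike_circle[OF k] m_pos[OF k] measure_spike[OF k] f_spike[OF k] n2
    by (intro exI[of _ "spike n m k"] exI[of _ "m k"]) auto
qed

context lacunary_sequence
begin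

text \<open>
  On a spike of level \<open>k\<close> the term \<open>\<nu>\<^sub>k \<phi>\<^bsub>\<nu>\<^sub>k\<^esub>\<close> equals \<open>m\<^sub>j\<^sup>2\<close>, large enough for both purposes: it
  dominates the terms of the two examples, and \<open>2\<close> to this power outweighs the width of the spike.
\<close>

definition envelope :: "real \<Rightarrow> real" where "envelope x = (\<Sum>k. real (\<nu> k) * \<phi> (\<nu> k) x)"

text \<open>
  The absolute value matters only on the null set where the series may diverge and its sum is
  unspecified; it ensures \<open>p \<ge> 2\<close> everywhere.
\<close>

definition p :: "real \<Rightarrow> real" where "p x = 2 + \<bar>envelope x\<bar>"

definition q :: "real \<Rightarrow> real" where "q x = p x / (p x - 1)"

lemma phi_periodic: "\<phi> (\<nu> k) (x + 2 * pi) = \<phi> (\<nu> k) x"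
  by (rule admissible_phi_periodic[OF nu_ge adm])

lemma p_ge: "2 \<le> p x"
  by (simp add: p_def)

lemma p_measurable [measurable]: "p \<in> borel_measurable circle"
proof -
  have "(\<lambda>x. \<Sum>k. real (\<nu> k) * \<phi> (\<nu> k) x) \<in> borel_measurable circle"
    by (intro borel_measurable_suminf borel_measurable_times borel_measurable_const phi_measurable)
  then have [measurable]: "envelope \<in> borel_measurable circle" by (simp add: envelope_def[abs_def])
  show ?thesis unfolding p_def[abs_def] by measurable
qed

lemma variable_exponent_p: "variable_exponent p"
proof -
  have "p (x + 2 * pi) = p x" for x by (simp add: p_def envelope_def phi_periodic)
  moreover have "1 \<le> p x" for x using p_ge[of x] by simp
  ultimately show ?thesis by (simp add: variable_exponent_def periodic_fun_simple_def)
qed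

lemma variable_exponent_q: "variable_exponent q"
proof -
  have "q (x + 2 * pi) = q x" for x by (simp add: q_def p_def envelope_def phi_periodic)
  moreover have "1 \<le> q x" for x using p_ge[of x] by (simp add: q_def)
  moreover have "q \<in> borel_measurable circle" unfolding q_def[abs_def] by measurable
  ultimately show ?thesis by (simp add: variable_exponent_def periodic_fun_simple_def)
qed

lemma conjugate: "1 / p x + 1 / q x = 1"
  using p_ge[of x] by (simp add: q_def add_divide_distrib[symmetric])

lemma AE_envelope:
  "AE x in circle. summable (\<lambda>k. real (\<nu> k) * \<phi> (\<nu> k) x) \<and> (\<forall>k. real (\<nu> k) * \<phi> (\<nu> k) x \<le> p x - 2) \<and> envelope x = p x - 2"
  using AE_summable[of "\<lambda>k. real (\<nu> k)"]
proof (rule AE_mp, intro AE_I2 impI)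
  fix x assume x: "x \<in> space circle" and "summable (\<lambda>k. \<bar>real (\<nu> k) * \<phi> (\<nu> k) x\<bar>)"
  from this(2) have s: "summable (\<lambda>k. real (\<nu> k) * \<phi> (\<nu> k) x)" by (rule summable_rabs_cancel)
  have nn: "0 \<le> real (\<nu> k) * \<phi> (\<nu> k) x" for k using x phi_nonneg by simp
  have "0 \<le> envelope x" unfolding envelope_def by (rule suminf_nonneg[OF s nn])
  then have env: "envelope x = p x - 2" by (simp add: p_def)
  have "real (\<nu> k) * \<phi> (\<nu> k) x \<le> envelope x" for k
    unfolding envelope_def using sum_le_suminf[OF s, of "{k}"] nn by simp
  then show "summable (\<lambda>k. real (\<nu> k) * \<phi> (\<nu> k) x) \<and> (\<forall>k. real (\<nu> k) * \<phi> (\<nu> k) x \<le> p x - 2) \<and> envelope x = p x - 2"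
    using s env by simp
qed

text \<open>
  A fine enough level has a spike in the given interval. Almost everywhere on it \<open>2\<^sup>p \<ge> 4 \<cdot> 2\<^bsup>M\<^sup>2\<^esup> \<ge> 4 M\<^sup>2\<close>, and its width is
  \<open>2/M\<^sup>2\<close>.
\<close>

lemma exponent_big:
  assumes uw: "0 \<le> u" "u < w" "w \<le> 2 * pi"
  shows "2 < (\<integral>\<^sup>+ x. indicator {u<..<w} x * ennreal (2 powr p x) \<partial>circle)"
proof -
  have "(\<lambda>n::nat. 8 * pi / (2 * real n + 1)) \<longlonglongrightarrow> 0" by real_asymp
  then have "\<forall>\<^sub>F n::nat in sequentially. 8 * pi / (2 * real n + 1) < w - u"
    by (rule order_tendstoD(2)) (use uw in simp)
  then have "\<forall>\<^sub>F k in sequentially. 8 * pi / (2 * real (\<nu> k) + 1) < w - u"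
    using nu_tendsto by (rule eventually_compose_filterlim)
  then obtain k where k: "8 * pi / (2 * real (\<nu> k) + 1) < w - u"
    by (auto simp: eventually_sequentially)
  obtain A M where A: "A \<in> sets circle" "A \<subseteq> {u<..<w}" "0 < (M::nat)" "measure circle A = 2 / (real M)\<^sup>2"
     "\<And>x. x \<in> A \<Longrightarrow> real (\<nu> k) * \<phi> (\<nu> k) x = (real M)\<^sup>2"
    using exists_spike_in_interval[OF nu_ge adm uw(1,3) k] by blast
  have "ennreal 2 < ennreal (4 * (real M)\<^sup>2 * measure circle A)"
    using A(3) by (subst ennreal_less_iff) (auto simp: A(4))
  also have "\<dots> = (\<integral>\<^sup>+ x. ennreal (4 * (real M)\<^sup>2) * indicator A x \<partial>circle)"
    using A(1) by (simp add: nn_integral_cmult circle.emeasure_eq_measure ennreal_mult')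
  also have "\<dots> \<le> (\<integral>\<^sup>+ x. indicator {u<..<w} x * ennreal (2 powr p x) \<partial>circle)"
  proof (rule nn_integral_mono_AE)
    show "AE x in circle. ennreal (4 * (real M)\<^sup>2) * indicator A x \<le> indicator {u<..<w} x * ennreal (2 powr p x)"
      using AE_envelope
    proof (rule AE_mp, intro AE_I2 impI)
      fix x assume x: "summable (\<lambda>k. real (\<nu> k) * \<phi> (\<nu> k) x) \<and> (\<forall>k. real (\<nu> k) * \<phi> (\<nu> k) x \<le> p x - 2) \<and> envelope x = p x - 2"
      show "ennreal (4 * (real M)\<^sup>2) * indicator A x \<le> indicator {u<..<w} x * ennreal (2 powr p x)"
      proof (cases "x \<in> A")
        case True
        have "real (M\<^sup>2) \<le> real (2 ^ M\<^sup>2)" by (intro of_nat_mono less_imp_le less_exp)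
        also have "real (2 ^ M\<^sup>2) = 2 powr real (M\<^sup>2)" by (subst powr_realpow) simp_all
        finally have "4 * (real M)\<^sup>2 \<le> 4 * 2 powr real (M\<^sup>2)" by simp
        also have "\<dots> = 2 powr (2 + real (M\<^sup>2))" by (simp add: powr_add)
        also have "\<dots> \<le> 2 powr p x"
        proof (rule powr_mono)
          have "real (\<nu> k) * \<phi> (\<nu> k) x \<le> p x - 2" using x by blast
          then show "2 + real (M\<^sup>2) \<le> p x" using A(5)[OF True] by simp
        qed simp
        finally have "ennreal (4 * (real M)\<^sup>2) \<le> ennreal (2 powr p x)" by (rule ennreal_leI)
        then show ?thesis using True A(2) by (auto simp: indicator_def)
      qed simp
    qed
  qed
  finally show ?thesis by simp
qed

lemma circle_continuous_closed: "closed_subspace_Lp p circle_continuous"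
  using variable_exponent_p exponent_big by (rule circle_continuous_closed_of_big_exponent)

end

text \<open>
  With \<open>s = p - 1\<close> the exponent is the conjugate of \<open>p\<close>. The excess \<open>y\<^bsup>1/s\<^esup> \<le> s\<^bsup>1/s\<^esup>\<close> stays bounded as long as \<open>y\<close> is at
  most \<open>s\<close>.
\<close>

lemma powr_conjugate_le:
  fixes y s :: real
  assumes "0 \<le> y" "y \<le> s" "0 < s"
  shows "y powr ((s + 1) / s) \<le> exp 1 * y"
proof (cases "y = 0")
  case False
  then have y: "0 < y" using assms by simp
  have "y powr ((s + 1) / s) = y powr 1 * y powr (1 / s)"
    using assms by (simp add: add_divide_distrib powr_add)
  also have "\<dots> \<le> y powr 1 * exp 1"
  proof (rule mult_left_mono)
    have "ln s \<le> s" using ln_le_minus_one[of s] assms by linarith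
    then have "s powr (1 / s) \<le> exp 1" using assms by (simp add: powr_def)
    moreover have "y powr (1 / s) \<le> s powr (1 / s)" using assms by (intro powr_mono2) auto
    ultimately show "y powr (1 / s) \<le> exp 1" by linarith
  qed simp
  finally show ?thesis using y by (simp add: mult.commute)
qed simp

context weighted_lacunary
begin

lemma AE_series_bounds: "AE x in circle. 0 \<le> series x \<and> series x \<le> p x - 1"
  using AE_envelope AE_summable[of a]
proof (rule AE_mp[OF AE_conjI], intro AE_I2 impI, elim conjE)
  fix x
  assume x: "x \<in> space circle" and s: "summable (\<lambda>k. \<bar>a k * \<phi> (\<nu> k) x\<bar>)"
    and s_env: "summable (\<lambda>k. real (\<nu> k) * \<phi> (\<nu> k) x)" and env: "envelope x = p x - 2"
  have nn: "0 \<le> \<phi> (\<nu> k) x" for k using x phi_nonneg by simp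
  have sF: "summable (\<lambda>k. a k * \<phi> (\<nu> k) x)" using s by (rule summable_rabs_cancel)
  have "0 \<le> series x" unfolding series_def by (rule suminf_nonneg[OF sF]) (simp add: nn a_nonneg)
  moreover have "series x \<le> envelope x"
    unfolding series_def envelope_def
  proof (rule suminf_le[OF _ sF s_env])
    fix k
    have "a k \<le> real (\<nu> k)" using a_le[of k] nu_ge[of k] by linarith
    then show "a k * \<phi> (\<nu> k) x \<le> real (\<nu> k) * \<phi> (\<nu> k) x" by (rule mult_right_mono[OF _ nn])
  qed
  ultimately show "0 \<le> series x \<and> series x \<le> p x - 1" using env by simp
qed

lemma series_in_variable_Lp: "(\<lambda>x. complex_of_real (series x)) \<in> variable_Lp q"
proof -
  have "series (x + 2 * pi) = series x" for x by (simp add: series_def phi_periodic)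
  then have per: "circle_periodic (\<lambda>x. complex_of_real (series x))" by (simp add: periodic_fun_simple_def)
  have [measurable]: "series \<in> borel_measurable circle" using integrable_series by (rule borel_measurable_integrable)
  have "modular q 1 (\<lambda>x. complex_of_real (series x)) \<le> (\<integral>\<^sup>+ x. ennreal (exp 1 * \<bar>series x\<bar>) \<partial>circle)"
    unfolding modular_def
  proof (rule nn_integral_mono_AE)
    show "AE x in circle. ennreal ((cmod (complex_of_real (series x)) / 1) powr q x) \<le> ennreal (exp 1 * \<bar>series x\<bar>)"
      using AE_series_bounds
    proof (rule AE_mp, intro AE_I2 impI)
      fix x assume F: "0 \<le> series x \<and> series x \<le> p x - 1"
      have "series x powr ((p x - 1 + 1) / (p x - 1)) \<le> exp 1 * series x"
        using F p_ge[of x] by (intro powr_conjugate_le) auto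
      then show "ennreal ((cmod (complex_of_real (series x)) / 1) powr q x) \<le> ennreal (exp 1 * \<bar>series x\<bar>)"
        using F by (intro ennreal_leI) (simp add: q_def)
    qed
  qed
  also have "\<dots> < \<infinity>"
  proof -
    have "integrable circle (\<lambda>x. exp 1 * \<bar>series x\<bar>)" using integrable_series by simp
    then have "(\<integral>\<^sup>+ x. ennreal (norm (exp 1 * \<bar>series x\<bar>)) \<partial>circle) < \<infinity>"
      by (simp only: integrable_iff_bounded)
    then show ?thesis by (simp add: abs_mult)
  qed
  finally have "modular q 1 (\<lambda>x. complex_of_real (series x)) < \<infinity>" .
  moreover have "(\<lambda>x. complex_of_real (series x)) \<in> borel_measurable circle" by measurable
  ultimately show ?thesis using per unfolding variable_Lp_def by (auto intro!: exI[of _ 1])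
qed

end

lemma (in lacunary_sequence) weighted_kolmogorov:
  "weighted_lacunary \<phi> \<nu> R T (\<lambda>k. 1 / sqrt (ln (real (\<nu> k))))"
proof
  fix k
  show "0 \<le> 1 / sqrt (ln (real (\<nu> k)))" using ln_nu_ge[of k] by simp
  have "1 / 2 \<le> sqrt (ln (real (\<nu> k)))"
    using ln_nu_ge[of k] by (intro real_le_rsqrt) (simp add: power2_eq_square)
  then have "1 / sqrt (ln (real (\<nu> k))) \<le> 1 / (1 / 2)" by (intro frac_le) auto
  then show "1 / sqrt (ln (real (\<nu> k))) \<le> 2" by simp
qed simp

lemma (in lacunary_sequence) weighted_marcinkiewicz:
  "weighted_lacunary \<phi> \<nu> R T (\<lambda>k. 1 / ln (real (\<nu> k)))"
proof
  fix k
  show "0 \<le> 1 / ln (real (\<nu> k))" using ln_nu_ge[of k] by simp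
  have "1 / ln (real (\<nu> k)) \<le> 1 / (1 / 2)" using ln_nu_ge[of k] by (intro frac_le) auto
  then show "1 / ln (real (\<nu> k)) \<le> 2" by simp
  have "sqrt (ln (real (\<nu> (Suc k)))) \<le> ln (real (\<nu> (Suc k)))"
    using ln_nu_Suc_ge[of k] by (intro real_le_lsqrt) (auto simp: power2_eq_square)
  then show "1 / ln (real (\<nu> (Suc k))) \<le> 1 / sqrt (ln (real (\<nu> (Suc k))))"
    using ln_nu_Suc_ge[of k] by (intro frac_le) auto
qed

theorem theorem5p2:
  shows "\<exists>p q :: real \<Rightarrow> real.
    variable_exponent p \<and> (AE x in circle. 1 < p x) \<and>
    closed_subspace_Lp p circle_continuous \<and>
    variable_exponent q \<and> (AE x in circle. 1 / p x + 1 / q x = 1) \<and>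
    (\<exists>(\<phi> :: nat \<Rightarrow> real \<Rightarrow> real) (\<nu> :: nat \<Rightarrow> nat) (\<mu> :: nat \<Rightarrow> nat).
      (\<forall>n\<ge>2. admissible_phi n (\<phi> n)) \<and>
      strict_mono \<nu> \<and> (\<forall>k. 2 \<le> \<nu> k) \<and>
      strict_mono \<mu> \<and> (\<forall>k. 2 \<le> \<mu> k) \<and>
      (AE x in circle. summable (kolmogorov_term \<phi> \<nu> x)) \<and>
      (AE x in circle. summable (marcinkiewicz_term \<phi> \<mu> x)) \<and>
      kolmogorov_fun \<phi> \<nu> \<in> variable_Lp q \<and>
      marcinkiewicz_fun \<phi> \<mu> \<in> variable_Lp q \<and>
      (AE x in circle.
        limsup (\<lambda>n. ereal (cmod (fourier_sum n x (kolmogorov_fun \<phi> \<nu>)))) = \<infinity>) \<and>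
      (AE x in circle.
        limsup (\<lambda>n. ereal (cmod (fourier_sum n x (marcinkiewicz_fun \<phi> \<mu>)))) < \<infinity>) \<and>
      (AE x in circle.
        \<not> convergent (\<lambda>n. fourier_sum n x (marcinkiewicz_fun \<phi> \<mu>))))"
proof -
  have "\<exists>f. 2 \<le> n \<longrightarrow> admissible_phi n f" for n
    using exists_admissible_phi by (cases "2 \<le> n") auto
  then obtain \<phi> where \<phi>: "\<And>n. 2 \<le> n \<Longrightarrow> admissible_phi n (\<phi> n)" by metis
  obtain \<nu> R T where "lacunary_sequence \<phi> \<nu> R T" using exists_lacunary_sequence[OF \<phi>] by blast
  then interpret lacunary_sequence \<phi> \<nu> R T .
  interpret K: weighted_lacunary \<phi> \<nu> R T "\<lambda>k. 1 / sqrt (ln (real (\<nu> k)))" by (rule weighted_kolmogorov)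
  interpret M: weighted_lacunary \<phi> \<nu> R T "\<lambda>k. 1 / ln (real (\<nu> k))" by (rule weighted_marcinkiewicz)
  have K_eq: "kolmogorov_fun \<phi> \<nu> = (\<lambda>x. complex_of_real (K.series x))"
    by (simp add: kolmogorov_fun_def[abs_def] kolmogorov_term_def[abs_def] K.series_def)
  have M_eq: "marcinkiewicz_fun \<phi> \<nu> = (\<lambda>x. complex_of_real (M.series x))"
    by (simp add: marcinkiewicz_fun_def[abs_def] marcinkiewicz_term_def[abs_def] M.series_def)
  have sK: "AE x in circle. summable (kolmogorov_term \<phi> \<nu> x)"
    using AE_summable[of "\<lambda>k. 1 / sqrt (ln (real (\<nu> k)))"]
  proof (rule AE_mp, intro AE_I2 impI)
    fix x assume "summable (\<lambda>k. \<bar>1 / sqrt (ln (real (\<nu> k))) * \<phi> (\<nu> k) x\<bar>)"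
    from summable_rabs_cancel[OF this] show "summable (kolmogorov_term \<phi> \<nu> x)"
      by (simp add: kolmogorov_term_def[abs_def])
  qed
  have sM: "AE x in circle. summable (marcinkiewicz_term \<phi> \<nu> x)"
    using AE_summable[of "\<lambda>k. 1 / ln (real (\<nu> k))"]
  proof (rule AE_mp, intro AE_I2 impI)
    fix x assume "summable (\<lambda>k. \<bar>1 / ln (real (\<nu> k)) * \<phi> (\<nu> k) x\<bar>)"
    from summable_rabs_cancel[OF this] show "summable (marcinkiewicz_term \<phi> \<nu> x)"
      by (simp add: marcinkiewicz_term_def[abs_def])
  qed
  have "filterlim (\<lambda>k. sqrt (ln (real (\<nu> (Suc k))))) at_top sequentially"
    by (rule filterlim_compose[OF sqrt_at_top]) (rule filterlim_compose[OF ln_nu_tendsto filterlim_Suc])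
  moreover have "sqrt (ln (real (\<nu> (Suc k)))) \<le> 1 / sqrt (ln (real (\<nu> (Suc k)))) * ln (real (\<nu> (Suc k)))" for k
    using ln_nu_Suc_ge[of k] by (simp add: real_div_sqrt)
  ultimately have dK: "AE x in circle. limsup (\<lambda>n. ereal (cmod (fourier_sum n x (kolmogorov_fun \<phi> \<nu>)))) = \<infinity>"
    unfolding K_eq by (rule K.AE_limsup_infinite[rotated])
  have one: "1 / ln (real (\<nu> (Suc k))) * ln (real (\<nu> (Suc k))) = 1" for k
    using ln_nu_Suc_ge[of k] by simp
  have p1: "AE x in circle. 1 < p x"
  proof (rule AE_I2)
    show "1 < p x" for x using p_ge[of x] by linarith
  qed
  have pq: "AE x in circle. 1 / p x + 1 / q x = 1" using conjugate by (rule AE_I2)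
  show ?thesis
  proof (intro exI conjI allI impI)
    show "variable_exponent p" "AE x in circle. 1 < p x" "closed_subspace_Lp p circle_continuous"
      "variable_exponent q" "AE x in circle. 1 / p x + 1 / q x = 1"
      by (rule variable_exponent_p p1 circle_continuous_closed variable_exponent_q pq)+
    show "admissible_phi n (\<phi> n)" if "2 \<le> n" for n using that by (rule \<phi>)
    show "strict_mono \<nu>" "strict_mono \<nu>" "2 \<le> \<nu> k" "2 \<le> \<nu> k" for k by (rule nu_mono nu_ge)+
    show "AE x in circle. summable (kolmogorov_term \<phi> \<nu> x)"
      "AE x in circle. summable (marcinkiewicz_term \<phi> \<nu> x)" by (rule sK sM)+
    show "kolmogorov_fun \<phi> \<nu> \<in> variable_Lp q" "marcinkiewicz_fun \<phi> \<nu> \<in> variable_Lp q"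
      unfolding K_eq M_eq by (rule K.series_in_variable_Lp M.series_in_variable_Lp)+
    show "AE x in circle. limsup (\<lambda>n. ereal (cmod (fourier_sum n x (kolmogorov_fun \<phi> \<nu>)))) = \<infinity>" by (rule dK)
    show "AE x in circle. limsup (\<lambda>n. ereal (cmod (fourier_sum n x (marcinkiewicz_fun \<phi> \<nu>)))) < \<infinity>"
      "AE x in circle. \<not> convergent (\<lambda>n. fourier_sum n x (marcinkiewicz_fun \<phi> \<nu>))"
      unfolding M_eq by (rule M.AE_bounded_divergent[OF one])+
  qed
qed

end
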